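(* Assume $G$ is semisimple of adjoint type and $\Bbbk$ is any field. Then $R_T^\wedge$ is a free $(R_T^\wedge)^W$-module of rank $|W|$; more precisely it admits a basis $(\mathsf e_w)_{w\in W}$ such that $$\det\big((w(\mathsf e_v))_{v,w\in W}\big)=\Big((-1)^{|\Phi^\vee_+|}e^{-\rho^\vee}\mathsf d\Big)^{|W|/2},\qquad \mathsf d=\prod_{\alpha^\vee\in\Phi^\vee_+}(1-e^{\alpha^\vee}).$$
   Context: $G$ complex semisimple adjoint, $T$ a maximal torus, $W$ the Weyl group, $\Phi^\vee$ the coroots, $\Phi^\vee_+$ the positive coroots, $\rho^\vee$ half their sum. $R_T=\Bbbk[X_*(T)]$ with basis $e^\lambda$, $\lambda\in X_*(T)$; $R_T^\wedge$ is the completion at the kernel of the augmentation $e^\lambda\mapsto1$. $W$ acts naturally. *)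

theory Defs
  imports "HOL-Analysis.Analysis" "HOL-Library.Poly_Mapping" "HOL-Combinatorics.Permutations"
begin

(* Root datum conventions.  X^*(T) = Y = int^'n (rank = CARD('n)), pairing = dot product.
  Cocharacter lattice Y = X_*(T) = int^'n.  R_T = k[Y] is the group algebra
  ((int^'n) \<Rightarrow>\<^sub>0 'k), with e^l = Poly_Mapping.single l 1. *)

type_synonym 'n lat = "int ^ 'n"

definition pair :: "'n::finite lat \<Rightarrow> 'n lat \<Rightarrow> int" where
  "pair x y = (\<Sum>i\<in>UNIV. x $ i * y $ i)"

(* Reduced root datum (\<Phi> roots in X, cor the bijection onto coroots in Y), semisimple of
  adjoint type: the roots span X over the integers. *)
definition adjoint_root_datum :: "'n::finite lat set \<Rightarrow> ('n lat \<Rightarrow> 'n lat) \<Rightarrow> bool" where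
  "adjoint_root_datum \<Phi> cor \<longleftrightarrow>
     finite \<Phi> \<and> inj_on cor \<Phi> \<and>
     (\<forall>\<alpha>\<in>\<Phi>. pair \<alpha> (cor \<alpha>) = 2) \<and>
     (\<forall>\<alpha>\<in>\<Phi>. \<forall>\<beta>\<in>\<Phi>. \<beta> - pair \<beta> (cor \<alpha>) *s \<alpha> \<in> \<Phi>) \<and>
     (\<forall>\<alpha>\<in>\<Phi>. \<forall>\<beta>\<in>\<Phi>. cor \<beta> - pair \<alpha> (cor \<beta>) *s cor \<alpha> \<in> cor ` \<Phi>) \<and>
     (\<forall>\<alpha>\<in>\<Phi>. 2 *s \<alpha> \<notin> \<Phi>) \<and>
     (\<forall>x. \<exists>c. x = (\<Sum>\<alpha>\<in>\<Phi>. c \<alpha> *s \<alpha>))"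


definition coreflection :: "('n::finite lat \<Rightarrow> 'n lat) \<Rightarrow> 'n lat \<Rightarrow> 'n lat \<Rightarrow> 'n lat" where
  "coreflection cor \<alpha> y = y - pair \<alpha> y *s cor \<alpha>"

inductive_set weyl_group :: "'n::finite lat set \<Rightarrow> ('n lat \<Rightarrow> 'n lat) \<Rightarrow> ('n lat \<Rightarrow> 'n lat) set"
  for \<Phi> cor where
  id: "id \<in> weyl_group \<Phi> cor"
| refl: "\<alpha> \<in> \<Phi> \<Longrightarrow> w \<in> weyl_group \<Phi> cor \<Longrightarrow> coreflection cor \<alpha> \<circ> w \<in> weyl_group \<Phi> cor"

(* Positive roots determined by a regular (integral) element h. *)
definition pos_roots :: "'n::finite lat set \<Rightarrow> 'n lat \<Rightarrow> 'n lat set" where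
  "pos_roots \<Phi> h = {\<alpha>\<in>\<Phi>. pair \<alpha> h > 0}"

type_synonym ('n, 'k) RT = "'n lat \<Rightarrow>\<^sub>0 'k"

definition eT :: "'n::finite lat \<Rightarrow> ('n, 'k::field) RT" where
  "eT l = Poly_Mapping.single l 1"

definition wact :: "('n::finite lat \<Rightarrow> 'n lat) \<Rightarrow> ('n, 'k::field) RT \<Rightarrow> ('n, 'k) RT" where
  "wact w f = (\<Sum>l\<in>Poly_Mapping.keys f. Poly_Mapping.single (w l) (Poly_Mapping.lookup f l))"

definition augmentation :: "('n::finite, 'k::field) RT \<Rightarrow> 'k" where
  "augmentation f = (\<Sum>l\<in>Poly_Mapping.keys f. Poly_Mapping.lookup f l)"

inductive aug_pow :: "nat \<Rightarrow> ('n::finite, 'k::field) RT \<Rightarrow> bool" where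
  zero: "aug_pow 0 f"
| mult: "augmentation a = 0 \<Longrightarrow> aug_pow n b \<Longrightarrow> aug_pow (Suc n) (a * b)"
| add: "aug_pow n f \<Longrightarrow> aug_pow n g \<Longrightarrow> aug_pow n (f + g)"

(* The completion R_T^\<wedge>: I-adic Cauchy sequences modulo null sequences. *)
definition cauchy :: "(nat \<Rightarrow> ('n::finite, 'k::field) RT) \<Rightarrow> bool" where
  "cauchy s \<longleftrightarrow> (\<forall>n. \<exists>N. \<forall>m\<ge>N. \<forall>m'\<ge>N. aug_pow n (s m - s m'))"

definition ceq :: "(nat \<Rightarrow> ('n::finite, 'k::field) RT) \<Rightarrow> (nat \<Rightarrow> ('n, 'k) RT) \<Rightarrow> bool" where
  "ceq s t \<longleftrightarrow> (\<forall>n. \<exists>N. \<forall>m\<ge>N. aug_pow n (s m - t m))"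

(* W-invariant elements of the completion (action extended termwise = continuously). *)
definition cinvariant :: "('n::finite lat \<Rightarrow> 'n lat) set \<Rightarrow> (nat \<Rightarrow> ('n, 'k::field) RT) \<Rightarrow> bool" where
  "cinvariant W s \<longleftrightarrow> cauchy s \<and> (\<forall>w\<in>W. ceq (\<lambda>m. wact w (s m)) s)"

definition detI :: "'a set \<Rightarrow> ('a \<Rightarrow> 'a \<Rightarrow> 'r::comm_ring_1) \<Rightarrow> 'r" where
  "detI I M = (\<Sum>\<sigma>\<in>{\<sigma>. \<sigma> permutes I}. of_int (sign \<sigma>) * (\<Prod>v\<in>I. M v (\<sigma> v)))"

end

theory Submission
  imports Defs "HOL-Computational_Algebra.Formal_Power_Series" "HOL-Computational_Algebra.Polynomial"
begin

text \<open>
  Steinberg's proof of Pittie's theorem, transported to the completion.  For \<open>v\<close> in the Weyl group let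
  \<open>\<lambda>\<^sub>v\<close> be the sum of the fundamental coweights \<open>\<omega>\<^sub>\<sigma>\<close> over the simple roots \<open>\<sigma>\<close> with \<open>v\<^sup>-\<^sup>1\<sigma> < 0\<close>, and let
  \<open>e\<^sub>v\<close> be the exponential of \<open>v\<^sup>-\<^sup>1\<lambda>\<^sub>v\<close>.  Subtracting column \<open>s\<^sub>\<alpha>w\<close> from column \<open>w\<close> shows that any
  determinant \<open>det (w g\<^sub>v)\<close> is divisible by \<open>(1 - e\<^bsup>\<alpha>\<^esup>)\<^bsup>|W|/2\<^esup>\<close> for every positive coroot \<open>\<alpha>\<close>, hence by the
  \<open>|W|/2\<close>-th power \<open>\<Delta>\<close> of the Weyl denominator.  For \<open>g = e\<close> both sides have the same leading
  exponential, contributed by the identity permutation alone, and the quotient is Weyl invariant up to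
  sign; as every orbit sums to zero, it has no other terms, so \<open>det (w e\<^sub>v) = \<Delta>\<close>.  Cramer's rule then
  gives coordinates over the invariants in the group algebra.  They pass to the completion, and are
  unique there, because the powers of the augmentation ideal are the balls of a valuation, so that
  division by \<open>\<Delta>\<close> shifts the filtration by a bounded amount.
\<close>

subsection \<open>Determinants indexed by a finite set\<close>

text \<open>Adjoint type makes the simple roots a basis of the characters over the integers, so the
  fundamental coweights, and with them \<rho>, lie in the cocharacter lattice; this is what makes
  Steinberg's exponents available. A coroot may still be divisible in that lattice: in rank one it
  is twice the fundamental coweight, and 1 - e^(2\<omega>) = (1 - e^\<omega>)(1 + e^\<omega>). The
  factors of \<Delta> are therefore not prime in general, and divisibility by their product rests on
  each being a non-zero-divisor modulo every other. The field is arbitrary, so the invariance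
  argument looks only at supports of group algebra elements, which a change of sign leaves alone.
  Heights of exponents are measured by the sum of the positive roots, a functional that is positive
  on positive coroots. Since \<Delta> lies in the augmentation ideal it is not a unit of the
  completion, so freeness cannot be had by inverting it.\<close>

lemma detI_cong:
  assumes "\<And>v w. v \<in> I \<Longrightarrow> w \<in> I \<Longrightarrow> M v w = N v w"
  shows "detI I M = detI I N"
  unfolding detI_def
  by (intro sum.cong HOL.refl arg_cong2[where f = "(*)"] prod.cong)
     (auto simp: assms permutes_in_image)

lemma detI_transpose:
  assumes "finite I"
  shows "detI I (\<lambda>v w. M w v) = detI I M"
proof -
  have "detI I (\<lambda>v w. M w v) =
        (\<Sum>\<sigma>\<in>{\<sigma>. \<sigma> permutes I}. of_int (sign (inv \<sigma>)) * (\<Prod>v\<in>I. M (inv \<sigma> v) v))"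
    unfolding detI_def by (rule sum_permutations_inverse)
  also have "\<dots> = detI I M"
    unfolding detI_def
  proof (intro sum.cong HOL.refl arg_cong2[where f = "(*)"])
    fix \<sigma> assume "\<sigma> \<in> {\<sigma>. \<sigma> permutes I}"
    then have \<sigma>: "\<sigma> permutes I" by simp
    then have "permutation \<sigma>"
      using assms by (auto simp: permutation_permutes)
    then show "of_int (sign (inv \<sigma>)) = of_int (sign \<sigma>)"
      by (simp add: sign_inverse)
    show "(\<Prod>v\<in>I. M (inv \<sigma> v) v) = (\<Prod>v\<in>I. M v (\<sigma> v))"
      using prod.permute[OF \<sigma>, of "\<lambda>v. M (inv \<sigma> v) v"]
      by (simp add: permutes_inverses[OF \<sigma>] comp_def)
  qed
  finally show ?thesis .
qed

lemma sign_compose_permutes: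
  assumes "finite I" "\<pi> permutes I" "\<sigma> permutes I"
  shows "sign (\<pi> \<circ> \<sigma>) = sign \<pi> * sign \<sigma>"
  using assms by (intro sign_compose) (auto simp: permutation_permutes)

lemma detI_permute_columns:
  fixes M :: "'a \<Rightarrow> 'a \<Rightarrow> 'b::comm_ring_1"
  assumes "finite I" and \<pi>: "\<pi> permutes I"
  shows "detI I (\<lambda>v w. M v (\<pi> w)) = of_int (sign \<pi>) * detI I M"
proof -
  have "of_int (sign \<pi>) * detI I M =
     (\<Sum>\<sigma>\<in>{\<sigma>. \<sigma> permutes I}. of_int (sign \<pi>) *
        (of_int (sign (\<pi> \<circ> \<sigma>)) * (\<Prod>v\<in>I. M v ((\<pi> \<circ> \<sigma>) v))))"
    unfolding detI_def sum_distrib_left by (rule setum_permutations_compose_left[OF \<pi>])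
  also have "\<dots> = detI I (\<lambda>v w. M v (\<pi> w))"
    unfolding detI_def
  proof (intro sum.cong HOL.refl)
    fix \<sigma> assume "\<sigma> \<in> {\<sigma>. \<sigma> permutes I}"
    then have "sign (\<pi> \<circ> \<sigma>) = sign \<pi> * sign \<sigma>"
      using assms by (intro sign_compose_permutes) auto
    then have "of_int (sign \<pi>) * (of_int (sign (\<pi> \<circ> \<sigma>)) :: 'b) = of_int (sign \<sigma>)"
      unfolding of_int_mult[symmetric] by simp
    then show "of_int (sign \<pi>) * (of_int (sign (\<pi> \<circ> \<sigma>)) * (\<Prod>v\<in>I. M v ((\<pi> \<circ> \<sigma>) v))) =
          of_int (sign \<sigma>) * (\<Prod>v\<in>I. M v (\<pi> (\<sigma> v)))"
      unfolding mult.assoc[symmetric] comp_def by simp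
  qed
  finally show ?thesis ..
qed

text \<open>Left multiplication by the transposition matches even with odd permutations, so the two
  halves cancel term by term. Deducing this from a determinant equal to its own negative would leave
  a factor 2, which may be zero here.\<close>

lemma detI_identical_columns:
  assumes fin: "finite I" and jk: "j \<in> I" "k \<in> I" "j \<noteq> k"
    and eq: "\<And>v. v \<in> I \<Longrightarrow> M v j = M v k"
  shows "detI I M = 0"
proof -
  let ?\<tau> = "Transposition.transpose j k"
  let ?P = "{\<sigma>. \<sigma> permutes I}"
  let ?f = "\<lambda>\<sigma>. of_int (sign \<sigma>) * (\<Prod>v\<in>I. M v (\<sigma> v))"
  have \<tau>: "?\<tau> permutes I"
    using jk by (simp add: permutes_swap_id)
  have fP: "finite ?P"
    using fin by (rule finite_permutations)
  have sgn: "sign (?\<tau> \<circ> \<sigma>) = - sign \<sigma>" if "\<sigma> \<in> ?P" for \<sigma>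
    using sign_compose_permutes[OF fin \<tau>, of \<sigma>] that jk by (simp add: sign_swap_id)
  have f\<tau>: "?f (?\<tau> \<circ> \<sigma>) = - ?f \<sigma>" if "\<sigma> \<in> ?P" for \<sigma>
  proof -
    have "(\<Prod>v\<in>I. M v ((?\<tau> \<circ> \<sigma>) v)) = (\<Prod>v\<in>I. M v (\<sigma> v))"
      using eq by (intro prod.cong) (auto simp: Transposition.transpose_def)
    then show ?thesis using sgn[OF that] by simp
  qed
  let ?E = "{\<sigma> \<in> ?P. sign \<sigma> = 1}" and ?O = "{\<sigma> \<in> ?P. sign \<sigma> \<noteq> 1}"
  have bij: "bij_betw (\<lambda>\<sigma>. ?\<tau> \<circ> \<sigma>) ?E ?O"
  proof (rule bij_betw_byWitness[where f' = "\<lambda>\<sigma>. ?\<tau> \<circ> \<sigma>"])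
    show "(\<lambda>\<sigma>. ?\<tau> \<circ> \<sigma>) ` ?E \<subseteq> ?O"
    proof (rule image_subsetI)
      fix \<sigma> assume \<sigma>: "\<sigma> \<in> ?E"
      then show "?\<tau> \<circ> \<sigma> \<in> ?O"
        using sgn[of \<sigma>] permutes_compose[OF _ \<tau>] by simp
    qed
    show "(\<lambda>\<sigma>. ?\<tau> \<circ> \<sigma>) ` ?O \<subseteq> ?E"
    proof (rule image_subsetI)
      fix \<sigma> assume \<sigma>: "\<sigma> \<in> ?O"
      then have "sign \<sigma> = - 1" by (auto simp: sign_def)
      then show "?\<tau> \<circ> \<sigma> \<in> ?E"
        using \<sigma> sgn[of \<sigma>] permutes_compose[OF _ \<tau>] by simp
    qed
  qed (auto simp: comp_def)
  have "detI I M = sum ?f ?E + sum ?f ?O"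
    unfolding detI_def using fP
    by (subst sum.union_disjoint[symmetric]) (auto intro: sum.cong)
  also have "sum ?f ?O = (\<Sum>\<sigma>\<in>?E. ?f (?\<tau> \<circ> \<sigma>))"
    by (rule sum.reindex_bij_betw[OF bij, symmetric])
  also have "\<dots> = - sum ?f ?E"
    unfolding sum_negf[symmetric] by (intro sum.cong HOL.refl f\<tau>) auto
  finally show ?thesis by simp
qed

text \<open>Each permutation meets column \<open>j\<close> in exactly one row. The cofactor is
  encoded as the determinant with column \<open>j\<close> replaced by a unit vector, which avoids
  minors over smaller index sets; linearity in a column is read off from this formula.\<close>

lemma detI_expand_column:
  assumes fin: "finite I" and j: "j \<in> I"
  shows "detI I (\<lambda>v w. if w = j then c v else M v w) =
    (\<Sum>u\<in>I. c u * detI I (\<lambda>v w. if w = j then (if v = u then 1 else 0) else M v w))"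
proof -
  have key: "(\<Prod>v\<in>I. if \<sigma> v = j then c v else M v (\<sigma> v)) =
      (\<Sum>u\<in>I. c u * (\<Prod>v\<in>I. if \<sigma> v = j then (if v = u then 1 else 0) else M v (\<sigma> v)))"
    if \<sigma>: "\<sigma> permutes I" for \<sigma>
  proof -
    define i where "i = inv \<sigma> j"
    have i: "i \<in> I" "\<sigma> i = j"
      using j \<sigma> by (auto simp: i_def permutes_inv permutes_in_image permutes_inverses)
    have ii: "\<sigma> v = j \<longleftrightarrow> v = i" for v
      using i(2) permutes_inj[OF \<sigma>] by (auto dest: injD)
    let ?p = "\<Prod>v\<in>I - {i}. M v (\<sigma> v)"
    have 1: "(\<Prod>v\<in>I. if \<sigma> v = j then d v else M v (\<sigma> v)) = d i * ?p" for d
    proof -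
      have "(\<Prod>v\<in>I. if \<sigma> v = j then d v else M v (\<sigma> v)) =
        d i * (\<Prod>v\<in>I - {i}. if \<sigma> v = j then d v else M v (\<sigma> v))"
        using prod.remove[OF fin i(1), of "\<lambda>v. if \<sigma> v = j then d v else M v (\<sigma> v)"] i(2) by simp
      then show ?thesis by (simp add: ii)
    qed
    have "(\<Sum>u\<in>I. c u * ((if i = u then 1 else 0) * ?p)) = (\<Sum>u\<in>I. if i = u then c u * ?p else 0)"
      by (intro sum.cong) auto
    also have "\<dots> = c i * ?p" using fin i by simp
    finally show ?thesis unfolding 1 by simp
  qed
  show ?thesis
    unfolding detI_def sum_distrib_left
    by (subst sum.swap, intro sum.cong HOL.refl)
       (simp add: key sum_distrib_left mult.left_commute)
qed

lemma detI_expand_row: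
  assumes fin: "finite I" and j: "j \<in> I"
  shows "detI I (\<lambda>v w. if v = j then c w else M v w) =
    (\<Sum>u\<in>I. c u * detI I (\<lambda>v w. if v = j then (if w = u then 1 else 0) else M v w))"
proof -
  have "detI I (\<lambda>v w. if v = j then c w else M v w) =
        detI I (\<lambda>v w. if w = j then c v else M w v)"
    by (subst detI_transpose[OF fin, symmetric]) simp
  also have "\<dots> = (\<Sum>u\<in>I. c u * detI I (\<lambda>v w. if w = j then (if v = u then 1 else 0) else M w v))"
    by (rule detI_expand_column[OF assms])
  also have "\<dots> = (\<Sum>u\<in>I. c u * detI I (\<lambda>v w. if v = j then (if w = u then 1 else 0) else M v w))"
    using detI_transpose[OF fin, where M = "\<lambda>v w. if v = j then (if w = _ then 1 else 0) else M v w"]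
    by (intro sum.cong HOL.refl arg_cong2[where f = "(*)"])
  finally show ?thesis .
qed

lemma detI_row_sum:
  assumes fin: "finite I" and j: "j \<in> I"
  shows "detI I (\<lambda>v w. if v = j then (\<Sum>k\<in>K. a k * r k w) else M v w) =
    (\<Sum>k\<in>K. a k * detI I (\<lambda>v w. if v = j then r k w else M v w))"
  unfolding detI_expand_row[OF assms, of "\<lambda>w. \<Sum>k\<in>K. a k * r k w"]
    detI_expand_row[OF assms, of "r _"]
  by (simp only: sum_distrib_left sum_distrib_right, subst sum.swap) (simp only: mult.assoc)

lemma detI_replace_row:
  assumes fin: "finite I" and "j \<in> I" "k \<in> I"
  shows "detI I (\<lambda>v w. if v = j then M k w else M v w) = (if k = j then detI I M else 0)"
proof (cases "k = j")
  case True
  then show ?thesis by (auto intro!: detI_cong)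
next
  case False
  have "detI I (\<lambda>v w. if v = j then M k w else M v w) =
        detI I (\<lambda>v w. if w = j then M k v else M w v)"
    by (subst detI_transpose[OF fin, symmetric]) simp
  also have "\<dots> = 0"
    by (rule detI_identical_columns[OF fin assms(2,3)]) (use False in auto)
  finally show ?thesis using False by simp
qed

text \<open>Either replacement kills all permutations except those with
  \<open>\<sigma> j = k\<close>, and on these the remaining factors agree. This turns row cofactors
  into column cofactors.\<close>

lemma detI_cofactor:
  assumes fin: "finite I" and "j \<in> I" "k \<in> I"
  shows "detI I (\<lambda>v w. if v = j then (if w = k then 1 else 0) else M v w) =
         detI I (\<lambda>v w. if w = k then (if v = j then 1 else 0) else M v w)"
  unfolding detI_def
proof (intro sum.cong HOL.refl arg_cong2[where f = "(*)"])
  fix \<sigma> assume "\<sigma> \<in> {\<sigma>. \<sigma> permutes I}"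
  then have \<sigma>: "\<sigma> permutes I" by simp
  have inj: "\<sigma> v = \<sigma> v' \<longleftrightarrow> v = v'" for v v'
    using permutes_inj[OF \<sigma>] by (auto dest: injD)
  show "(\<Prod>v\<in>I. if v = j then (if \<sigma> v = k then 1 else 0) else M v (\<sigma> v)) =
        (\<Prod>v\<in>I. if \<sigma> v = k then (if v = j then 1 else 0) else M v (\<sigma> v))"
  proof (cases "\<sigma> j = k")
    case True
    then show ?thesis using inj by (intro prod.cong) auto
  next
    case False
    define i where "i = inv \<sigma> k"
    have i: "i \<in> I" "\<sigma> i = k"
      using assms \<sigma> by (auto simp: i_def permutes_inv permutes_in_image permutes_inverses)
    have "(\<Prod>v\<in>I. if v = j then (if \<sigma> v = k then 1 else 0) else M v (\<sigma> v)) = 0"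
      using False assms by (intro prod_zero bexI[of _ j]) auto
    moreover have "(\<Prod>v\<in>I. if \<sigma> v = k then (if v = j then 1 else 0) else M v (\<sigma> v)) = 0"
      using False assms i by (intro prod_zero bexI[of _ i]) auto
    ultimately show ?thesis by simp
  qed
qed

text \<open>Cofactors of column \<open>w\<close> combined with the entries of column
  \<open>u\<close> give the determinant with column \<open>w\<close> overwritten by column
  \<open>u\<close>, which vanishes unless \<open>w = u\<close>. The rule is stated without
  division.\<close>

lemma detI_cramer:
  assumes fin: "finite I" and u: "u \<in> I"
  shows "(\<Sum>v\<in>I. M v u * detI I (\<lambda>v' w. if v' = v then y w else M v' w)) = y u * detI I M"
proof -
  let ?C = "\<lambda>v w. detI I (\<lambda>v' w'. if w' = w then (if v' = v then 1 else 0) else M v' w')"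
  have "(\<Sum>v\<in>I. M v u * detI I (\<lambda>v' w. if v' = v then y w else M v' w)) =
        (\<Sum>v\<in>I. M v u * (\<Sum>w\<in>I. y w * ?C v w))"
    by (intro sum.cong HOL.refl arg_cong2[where f = "(*)"])
       (simp add: detI_expand_row[OF fin, of _ y] detI_cofactor[OF fin])
  also have "\<dots> = (\<Sum>w\<in>I. y w * (\<Sum>v\<in>I. M v u * ?C v w))"
    unfolding sum_distrib_left by (subst sum.swap) (simp add: mult.left_commute)
  also have "\<dots> = (\<Sum>w\<in>I. y w * (if w = u then detI I M else 0))"
  proof (intro sum.cong HOL.refl arg_cong2[where f = "(*)"])
    fix w assume w: "w \<in> I"
    have "(\<Sum>v\<in>I. M v u * ?C v w) = detI I (\<lambda>v w'. if w' = w then M v u else M v w')"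
      by (rule detI_expand_column[OF fin w, symmetric])
    also have "\<dots> = (if w = u then detI I M else 0)"
    proof (cases "w = u")
      case True
      then show ?thesis by (auto intro!: detI_cong)
    next
      case False
      then show ?thesis
        using detI_identical_columns[OF fin w u False, of "\<lambda>v w'. if w' = w then M v u else M v w'"]
        by simp
    qed
    finally show "(\<Sum>v\<in>I. M v u * ?C v w) = (if w = u then detI I M else 0)" .
  qed
  also have "\<dots> = y u * detI I M"
    using fin u by (simp add: if_distrib[of "(*) _"] cong: if_cong)
  finally show ?thesis .
qed

text \<open>If column \<open>w\<close> is congruent to column \<open>s w\<close> modulo \<open>p\<close>, subtracting column \<open>s w\<close> from
  column \<open>w\<close> makes a factor \<open>p\<close> appear; no interference occurs as long as \<open>s\<close> leaves \<open>H\<close>.\<close>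

lemma detI_dvd_power:
  fixes p :: "'r::comm_ring_1"
  assumes fin: "finite I" and H: "H \<subseteq> I"
    and s: "\<And>w. w \<in> H \<Longrightarrow> s w \<in> I - H"
    and dvd: "\<And>v w. v \<in> I \<Longrightarrow> w \<in> H \<Longrightarrow> p dvd M v w - M v (s w)"
  shows "p ^ card H dvd detI I M"
proof -
  obtain q where q: "\<And>v w. v \<in> I \<Longrightarrow> w \<in> H \<Longrightarrow> M v w - M v (s w) = p * q v w"
    using dvd unfolding dvd_def by metis
  have "finite H" using fin H by (rule rev_finite_subset)
  have main: "T \<subseteq> H \<Longrightarrow> detI I M = p ^ card T * detI I (\<lambda>v w. if w \<in> T then q v w else M v w)"
    if "finite T" for T
    using that
  proof (induction T)
    case empty
    then show ?case by simp
  next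
    case (insert w T)
    let ?N = "\<lambda>v w. if w \<in> T then q v w else M v w"
    let ?repl = "\<lambda>c. detI I (\<lambda>v w'. if w' = w then c v else ?N v w')"
    have w: "w \<in> I" "s w \<in> I" "s w \<notin> T" "s w \<noteq> w" "w \<in> H"
      using insert.prems s[of w] H by auto
    have "detI I ?N = ?repl (\<lambda>v. p * q v w + M v (s w))"
      using insert.hyps(2) w q by (intro detI_cong) (auto simp: algebra_simps)
    also have "\<dots> = p * ?repl (\<lambda>v. q v w) + ?repl (\<lambda>v. M v (s w))"
      using detI_expand_column[OF fin w(1), of "\<lambda>v. p * q v w + M v (s w)" ?N]
        detI_expand_column[OF fin w(1), of "\<lambda>v. q v w" ?N]
        detI_expand_column[OF fin w(1), of "\<lambda>v. M v (s w)" ?N]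
      by (simp only: distrib_right sum.distrib sum_distrib_left mult.assoc)
    also have "?repl (\<lambda>v. M v (s w)) = 0"
      using w by (intro detI_identical_columns[OF fin w(1,2)]) auto
    also have "?repl (\<lambda>v. q v w) = detI I (\<lambda>v w'. if w' \<in> insert w T then q v w' else M v w')"
      by (intro detI_cong) auto
    finally show ?case using insert by (simp add: mult.assoc mult.left_commute)
  qed
  show ?thesis by (rule dvdI[OF main[OF \<open>finite H\<close> order_refl]])
qed

subsection \<open>The group algebra of a lattice\<close>

lemma poly_mapping_single_induct [case_names single add]:
  fixes P :: "('l \<Rightarrow>\<^sub>0 'k::comm_monoid_add) \<Rightarrow> bool"
  assumes single: "\<And>l c. P (Poly_Mapping.single l c)"
    and add: "\<And>f g. P f \<Longrightarrow> P g \<Longrightarrow> P (f + g)"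
  shows "P f"
proof -
  have "P (\<Sum>l\<in>A. Poly_Mapping.single l (Poly_Mapping.lookup f l))" if "finite A" for A
    using that
  proof induction
    case empty
    show ?case using single[of undefined 0] by simp
  qed (simp add: single add)
  moreover have "(\<Sum>l\<in>Poly_Mapping.keys f. Poly_Mapping.single l (Poly_Mapping.lookup f l)) = f"
    by (rule poly_mapping_eqI)
       (simp add: lookup_sum lookup_single when_def in_keys_iff)
  ultimately show ?thesis
    using finite_keys[of f] by metis
qed

lemma sum_keys_single:
  "F l 0 = 0 \<Longrightarrow>
   (\<Sum>k\<in>Poly_Mapping.keys (Poly_Mapping.single l c). F k (Poly_Mapping.lookup (Poly_Mapping.single l c) k)) = F l c"
  by simp

lemma sum_keys_mult:
  fixes F :: "'l::monoid_add \<Rightarrow> 'k::semiring_0 \<Rightarrow> 's::semiring_0"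
  assumes zero: "\<And>l. F l 0 = 0" and add: "\<And>l a b. F l (a + b) = F l a + F l b"
    and mult: "\<And>l l' a b. F (l + l') (a * b) = F l a * F l' b"
  shows "(\<Sum>l\<in>Poly_Mapping.keys (f * g). F l (Poly_Mapping.lookup (f * g) l)) =
    (\<Sum>l\<in>Poly_Mapping.keys f. F l (Poly_Mapping.lookup f l)) *
    (\<Sum>l\<in>Poly_Mapping.keys g. F l (Poly_Mapping.lookup g l))"
proof -
  define S where "S = (\<lambda>f. \<Sum>l\<in>Poly_Mapping.keys f. F l (Poly_Mapping.lookup f l))"
  have S_add: "S (f + g) = S f + S g" for f g
    unfolding S_def by (rule setsum_keys_plus_distrib) (auto simp: zero add)
  have S_single: "S (Poly_Mapping.single l c) = F l c" for l c
    unfolding S_def by (rule sum_keys_single) (rule zero)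
  have "S (f * g) = S f * S g"
  proof (induction f rule: poly_mapping_single_induct)
    case (single l c)
    show ?case
      by (induction g rule: poly_mapping_single_induct)
         (simp_all add: S_add S_single mult_single mult distrib_left)
  qed (simp add: S_add distrib_right)
  then show ?thesis unfolding S_def .
qed

lemma eT_0 [simp]: "eT 0 = 1"
  by (simp add: eT_def)

lemma eT_add: "eT (a + b) = eT a * eT b"
  by (simp add: eT_def mult_single)

lemma eT_mult_uminus [simp]: "eT (- a) * eT a = 1" "eT a * eT (- a) = 1"
  by (simp_all flip: eT_add)

lemma eT_sum: "eT (sum f A) = (\<Prod>i\<in>A. eT (f i))"
  by (induction A rule: infinite_finite_induct) (simp_all add: eT_add)

lemma single_eq_scalar_eT: "Poly_Mapping.single l c = Poly_Mapping.single 0 c * eT l"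
  by (simp add: eT_def mult_single)

lemma wact_add: "wact w (f + g) = wact w f + wact w g"
  unfolding wact_def by (rule setsum_keys_plus_distrib) (auto simp: single_add)

lemma wact_single [simp]: "wact w (Poly_Mapping.single l c) = Poly_Mapping.single (w l) c"
  unfolding wact_def by simp

lemma wact_0 [simp]: "wact w 0 = 0"
  by (simp add: wact_def)

lemma wact_eT [simp]: "wact w (eT l) = eT (w l)"
  by (simp add: eT_def)

lemma wact_uminus: "wact w (- f) = - wact w f"
  using wact_add[of w "- f" f] by (simp add: eq_neg_iff_add_eq_0)

lemma wact_diff: "wact w (f - g) = wact w f - wact w g"
  using wact_add[of w f "- g"] by (simp add: wact_uminus)

lemma wact_sum: "wact w (sum f A) = (\<Sum>i\<in>A. wact w (f i))"
  by (induction A rule: infinite_finite_induct) (simp_all add: wact_add)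

lemma wact_comp: "wact v (wact w f) = wact (v \<circ> w) f"
  by (induction f rule: poly_mapping_single_induct) (simp_all add: wact_add)

lemma wact_id [simp]: "wact id f = f"
  by (induction f rule: poly_mapping_single_induct) (simp_all add: wact_add)

text \<open>\<open>wact\<close> accepts arbitrary maps of the lattice, so multiplication by e^b
  becomes the action of a translation and can be composed with other maps that are not
  additive.\<close>

lemma wact_translate: "wact (\<lambda>l. l + b) f = eT b * f"
  by (induction f rule: poly_mapping_single_induct)
     (simp_all add: wact_add distrib_left eT_def mult_single add.commute)

lemma wact_mult:
  assumes "Modules.additive w"
  shows "wact w (f * g) = wact w f * wact w g"
  unfolding wact_def
  by (rule sum_keys_mult) (auto simp: single_add Modules.additive.add[OF assms] mult_single)

lemma wact_1 [simp]: "Modules.additive w \<Longrightarrow> wact w 1 = 1"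
  using wact_eT[of w 0] by (simp add: Modules.additive.zero)

lemma wact_prod: "Modules.additive w \<Longrightarrow> wact w (prod f A) = (\<Prod>i\<in>A. wact w (f i))"
  by (induction A rule: infinite_finite_induct) (simp_all add: wact_mult)

lemma wact_power: "Modules.additive w \<Longrightarrow> wact w (f ^ n) = wact w f ^ n"
  by (induction n) (simp_all add: wact_mult)

lemma wact_of_int: "Modules.additive w \<Longrightarrow> wact w (of_int n) = of_int n"
  by (simp add: Modules.additive.zero flip: single_of_int)

lemma keys_wact: "Poly_Mapping.keys (wact w f) \<subseteq> w ` Poly_Mapping.keys f"
proof
  fix k assume "k \<in> Poly_Mapping.keys (wact w f)"
  then have "(\<Sum>l\<in>Poly_Mapping.keys f. Poly_Mapping.lookup (Poly_Mapping.single (w l) (Poly_Mapping.lookup f l)) k) \<noteq> 0"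
    by (simp add: in_keys_iff wact_def lookup_sum)
  then obtain l where "l \<in> Poly_Mapping.keys f"
    "Poly_Mapping.lookup (Poly_Mapping.single (w l) (Poly_Mapping.lookup f l)) k \<noteq> 0"
    by (meson sum.neutral)
  then show "k \<in> w ` Poly_Mapping.keys f"
    by (auto simp: lookup_single when_def split: if_splits)
qed

lemma keys_wact_bij:
  assumes "bij w"
  shows "Poly_Mapping.keys (wact w f) = w ` Poly_Mapping.keys f"
proof
  have "Poly_Mapping.keys f \<subseteq> inv w ` Poly_Mapping.keys (wact w f)"
    using keys_wact[of "inv w" "wact w f"] assms by (simp add: wact_comp bij_is_inj)
  then show "w ` Poly_Mapping.keys f \<subseteq> Poly_Mapping.keys (wact w f)"
    using assms by (auto simp: bij_is_surj surj_f_inv_f)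
qed (rule keys_wact)

text \<open>The finite support lies in its own image under \<tau>, hence equals it; orbits inside it
  are finite and must repeat. The use is to force \<open>f = 0\<close> when \<tau> has no recurrent
  points.\<close>

lemma wact_fixed_recurrent:
  assumes fixed: "wact \<tau> f = f" and "f \<noteq> 0"
  obtains k m n where "m < (n::nat)" "(\<tau> ^^ m) k = (\<tau> ^^ n) k"
proof -
  let ?K = "Poly_Mapping.keys f"
  have K: "finite ?K" "?K \<noteq> {}" "?K \<subseteq> \<tau> ` ?K"
    using \<open>f \<noteq> 0\<close> keys_wact[of \<tau> f] fixed by (auto simp: poly_mapping_eq_iff in_keys_iff fun_eq_iff)
  moreover have "card ?K = card (\<tau> ` ?K)"
    using K by (intro le_antisym card_mono card_image_le) auto
  ultimately have "\<tau> ` ?K = ?K"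
    by (metis card_subset_eq finite_imageI)
  moreover obtain k where "k \<in> ?K" using K by blast
  ultimately have orbit: "(\<tau> ^^ n) k \<in> ?K" for n
    by (induction n) auto
  have "\<not> inj (\<lambda>n. (\<tau> ^^ n) k)"
    using finite_subset[OF _ K(1), of "range (\<lambda>n. (\<tau> ^^ n) k)"] orbit
    by (meson finite_imageD image_subsetI infinite_UNIV_nat)
  then obtain m n where "m \<noteq> n" "(\<tau> ^^ m) k = (\<tau> ^^ n) k"
    by (auto simp: inj_on_def)
  then show thesis
    using that by (metis linorder_neqE_nat)
qed

section \<open>Divisibility by 1 - e^\<beta> in the group algebra\<close>

lemma eT_diff_dvd: "1 - eT \<beta> dvd eT l - (eT (l + j *s \<beta>) :: ('n::finite, 'k::field) RT)"
proof -
  have nat: "1 - eT \<beta> dvd 1 - (eT (of_nat m *s \<beta>) :: ('n, 'k) RT)" for m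
  proof (induction m)
    case (Suc m)
    have "1 - eT (of_nat (Suc m) *s \<beta>) =
          (1 - eT (of_nat m *s \<beta>)) + eT (of_nat m *s \<beta>) * (1 - eT \<beta> :: ('n, 'k) RT)"
      by (simp add: vector_sadd_rdistrib eT_add algebra_simps)
    then show ?case using dvd_add[OF Suc.IH dvd_triv_right] by (simp only:)
  qed simp
  have "1 - eT \<beta> dvd 1 - (eT (j *s \<beta>) :: ('n, 'k) RT)"
  proof (cases "j \<ge> 0")
    case True
    then show ?thesis using nat[of "nat j"] by simp
  next
    case False
    have "1 - eT (j *s \<beta>) = - eT (j *s \<beta>) * (1 - eT (of_nat (nat (- j)) *s \<beta>) :: ('n, 'k) RT)"
      using False by (simp add: algebra_simps flip: eT_add vector_sadd_rdistrib)
    then show ?thesis using nat[of "nat (- j)"] by simp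
  qed
  then have "1 - eT \<beta> dvd eT l * (1 - (eT (j *s \<beta>) :: ('n, 'k) RT))"
    by (rule dvd_mult)
  then show ?thesis by (simp add: eT_add algebra_simps)
qed

text \<open>Monomial by monomial this is \<open>eT_diff_dvd\<close>. It serves both for
  coreflections, which move exponents along a coroot, and for a choice of coset representatives
  modulo the multiples of \<beta>.\<close>

lemma dvd_diff_wact:
  assumes "\<And>l. \<exists>j. w l = l + j *s \<beta>"
  shows "1 - eT \<beta> dvd f - wact w (f :: ('n::finite, 'k::field) RT)"
proof (induction f rule: poly_mapping_single_induct)
  case (single l c)
  obtain j where "w l = l + j *s \<beta>" using assms by blast
  then have "Poly_Mapping.single l c - wact w (Poly_Mapping.single l c) =
        Poly_Mapping.single 0 c * (eT l - eT (l + j *s \<beta>))"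
    by (simp add: eT_def mult_single right_diff_distrib)
  then show ?case by (simp add: eT_diff_dvd)
next
  case (add f g)
  have "f + g - wact w (f + g) = (f - wact w f) + (g - wact w g)"
    by (simp add: wact_add)
  then show ?case using dvd_add[OF add] by (simp only:)
qed

text \<open>Being annihilated means being fixed by translation by \<beta>, and translation by a
  nonzero vector has no recurrent points in a torsion-free lattice.\<close>

lemma one_minus_eT_cancel:
  assumes "\<beta> \<noteq> 0" and "(1 - eT \<beta>) * (f :: ('n::finite, 'k::field) RT) = 0"
  shows "f = 0"
proof (rule ccontr)
  assume "f \<noteq> 0"
  have "wact (\<lambda>l. l + \<beta>) f = f"
    using assms(2) by (simp add: wact_translate algebra_simps)
  then obtain k m n where mn: "m < (n::nat)" "((\<lambda>l. l + \<beta>) ^^ m) k = ((\<lambda>l. l + \<beta>) ^^ n) k"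
    using \<open>f \<noteq> 0\<close> by (rule wact_fixed_recurrent)
  have "((\<lambda>l. l + \<beta>) ^^ n) k = k + of_nat n *s \<beta>" for n
    by (induction n) (simp_all add: vector_sadd_rdistrib)
  then have "of_nat m *s \<beta> = of_nat n *s \<beta>" using mn by simp
  then show False using mn(1) \<open>\<beta> \<noteq> 0\<close> by (auto simp: vec_eq_iff)
qed

text \<open>\<open>R/(1 - e\<^sup>\<beta>)\<close> is the group algebra of \<open>Y/\<int>\<beta>\<close>, in which \<open>1 - e\<^sup>\<alpha>\<close> is no zero divisor because
  the class of \<open>\<alpha>\<close> has infinite order; here a choice of coset representatives realises the quotient.\<close>

lemma one_minus_eT_coprime:
  assumes indep: "\<And>m n. m *s \<alpha> = n *s \<beta> \<Longrightarrow> m = (0::int)"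
    and dvd: "1 - eT \<beta> dvd (1 - eT \<alpha>) * (f :: ('n::finite, 'k::field) RT)"
  shows "1 - eT \<beta> dvd f"
proof -
  define r where "r l = (SOME k. \<exists>j. k = l + j *s \<beta>)" for l
  have r: "\<exists>j. r l = l + j *s \<beta>" for l
    unfolding r_def by (rule someI_ex) blast
  have r_add: "r (l + j *s \<beta>) = r l" for l j
  proof -
    have "(\<exists>j'. k = l + j *s \<beta> + j' *s \<beta>) \<longleftrightarrow> (\<exists>j. k = l + j *s \<beta>)" for k
    proof
      assume "\<exists>j'. k = l + j *s \<beta> + j' *s \<beta>"
      then show "\<exists>j. k = l + j *s \<beta>"
        by (metis add.assoc vector_sadd_rdistrib)
    next
      assume "\<exists>j. k = l + j *s \<beta>"
      then obtain i where "k = l + i *s \<beta>" by blast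
      then have "k = l + j *s \<beta> + (i - j) *s \<beta>"
        by (simp add: add.assoc flip: vector_sadd_rdistrib)
      then show "\<exists>j'. k = l + j *s \<beta> + j' *s \<beta>" by blast
    qed
    then show ?thesis by (simp add: r_def)
  qed
  have r_shift: "r (r l + a) = r (l + a)" for l a
  proof -
    obtain j where "r l = l + j *s \<beta>" using r by blast
    then have "r l + a = (l + a) + j *s \<beta>" by simp
    then show ?thesis by (simp only: r_add)
  qed
  let ?F = "wact r f" and ?\<tau> = "\<lambda>l. r (l + \<alpha>)"
  have zero: "wact r ((1 - eT \<beta>) * g) = (0 :: ('n, 'k) RT)" for g
  proof -
    have "r \<circ> (\<lambda>l. l + \<beta>) = r"
      using r_add[of _ 1] by (auto simp: fun_eq_iff)
    then have "wact r (eT \<beta> * g) = wact r g"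
      by (simp add: wact_comp flip: wact_translate)
    then show ?thesis by (simp add: left_diff_distrib wact_diff)
  qed
  obtain g where "(1 - eT \<alpha>) * f = (1 - eT \<beta>) * g"
    using dvd by (auto simp: dvd_def)
  then have "wact r ((1 - eT \<alpha>) * f) = 0"
    using zero[of g] by (simp only:)
  then have "wact r f = wact r (eT \<alpha> * f)"
    by (simp add: left_diff_distrib wact_diff)
  also have "\<dots> = wact ?\<tau> ?F"
    unfolding wact_translate[symmetric] by (simp add: wact_comp comp_def r_shift)
  finally have fixed: "wact ?\<tau> ?F = ?F" ..
  have "?F = 0"
  proof (rule ccontr)
    assume "?F \<noteq> 0"
    with fixed obtain k m n where mn: "m < (n::nat)" "(?\<tau> ^^ m) k = (?\<tau> ^^ n) k"
      by (rule wact_fixed_recurrent)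
    \<comment> \<open>Up to multiples of \<beta>, iterating \<open>?\<tau>\<close> adds multiples of
      \<alpha>; a repetition would contradict \<open>indep\<close>.\<close>
    have "\<exists>j. (?\<tau> ^^ n) k = k + of_nat n *s \<alpha> + j *s \<beta>" for n
    proof (induction n)
      case 0
      show ?case by (rule exI[of _ 0]) simp
    next
      case (Suc n)
      then obtain j where "(?\<tau> ^^ n) k = k + of_nat n *s \<alpha> + j *s \<beta>" by blast
      moreover obtain i where "r ((?\<tau> ^^ n) k + \<alpha>) = (?\<tau> ^^ n) k + \<alpha> + i *s \<beta>"
        using r by blast
      ultimately have "(?\<tau> ^^ Suc n) k = k + of_nat (Suc n) *s \<alpha> + (j + i) *s \<beta>"
        by (simp add: vector_sadd_rdistrib)
      then show ?case by blast
    qed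
    then obtain i j where "(?\<tau> ^^ m) k = k + of_nat m *s \<alpha> + i *s \<beta>"
      "(?\<tau> ^^ n) k = k + of_nat n *s \<alpha> + j *s \<beta>"
      by blast
    then have "k + of_nat m *s \<alpha> + i *s \<beta> = k + of_nat n *s \<alpha> + j *s \<beta>"
      using mn(2) by simp
    then have "(int n - int m) *s \<alpha> = (i - j) *s \<beta>"
      by (simp add: vec_eq_iff left_diff_distrib) (simp add: algebra_simps)
    from indep[OF this] mn(1) show False by simp
  qed
  \<comment> \<open>With \<open>?F = 0\<close>, \<open>f\<close> equals \<open>f - wact r f\<close>,
    and \<open>r\<close> moves exponents only along \<beta>.\<close>
  then show ?thesis using dvd_diff_wact[OF r, of f] by simp
qed

text \<open>Factors \<open>p\<close> are peeled off one at a time: \<open>coprime\<close> extracts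
  one from \<open>f\<close>, and \<open>nz\<close> cancels it on both sides.\<close>

lemma dvd_power_cancel:
  fixes p :: "'r::comm_ring_1"
  assumes nz: "\<And>f. p * f = 0 \<Longrightarrow> f = 0"
    and coprime: "\<And>f. p dvd q * f \<Longrightarrow> p dvd f"
  shows "p ^ N dvd q * f \<Longrightarrow> p ^ N dvd f"
proof (induction N arbitrary: f)
  case (Suc N)
  then obtain h where h: "q * f = p * (p ^ N * h)" by (auto simp: dvd_def mult.assoc)
  then obtain f' where f: "f = p * f'"
    using coprime[of f] by (auto simp: dvd_def)
  have "p * (q * f' - p ^ N * h) = 0"
    using h unfolding f by (simp add: algebra_simps)
  from nz[OF this] have "p ^ N dvd q * f'" by simp
  from Suc.IH[OF this] show ?case unfolding f by (simp add: mult_dvd_mono)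
qed simp

text \<open>Stands in for unique factorization where the \<open>p a\<close> need not be prime. Once
  the product over \<open>A\<close> has been split off, every factor in it is a non-zero-divisor
  modulo the new \<open>p b\<close>, so all of \<open>p b ^ N\<close> falls on the cofactor.\<close>

lemma prod_power_dvd:
  fixes p :: "'a \<Rightarrow> 'r::comm_ring_1"
  assumes "finite A"
    and nz: "\<And>a f. a \<in> A \<Longrightarrow> p a * f = 0 \<Longrightarrow> f = 0"
    and coprime: "\<And>a b f. a \<in> A \<Longrightarrow> b \<in> A \<Longrightarrow> a \<noteq> b \<Longrightarrow> p b dvd p a * f \<Longrightarrow> p b dvd f"
    and dvd: "\<And>a. a \<in> A \<Longrightarrow> p a ^ N dvd f"
  shows "(\<Prod>a\<in>A. p a) ^ N dvd f"
  using assms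
proof (induction A)
  case (insert b A)
  have cpow: "p b dvd p a ^ n * g \<Longrightarrow> p b dvd g" if "a \<in> A" for a n g
  proof -
    have step: "p b dvd h" if "p b dvd p a * h" for h
      using that \<open>a \<in> A\<close> insert.hyps(2) insert.prems(2)[of a b h] by auto
    show "p b dvd p a ^ n * g \<Longrightarrow> p b dvd g"
    proof (induction n)
      case (Suc n)
      from Suc.prems have "p b dvd p a * (p a ^ n * g)"
        unfolding power_Suc mult.assoc .
      then show ?case by (rule Suc.IH[OF step])
    qed simp
  qed
  have cprod: "p b dvd (\<Prod>a\<in>T. p a ^ N) * g \<Longrightarrow> p b dvd g" if "T \<subseteq> A" "finite T" for T g
    using that(2,1)
  proof (induction T)
    case (insert a T)
    have a: "a \<in> A" and T: "T \<subseteq> A" using insert.prems(2) by auto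
    from insert.prems(1) have "p b dvd p a ^ N * ((\<Prod>a\<in>T. p a ^ N) * g)"
      unfolding prod.insert[OF insert.hyps] mult.assoc .
    then show ?case by (rule insert.IH[OF cpow[OF a] T])
  qed simp
  have "(\<Prod>a\<in>A. p a) ^ N dvd f"
  proof (rule insert.IH)
    show "\<And>a b f. a \<in> A \<Longrightarrow> b \<in> A \<Longrightarrow> a \<noteq> b \<Longrightarrow> p b dvd p a * f \<Longrightarrow> p b dvd f"
      using insert.prems(2) by blast
  qed (use insert.prems in blast)+
  then obtain g where g: "f = (\<Prod>a\<in>A. p a ^ N) * g"
    by (auto simp: dvd_def prod_power_distrib)
  have "p b ^ N dvd g"
  proof (rule dvd_power_cancel)
    show "p b ^ N dvd (\<Prod>a\<in>A. p a ^ N) * g"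
      using insert.prems(3)[of b] g by simp
    show "p b dvd h" if "p b dvd (\<Prod>a\<in>A. p a ^ N) * h" for h
      using cprod[OF order_refl insert.hyps(1) that] .
  qed (use insert.prems(1) in auto)
  then show ?case
    unfolding g prod.insert[OF insert.hyps] power_mult_distrib prod_power_distrib
    by (subst mult.commute) (rule mult_dvd_mono[OF dvd_refl])
qed simp

subsection \<open>The augmentation ideal\<close>

lemma augmentation_add: "augmentation (f + g) = augmentation f + augmentation g"
  unfolding augmentation_def by (rule setsum_keys_plus_distrib) auto

lemma augmentation_single [simp]: "augmentation (Poly_Mapping.single l c) = c"
  by (simp add: augmentation_def)

lemma augmentation_0 [simp]: "augmentation 0 = 0"
  by (simp add: augmentation_def)

lemma augmentation_eT [simp]: "augmentation (eT l) = 1"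
  by (simp add: eT_def)

lemma augmentation_uminus: "augmentation (- f) = - augmentation f"
  using augmentation_add[of "- f" f] by (simp add: eq_neg_iff_add_eq_0)

lemma augmentation_diff: "augmentation (f - g) = augmentation f - augmentation g"
  using augmentation_add[of f "- g"] by (simp add: augmentation_uminus)

lemma augmentation_wact: "augmentation (wact w f) = augmentation f"
  by (induction f rule: poly_mapping_single_induct) (simp_all add: wact_add augmentation_add)

lemma aug_pow_0 [simp]: "aug_pow n 0"
proof (induction n)
  case (Suc n)
  then show ?case using aug_pow.mult[of 0 n 0] by simp
qed (rule aug_pow.zero)

lemma aug_pow_mult_left: "aug_pow n f \<Longrightarrow> aug_pow n (g * f)"
proof (induction rule: aug_pow.induct)
  case (mult a n b)
  show ?case
    unfolding mult.left_commute[of g a b] by (rule aug_pow.mult[OF mult.hyps(1) mult.IH])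
qed (auto simp: distrib_left intro: aug_pow.intros)

lemma aug_pow_mult_right: "aug_pow n f \<Longrightarrow> aug_pow n (f * g)"
  using aug_pow_mult_left[of n f g] by (simp add: mult.commute)

lemma aug_pow_uminus: "aug_pow n f \<Longrightarrow> aug_pow n (- f)"
  using aug_pow_mult_left[of n f "- 1"] by simp

lemma aug_pow_diff: "aug_pow n f \<Longrightarrow> aug_pow n g \<Longrightarrow> aug_pow n (f - g)"
  using aug_pow.add[of n f "- g"] aug_pow_uminus[of n g] by simp

lemma aug_pow_sum: "(\<And>i. i \<in> A \<Longrightarrow> aug_pow n (f i)) \<Longrightarrow> aug_pow n (sum f A)"
  by (induction A rule: infinite_finite_induct) (auto intro: aug_pow.add)

lemma aug_pow_mult: "aug_pow m f \<Longrightarrow> aug_pow n g \<Longrightarrow> aug_pow (m + n) (f * g)"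
proof (induction rule: aug_pow.induct)
  case (zero f)
  then show ?case by (simp add: aug_pow_mult_left)
next
  case (mult a m b)
  then show ?case using aug_pow.mult[of a "m + n" "b * g"] by (simp add: mult.assoc)
next
  case (add m f f')
  then show ?case by (simp add: distrib_right aug_pow.add)
qed

lemma aug_pow_Suc_imp: "aug_pow (Suc n) f \<Longrightarrow> aug_pow n f"
proof (induction "Suc n" f rule: aug_pow.induct)
  case (mult a b)
  then show ?case by (simp add: aug_pow_mult_left)
qed (auto intro: aug_pow.add)

lemma aug_pow_mono: "aug_pow n f \<Longrightarrow> m \<le> n \<Longrightarrow> aug_pow m f"
  by (induction n) (auto simp: le_Suc_eq dest: aug_pow_Suc_imp)

lemma aug_pow_power: "augmentation f = 0 \<Longrightarrow> aug_pow n (f ^ n)"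
  by (induction n) (auto intro: aug_pow.intros)

lemma aug_pow_wact:
  assumes "Modules.additive w"
  shows "aug_pow n f \<Longrightarrow> aug_pow n (wact w f)"
proof (induction rule: aug_pow.induct)
  case (mult a n b)
  then show ?case by (simp add: wact_mult[OF assms] augmentation_wact aug_pow.mult)
qed (auto simp: wact_add intro: aug_pow.intros)

lemma aug_pow_cong_prod:
  assumes "\<And>i. i \<in> A \<Longrightarrow> aug_pow n (f i - g i)"
  shows "aug_pow n (prod f A - prod g A)"
  using assms
proof (induction A rule: infinite_finite_induct)
  case (insert i A)
  have "prod f (insert i A) - prod g (insert i A) =
        (f i - g i) * prod f A + g i * (prod f A - prod g A)"
    using insert.hyps by (simp add: algebra_simps)
  moreover have "aug_pow n ((f i - g i) * prod f A)" "aug_pow n (g i * (prod f A - prod g A))"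
    using insert by (auto intro: aug_pow_mult_left aug_pow_mult_right)
  ultimately show ?case by (simp add: aug_pow.add)
qed simp_all

subsection \<open>Expansion in the coordinates \<open>e\<^sup>\<epsilon> - 1\<close>\<close>

definition scal :: "'k::field \<Rightarrow> ('n::finite, 'k) RT" where
  "scal c = Poly_Mapping.single 0 c"

definition tcoord :: "'n::finite \<Rightarrow> ('n, 'k::field) RT" where
  "tcoord i = eT (axis i 1) - 1"

definition tmonom :: "('n::finite \<Rightarrow> nat) \<Rightarrow> ('n, 'k::field) RT" where
  "tmonom k = (\<Prod>i\<in>UNIV. tcoord i ^ k i)"

lemma scal_simps: "scal 0 = 0" "scal 1 = 1" "scal (a + b) = scal a + scal b"
  "scal (a - b) = scal a - scal b" "scal (a * b) = scal a * scal b"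
  by (simp_all add: scal_def single_add single_diff mult_single)

lemma scal_prod: "scal (prod f A) = (\<Prod>i\<in>A. scal (f i))"
  by (induction A rule: infinite_finite_induct) (simp_all add: scal_simps)

lemma augmentation_tcoord [simp]: "augmentation (tcoord i) = 0"
  by (simp add: tcoord_def augmentation_diff flip: eT_0)

lemma aug_pow_tmonom: "aug_pow (\<Sum>i\<in>UNIV. k i) (tmonom k :: ('n::finite, 'k::field) RT)"
proof -
  have "aug_pow (\<Sum>i\<in>A. k i) (\<Prod>i\<in>A. (tcoord i :: ('n, 'k) RT) ^ k i)" if "finite A" for A
    using that
  proof induction
    case (insert i A)
    then show ?case by (simp add: aug_pow_mult aug_pow_power)
  qed (simp add: aug_pow.zero)
  then show ?thesis by (simp add: tmonom_def)
qed

text \<open>This is (1 + t)^a truncated below degree \<open>N\<close>. The coefficients come from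
  Pascal's rule \<open>c (Suc j) = b (Suc j) + b j\<close>, run forwards to reach a + 1 and solved
  for \<open>b\<close> to reach a - 1, so negative exponents need no separate binomial
  series.\<close>

lemma one_variable_expansion:
  "\<exists>b. aug_pow N (eT (a *s axis i 1) - (\<Sum>j<N. scal (b j) * tcoord i ^ j) :: ('n::finite, 'k::field) RT)"
proof (cases N)
  case 0
  then show ?thesis by (auto intro: aug_pow.zero)
next
  case (Suc M)
  let ?x = "eT (axis i 1) :: ('n, 'k) RT" and ?y = "eT (- axis i 1) :: ('n, 'k) RT"
  let ?t = "tcoord i :: ('n, 'k) RT"
  let ?E = "\<lambda>b. \<Sum>j<N. scal (b j) * ?t ^ j"
  have tN: "aug_pow N (c * ?t ^ N)" for c
    by (intro aug_pow_mult_left aug_pow_power) simp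
  \<comment> \<open>The only term that overflows the truncation is
    \<open>scal (b M) * ?t ^ N\<close>, since \<open>N = Suc M\<close>.\<close>
  have step: "aug_pow N (?E c - ?x * ?E b)"
    if "c 0 = b 0" "\<And>j. c (Suc j) = b (Suc j) + b j" for b c
  proof -
    have "?x * ?E b = ?E b + (\<Sum>j<N. scal (b j) * ?t ^ Suc j)"
      unfolding sum_distrib_left sum.distrib[symmetric]
      by (intro sum.cong HOL.refl) (simp add: tcoord_def algebra_simps)
    also have "?E b = scal (b 0) + (\<Sum>j<M. scal (b (Suc j)) * ?t ^ Suc j)"
      unfolding Suc by (simp add: sum.lessThan_Suc_shift del: sum.lessThan_Suc)
    also have "(\<Sum>j<N. scal (b j) * ?t ^ Suc j) =
        (\<Sum>j<M. scal (b j) * ?t ^ Suc j) + scal (b M) * ?t ^ N"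
      unfolding Suc by simp
    finally have "?E c - ?x * ?E b = - scal (b M) * ?t ^ N"
      using that unfolding Suc
      by (simp add: sum.lessThan_Suc_shift scal_simps distrib_right sum.distrib del: sum.lessThan_Suc power_Suc)
    then show ?thesis using tN[of "- scal (b M)"] by (simp only:)
  qed
  show ?thesis
  proof (induction a rule: int_induct[where k = 0])
    case base
    show ?case
    proof (rule exI)
      show "aug_pow N (eT (0 *s axis i 1) - ?E (\<lambda>j. if j = 0 then 1 else 0))"
        unfolding Suc by (simp add: sum.lessThan_Suc_shift scal_simps del: sum.lessThan_Suc)
    qed
  next
    case (step1 a)
    then obtain b where b: "aug_pow N (eT (a *s axis i 1) - ?E b)" by blast
    define c where "c j = (case j of 0 \<Rightarrow> b 0 | Suc j \<Rightarrow> b (Suc j) + b j)" for j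
    have "eT ((a + 1) *s axis i 1) - ?E c = ?x * (eT (a *s axis i 1) - ?E b) - (?E c - ?x * ?E b)"
      by (simp add: vector_sadd_rdistrib eT_add algebra_simps)
    moreover have "aug_pow N \<dots>"
      by (rule aug_pow_diff[OF aug_pow_mult_left[OF b] step]) (auto simp: c_def)
    ultimately show ?case by metis
  next
    case (step2 a)
    then obtain c where c: "aug_pow N (eT (a *s axis i 1) - ?E c)" by blast
    \<comment> \<open>Pascal's rule solved downwards: \<open>b 0 = c 0\<close> and
      \<open>b (Suc j) = c (Suc j) - b j\<close>.\<close>
    define b where "b = rec_nat (c 0) (\<lambda>j r. c (Suc j) - r)"
    have "(a - 1) *s axis i 1 = - axis i 1 + a *s axis i (1 :: int)"
      by (simp add: vec_eq_iff algebra_simps)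
    then have "eT ((a - 1) *s axis i 1) - ?E b = ?y * eT (a *s axis i 1) - (?y * ?x) * ?E b"
      by (simp only: eT_add) simp
    also have "\<dots> = ?y * ((eT (a *s axis i 1) - ?E c) + (?E c - ?x * ?E b))"
      by (simp only: distrib_left right_diff_distrib mult.assoc) simp
    finally have "eT ((a - 1) *s axis i 1) - ?E b = \<dots>" .
    moreover have "aug_pow N \<dots>"
      by (rule aug_pow_mult_left[OF aug_pow.add[OF c step]]) (auto simp: b_def)
    ultimately show ?case by metis
  qed
qed

text \<open>The bound is on each exponent separately, because a product of one-variable truncations
  yields a box and not a bound on the total degree.\<close>

definition trange :: "nat \<Rightarrow> ('n::finite \<Rightarrow> nat) set" where
  "trange N = PiE UNIV (\<lambda>_. {..<N})"

lemma finite_trange [simp]: "finite (trange N)"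
  by (auto simp: trange_def intro: finite_PiE)

lemma trange_mono: "M \<le> N \<Longrightarrow> trange M \<subseteq> trange N"
  by (auto simp: trange_def PiE_def Pi_def intro: order_less_le_trans)

lemma tcoord_expansion:
  "\<exists>c. aug_pow N (f - (\<Sum>k\<in>trange N. scal (c k) * tmonom k) :: ('n::finite, 'k::field) RT)"
proof (induction f rule: poly_mapping_single_induct)
  case (single l a)
  obtain b where b: "\<And>i. aug_pow N (eT ((l $ i) *s axis i 1) -
      (\<Sum>j<N. scal (b i j) * tcoord i ^ j) :: ('n, 'k) RT)"
    using choice[OF allI, of "\<lambda>i b. aug_pow N (eT ((l $ i) *s axis i 1) -
      (\<Sum>j<N. scal (b j) * tcoord i ^ j) :: ('n, 'k) RT)", OF one_variable_expansion]
    by blast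
  have "eT l = (\<Prod>i\<in>UNIV. eT ((l $ i) *s axis i 1) :: ('n, 'k) RT)"
    using basis_expansion[of l] by (simp flip: eT_sum)
  moreover have "(\<Prod>i\<in>UNIV. \<Sum>j<N. scal (b i j) * tcoord i ^ j) =
      (\<Sum>k\<in>trange N. scal (\<Prod>i\<in>UNIV. b i (k i)) * tmonom k :: ('n, 'k) RT)"
    by (simp add: prod_sum_PiE trange_def tmonom_def prod.distrib scal_prod)
  moreover have "aug_pow N ((\<Prod>i\<in>UNIV. eT ((l $ i) *s axis i 1)) -
      (\<Prod>i\<in>UNIV. \<Sum>j<N. scal (b i j) * tcoord i ^ j) :: ('n, 'k) RT)"
    by (rule aug_pow_cong_prod) (rule b)
  ultimately have "aug_pow N (eT l - (\<Sum>k\<in>trange N. scal (\<Prod>i\<in>UNIV. b i (k i)) * tmonom k :: ('n, 'k) RT))"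
    by (simp only:)
  then have "aug_pow N (scal a * (eT l - (\<Sum>k\<in>trange N. scal (\<Prod>i\<in>UNIV. b i (k i)) * tmonom k :: ('n, 'k) RT)))"
    by (rule aug_pow_mult_left)
  also have "scal a * (eT l - (\<Sum>k\<in>trange N. scal (\<Prod>i\<in>UNIV. b i (k i)) * tmonom k)) =
      Poly_Mapping.single l a - (\<Sum>k\<in>trange N. scal (a * (\<Prod>i\<in>UNIV. b i (k i))) * tmonom k :: ('n, 'k) RT)"
    unfolding single_eq_scalar_eT[of l a] scal_def[symmetric]
    by (simp add: scal_simps right_diff_distrib sum_distrib_left mult.assoc)
  finally show ?case by (rule exI[of _ "\<lambda>k. a * (\<Prod>i\<in>UNIV. b i (k i))"])
next
  case (add f g)
  then obtain c d where "aug_pow N (f - (\<Sum>k\<in>trange N. scal (c k) * tmonom k))"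
    "aug_pow N (g - (\<Sum>k\<in>trange N. scal (d k) * tmonom k))" by blast
  from aug_pow.add[OF this]
  have "aug_pow N (f + g - (\<Sum>k\<in>trange N. scal (c k + d k) * tmonom k))"
    by (simp add: scal_simps distrib_right sum.distrib algebra_simps)
  then show ?case by (rule exI[of _ "\<lambda>k. c k + d k"])
qed

text \<open>The ring homomorphism \<open>e\<^sup>l \<mapsto> \<Prod>\<^sub>i (1 + z\<^sub>i t)\<^bsup>l i\<^esup>\<close> into the domain \<open>k[x][[t]]\<close>.  With \<open>z\<^sub>i = x\<^bsup>w i\<^esup>\<close>
  for weights \<open>w\<close> that separate the monomials of bounded degree it detects the powers of the
  augmentation ideal, which are therefore the balls of a valuation.\<close>

definition ubase :: "'a::comm_ring_1 \<Rightarrow> 'a fps" where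
  "ubase z = 1 + fps_const z * fps_X"

definition uinv :: "'a::comm_ring_1 \<Rightarrow> 'a fps" where
  "uinv z = Abs_fps (\<lambda>n. (- z) ^ n)"

definition upow :: "'a::comm_ring_1 \<Rightarrow> int \<Rightarrow> 'a fps" where
  "upow z a = ubase z ^ nat a * uinv z ^ nat (- a)"

lemma ubase_uinv: "ubase z * uinv z = 1"
proof (rule fps_ext)
  fix n
  show "fps_nth (ubase z * uinv z) n = fps_nth 1 n"
    by (cases n) (simp_all add: ubase_def uinv_def distrib_right mult.assoc)
qed

lemma upow_0 [simp]: "upow z 0 = 1"
  by (simp add: upow_def)

lemma upow_1 [simp]: "upow z 1 = ubase z"
  by (simp add: upow_def)

lemma upow_add1: "upow z (a + 1) = ubase z * upow z a"
proof (cases "a \<ge> 0")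
  case True
  then show ?thesis by (simp add: upow_def nat_add_distrib)
next
  case False
  then have "nat (- a) = Suc (nat (- (a + 1)))" by simp
  moreover have "ubase z * (uinv z * uinv z ^ n) = uinv z ^ n" for n
    by (simp add: ubase_uinv flip: mult.assoc)
  ultimately show ?thesis using False by (simp add: upow_def)
qed

lemma upow_add: "upow z (a + b) = upow z a * upow z b"
proof (induction b rule: int_induct[where k = 0])
  case (step1 b)
  then show ?case using upow_add1[of z "a + b"] upow_add1[of z b] by (simp add: algebra_simps)
next
  case (step2 b)
  have "ubase z * upow z (a + (b - 1)) = ubase z * (upow z a * upow z (b - 1))"
    using upow_add1[of z "a + (b - 1)"] upow_add1[of z "b - 1"] step2 by (simp add: algebra_simps)
  then have "uinv z * (ubase z * upow z (a + (b - 1))) = uinv z * (ubase z * (upow z a * upow z (b - 1)))"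
    by (simp only:)
  then show ?case
    by (simp only: mult.assoc[symmetric] mult.commute[of "uinv z" "ubase z"] ubase_uinv mult_1_left)
qed simp

definition phi :: "('n \<Rightarrow> 'k poly) \<Rightarrow> ('n::finite, 'k::field) RT \<Rightarrow> 'k poly fps" where
  "phi z f = (\<Sum>l\<in>Poly_Mapping.keys f. fps_const [:Poly_Mapping.lookup f l:] * (\<Prod>i\<in>UNIV. upow (z i) (l $ i)))"

lemma phi_add:
  fixes f :: "('n::finite, 'k::field) RT"
  shows "phi z (f + g) = phi z f + phi z g"
  unfolding phi_def
proof (rule setsum_keys_plus_distrib)
  have "fps_const [:a + b:] = fps_const [:a:] + fps_const [:b:]" for a b :: 'k
    by simp
  then show "fps_const [:poly_mapping.lookup f l + poly_mapping.lookup g l:] * P =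
      fps_const [:poly_mapping.lookup f l:] * P + fps_const [:poly_mapping.lookup g l:] * P" for l P
    by (simp only: distrib_right)
qed simp

lemma phi_single: "phi z (Poly_Mapping.single l c) = fps_const [:c:] * (\<Prod>i\<in>UNIV. upow (z i) (l $ i))"
  unfolding phi_def by (rule sum_keys_single) simp

lemma phi_mult:
  fixes f :: "('n::finite, 'k::field) RT"
  shows "phi z (f * g) = phi z f * phi z g"
  unfolding phi_def
proof (rule sum_keys_mult)
  fix l l' :: "'n lat" and a b :: 'k
  show "fps_const [:a * b:] * (\<Prod>i\<in>UNIV. upow (z i) ((l + l') $ i)) =
    fps_const [:a:] * (\<Prod>i\<in>UNIV. upow (z i) (l $ i)) * (fps_const [:b:] * (\<Prod>i\<in>UNIV. upow (z i) (l' $ i)))"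
    by (simp add: upow_add prod.distrib mult_ac flip: fps_const_mult)
next
  fix l :: "'n lat" and a b :: 'k
  show "fps_const [:a + b:] * (\<Prod>i\<in>UNIV. upow (z i) (l $ i)) =
    fps_const [:a:] * (\<Prod>i\<in>UNIV. upow (z i) (l $ i)) + fps_const [:b:] * (\<Prod>i\<in>UNIV. upow (z i) (l $ i))"
    unfolding distrib_right[symmetric] by simp
qed simp

lemma phi_scal [simp]: "phi z (scal c) = fps_const [:c:]"
  by (simp add: scal_def phi_single)

lemma phi_0 [simp]: "phi z 0 = 0"
  by (simp add: phi_def)

lemma phi_1 [simp]: "phi z 1 = 1"
  using phi_scal[of z 1] by (simp add: scal_simps)

lemma phi_diff: "phi z (f - g) = phi z f - phi z g"
  using phi_add[of z "f - g" g] by simp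

lemma phi_sum: "phi z (sum f A) = (\<Sum>i\<in>A. phi z (f i))"
  by (induction A rule: infinite_finite_induct) (simp_all add: phi_add)

lemma phi_prod: "phi z (prod f A) = (\<Prod>i\<in>A. phi z (f i))"
  by (induction A rule: infinite_finite_induct) (simp_all add: phi_mult)

lemma phi_power: "phi z (f ^ n) = phi z f ^ n"
  by (induction n) (simp_all add: phi_mult)

lemma phi_eT: "phi z (eT l) = (\<Prod>i\<in>UNIV. upow (z i) (l $ i))"
  by (simp add: eT_def phi_single)

lemma phi_tcoord: "phi z (tcoord i) = fps_const (z i) * fps_X"
proof -
  have "(\<Prod>j\<in>UNIV. upow (z j) (axis i 1 $ j)) = (\<Prod>j\<in>UNIV. if j = i then ubase (z j) else 1)"
    by (intro prod.cong) (auto simp: axis_def)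
  then show ?thesis
    by (simp add: tcoord_def phi_diff phi_eT ubase_def)
qed

lemma phi_tmonom: "phi z (tmonom k) = fps_const (\<Prod>i\<in>UNIV. z i ^ k i) * fps_X ^ (\<Sum>i\<in>UNIV. k i)"
proof -
  have "(\<Prod>i\<in>A. (fps_const (z i) * fps_X) ^ k i) =
        fps_const (\<Prod>i\<in>A. z i ^ k i) * fps_X ^ (\<Sum>i\<in>A. k i)" for A
    by (induction A rule: infinite_finite_induct)
       (simp_all add: power_mult_distrib power_add fps_const_power mult_ac flip: fps_const_mult)
  then show ?thesis
    by (simp add: tmonom_def phi_prod phi_power phi_tcoord)
qed

section \<open>The augmentation filtration as a valuation\<close>

lemma fps_X_power_dvd_iff:
  "fps_X ^ n dvd (f :: 'a::comm_ring_1 fps) \<longleftrightarrow> (\<forall>i<n. fps_nth f i = 0)"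
proof
  assume "\<forall>i<n. fps_nth f i = 0"
  then have "f = fps_X ^ n * fps_shift n f"
    by (cases "f = 0") (auto intro!: fps_conv_fps_X_power_mult_fps_shift subdegree_geI)
  then show "fps_X ^ n dvd f" by (rule dvdI)
qed (auto simp: dvd_def fps_X_power_mult_nth)

lemma phi_nth_0:
  fixes f :: "('n::finite, 'k::field) RT"
  shows "fps_nth (phi z f) 0 = [:augmentation f:]"
proof (induction f rule: poly_mapping_single_induct)
  case (single l c)
  have *: "fps_nth (prod g A) 0 = (\<Prod>i\<in>A. fps_nth (g i) 0)" for g :: "'n \<Rightarrow> 'k poly fps" and A
    by (induction A rule: infinite_finite_induct) simp_all
  have "fps_nth (upow (z i) a) 0 = 1" for i a
    by (simp add: upow_def ubase_def uinv_def fps_nth_power_0)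
  then show ?case by (simp add: phi_single *)
qed (simp add: phi_add augmentation_add)

lemma aug_pow_imp_phi_dvd: "aug_pow n f \<Longrightarrow> fps_X ^ n dvd phi z f"
proof (induction rule: aug_pow.induct)
  case (mult a n b)
  have "fps_X ^ 1 dvd phi z a"
    unfolding fps_X_power_dvd_iff using phi_nth_0[of z a] mult.hyps(1) by simp
  then show ?case using mult_dvd_mono[OF _ mult.IH] by (simp add: phi_mult)
qed (auto simp: phi_add)

text \<open>Modulo the \<open>N\<close>-th power, \<open>f\<close> is a combination of monomials in
  the \<open>tcoord i\<close>. In its image the coefficient of t^d x^m with d < N meets at most one
  monomial, because the weighted degrees are distinct; so the monomials of total degree below
  \<open>N\<close> drop out, and the others lie in the \<open>N\<close>-th power already.\<close>

lemma phi_dvd_imp_aug_pow: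
  fixes w :: "'n::finite \<Rightarrow> nat" and f :: "('n, 'k::field) RT"
  assumes inj: "inj_on (\<lambda>k. \<Sum>i\<in>UNIV. w i * k i) (trange N)"
    and dvd: "fps_X ^ N dvd phi (\<lambda>i. monom 1 (w i)) f"
  shows "aug_pow N f"
proof -
  let ?z = "\<lambda>i. monom (1 :: 'k) (w i)" and ?\<kappa> = "\<lambda>k. \<Sum>i\<in>UNIV. w i * k i"
  obtain c where c: "aug_pow N (f - (\<Sum>k\<in>trange N. scal (c k) * tmonom k))"
    using tcoord_expansion by blast
  let ?g = "\<Sum>k\<in>trange N. scal (c k) * tmonom k"
  have "fps_X ^ N dvd phi ?z (f - ?g)"
    using c by (rule aug_pow_imp_phi_dvd)
  then have "fps_X ^ N dvd phi ?z f - phi ?z (f - ?g)"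
    using dvd by simp
  then have g: "fps_X ^ N dvd phi ?z ?g"
    by (simp add: phi_diff)
  have mon: "(\<Prod>i\<in>A. ?z i ^ k i) = monom 1 (\<Sum>i\<in>A. w i * k i)" for k A
    by (induction A rule: infinite_finite_induct) (simp_all add: monom_power mult_monom)
  have phig: "phi ?z ?g = (\<Sum>k\<in>trange N. fps_const (monom (c k) (?\<kappa> k)) * fps_X ^ (\<Sum>i\<in>UNIV. k i))"
    unfolding phi_sum phi_mult phi_scal phi_tmonom mon
    by (simp add: smult_monom flip: mult.assoc)
  have zero: "c k = 0" if k: "k \<in> trange N" "(\<Sum>i\<in>UNIV. k i) < N" for k
  proof -
    have "fps_nth (phi ?z ?g) (\<Sum>i\<in>UNIV. k i) = 0"
      using g k(2) by (auto simp: fps_X_power_dvd_iff)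
    then have "(\<Sum>k'\<in>trange N. if (\<Sum>i\<in>UNIV. k' i) = (\<Sum>i\<in>UNIV. k i) then monom (c k') (?\<kappa> k') else 0) = 0"
      unfolding phig fps_sum_nth
      by (subst (asm) sum.cong[OF HOL.refl, where h = "\<lambda>k'. if (\<Sum>i\<in>UNIV. k' i) = (\<Sum>i\<in>UNIV. k i) then monom (c k') (?\<kappa> k') else 0"])
         auto
    then have "(\<Sum>k'\<in>trange N. poly.coeff (if (\<Sum>i\<in>UNIV. k' i) = (\<Sum>i\<in>UNIV. k i) then monom (c k') (?\<kappa> k') else 0) (?\<kappa> k)) = 0"
      by (simp only: coeff_sum[symmetric] coeff_0)
    also have "(\<Sum>k'\<in>trange N. poly.coeff (if (\<Sum>i\<in>UNIV. k' i) = (\<Sum>i\<in>UNIV. k i) then monom (c k') (?\<kappa> k') else 0) (?\<kappa> k)) =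
      (\<Sum>k'\<in>trange N. if k' = k then c k else 0)"
      using inj k(1) by (intro sum.cong) (auto dest: inj_onD)
    also have "\<dots> = c k" using k(1) by simp
    finally show ?thesis .
  qed
  have "aug_pow N ?g"
  proof (rule aug_pow_sum)
    fix k :: "'n \<Rightarrow> nat" assume "k \<in> trange N"
    show "aug_pow N (scal (c k) * tmonom k :: ('n, 'k) RT)"
    proof (cases "(\<Sum>i\<in>UNIV. k i) < N")
      case True
      then show ?thesis using zero \<open>k \<in> trange N\<close> by (simp add: scal_simps)
    next
      case False
      then show ?thesis
        by (intro aug_pow_mult_left aug_pow_mono[OF aug_pow_tmonom]) simp
    qed
  qed
  from aug_pow.add[OF c this] show ?thesis by simp
qed

text \<open>Exponents below \<open>N\<close> are digits in base \<open>N\<close>: a new variable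
  takes weight 1 and the older weights are multiplied by \<open>N\<close>, so its exponent is
  recovered modulo \<open>N\<close>.\<close>

lemma separating_weights:
  "\<exists>w :: 'n::finite \<Rightarrow> nat. inj_on (\<lambda>k. \<Sum>i\<in>UNIV. w i * k i) (trange N)"
proof -
  have "\<exists>w :: 'n \<Rightarrow> nat. \<forall>k\<in>trange N. \<forall>k'\<in>trange N.
      (\<Sum>i\<in>A. w i * k i) = (\<Sum>i\<in>A. w i * k' i) \<longrightarrow> (\<forall>i\<in>A. k i = k' i)" if "finite A" for A
    using that
  proof induction
    case (insert a A)
    then obtain w :: "'n \<Rightarrow> nat" where w: "\<And>k k' i. k \<in> trange N \<Longrightarrow> k' \<in> trange N \<Longrightarrow>
      (\<Sum>i\<in>A. w i * k i) = (\<Sum>i\<in>A. w i * k' i) \<Longrightarrow> i \<in> A \<Longrightarrow> k i = k' i" by blast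
    define w' where "w' i = (if i = a then 1 else N * w i)" for i
    have sum_w': "(\<Sum>i\<in>insert a A. w' i * k i) = k a + N * (\<Sum>i\<in>A. w i * k i)" for k
      using insert.hyps by (auto simp: w'_def sum_distrib_left mult.assoc intro!: sum.cong)
    show ?case
    proof (intro exI ballI impI)
      fix k k' :: "'n \<Rightarrow> nat" and i
      assume k: "k \<in> trange N" "k' \<in> trange N"
        and eq: "(\<Sum>i\<in>insert a A. w' i * k i) = (\<Sum>i\<in>insert a A. w' i * k' i)" and i: "i \<in> insert a A"
      have lt: "k a < N" "k' a < N" using k by (auto simp: trange_def PiE_def Pi_def)
      have "k a = k' a"
        using arg_cong[OF eq[unfolded sum_w'], of "\<lambda>x. x mod N"] lt by simp
      moreover have "(\<Sum>i\<in>A. w i * k i) = (\<Sum>i\<in>A. w i * k' i)"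
        using eq[unfolded sum_w'] calculation lt by simp
      ultimately show "k i = k' i" using w k i by blast
    qed
  qed auto
  from this[OF finite[of UNIV]] show ?thesis by (auto simp: inj_on_def fun_eq_iff)
qed

text \<open>Orders of vanishing add up in the domain k[x][[t]]: \<open>f\<close> has order below
  \<open>c\<close>, so \<open>g\<close> must supply at least \<open>N\<close>.\<close>

lemma aug_pow_cancel:
  assumes f: "\<not> aug_pow c f" and fg: "aug_pow (N + c) (f * g)"
  shows "aug_pow N g"
proof -
  \<comment> \<open>One homomorphism has to detect level \<open>c\<close> for \<open>f\<close> and
    level \<open>N\<close> for \<open>g\<close>.\<close>
  let ?M = "max N c"
  obtain w :: "'a \<Rightarrow> nat" where w: "inj_on (\<lambda>k. \<Sum>i\<in>UNIV. w i * k i) (trange ?M)"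
    using separating_weights by blast
  let ?\<phi> = "phi (\<lambda>i. monom (1 :: 'b) (w i))"
  have inj: "inj_on (\<lambda>k. \<Sum>i\<in>UNIV. w i * k i) (trange L)" if "L \<le> ?M" for L
    using w trange_mono[OF that] by (rule inj_on_subset)
  have nf: "\<not> fps_X ^ c dvd ?\<phi> f"
    using phi_dvd_imp_aug_pow[OF inj, of c f] f by auto
  have "fps_X ^ N dvd ?\<phi> g"
  proof (cases "?\<phi> g = 0")
    case False
    have f0: "?\<phi> f \<noteq> 0" using nf by auto
    have "subdegree (?\<phi> f) < c"
      using nf unfolding fps_X_power_dvd_iff by (meson leI nth_less_subdegree_zero order_less_le_trans)
    moreover have "fps_X ^ (N + c) dvd ?\<phi> f * ?\<phi> g"
      using aug_pow_imp_phi_dvd[OF fg] by (simp add: phi_mult)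
    then have "N + c \<le> subdegree (?\<phi> f * ?\<phi> g)"
      using f0 False by (intro subdegree_geI) (auto simp: fps_X_power_dvd_iff)
    ultimately have "N \<le> subdegree (?\<phi> g)" using f0 False by simp
    then show ?thesis by (auto simp: fps_X_power_dvd_iff intro!: nth_less_subdegree_zero)
  qed simp
  then show ?thesis by (intro phi_dvd_imp_aug_pow[OF inj]) auto
qed

text \<open>Sending one z_i to 1 and all other z_j to 0 maps e^l to (1 + t)^a, where a is the
  positive coordinate of l at i. The coefficient of t^a is 1 in every characteristic, whereas lower
  binomial coefficients may vanish. A negative coordinate is made positive at the cost of a
  unit.\<close>

lemma not_aug_pow_one_minus_eT:
  assumes "l \<noteq> 0"
  shows "\<exists>c. \<not> aug_pow c (1 - eT l :: ('n::finite, 'k::field) RT)"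
proof -
  have pos: "\<exists>c. \<not> aug_pow c (1 - eT l :: ('n, 'k) RT)" if "l $ i > 0" for i and l :: "'n lat"
  proof -
    let ?z = "\<lambda>j. if j = i then 1 else (0 :: 'k poly)"
    define a where "a = nat (l $ i)"
    have a: "a > 0" using that by (simp add: a_def)
    have "ubase (0 :: 'k poly) = 1" by (simp add: ubase_def)
    moreover from this have "uinv (0 :: 'k poly) = 1"
      using ubase_uinv[of "0 :: 'k poly"] by simp
    ultimately have "upow (?z j) (l $ j) = (if j = i then (1 + fps_X) ^ a else 1)" for j
      using that by (auto simp: upow_def a_def ubase_def)
    then have "phi ?z (1 - eT l) = 1 - (1 + fps_X) ^ a"
      by (simp add: phi_diff phi_eT)
    moreover have "fps_nth ((1 + fps_X :: 'k poly fps) ^ a) a = 1"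
    proof -
      have "fps_nth ((1 + fps_X :: 'k poly fps) ^ m) n = of_nat (m choose n)" for m n
        by (induction m arbitrary: n)
           (case_tac n; simp add: distrib_right)+
      then show ?thesis by simp
    qed
    ultimately have "fps_nth (phi ?z (1 - eT l)) a \<noteq> 0"
      using a by simp
    then have "\<not> fps_X ^ Suc a dvd phi ?z (1 - eT l)"
      unfolding fps_X_power_dvd_iff by auto
    then show ?thesis using aug_pow_imp_phi_dvd by blast
  qed
  from assms obtain i where "l $ i \<noteq> 0" by (auto simp: vec_eq_iff)
  then consider "l $ i > 0" | "(- l) $ i > 0" by fastforce
  then show ?thesis
  proof cases
    case 1
    then show ?thesis by (rule pos)
  next
    case 2
    from pos[OF this] obtain c where "\<not> aug_pow c (1 - eT (- l) :: ('n, 'k) RT)" ..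
    moreover have "1 - eT (- l) = - eT (- l) * (1 - eT l :: ('n, 'k) RT)"
      by (simp add: algebra_simps)
    ultimately show ?thesis by (metis aug_pow_mult_left)
  qed
qed

lemma not_aug_pow_mult:
  assumes "\<exists>c. \<not> aug_pow c f" "\<exists>c. \<not> aug_pow c g"
  shows "\<exists>c. \<not> aug_pow c (f * g)"
  using assms aug_pow_cancel by blast

subsection \<open>Root systems of adjoint type\<close>

lemma pair_commute: "pair x y = pair y x"
  by (simp add: pair_def mult.commute)

lemma pair_add_left: "pair (x + x') y = pair x y + pair x' y"
  by (simp add: pair_def distrib_right sum.distrib)

lemma pair_diff_left: "pair (x - x') y = pair x y - pair x' y"
  by (simp add: pair_def left_diff_distrib sum_subtractf)

lemma pair_uminus_left [simp]: "pair (- x) y = - pair x y"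
  by (simp add: pair_def sum_negf)

lemma pair_scale_left [simp]: "pair (c *s x) y = c * pair x y"
  by (simp add: pair_def sum_distrib_left mult.assoc)

lemma pair_zero_left [simp]: "pair 0 y = 0"
  by (simp add: pair_def)

lemma pair_sum_left: "pair (sum f A) y = (\<Sum>i\<in>A. pair (f i) y)"
  by (induction A rule: infinite_finite_induct) (simp_all add: pair_add_left)

lemma pair_add_right: "pair x (y + y') = pair x y + pair x y'"
  using pair_add_left[of y y' x] by (simp only: pair_commute)

lemma pair_diff_right: "pair x (y - y') = pair x y - pair x y'"
  using pair_diff_left[of y y' x] by (simp only: pair_commute)

lemma pair_uminus_right [simp]: "pair x (- y) = - pair x y"
  using pair_uminus_left[of y x] by (simp only: pair_commute)

lemma pair_scale_right [simp]: "pair x (c *s y) = c * pair x y"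
  using pair_scale_left[of c y x] by (simp only: pair_commute)

lemma pair_zero_right [simp]: "pair x 0 = 0"
  by (simp add: pair_def)

lemma pair_sum_right: "pair x (sum f A) = (\<Sum>i\<in>A. pair x (f i))"
  using pair_sum_left[of f A x] by (simp only: pair_commute)

lemma pair_axis_left [simp]: "pair (axis i 1) y = y $ i"
proof -
  have "pair (axis i 1) y = (\<Sum>j\<in>UNIV. if j = i then y $ j else 0)"
    unfolding pair_def by (intro sum.cong) (auto simp: axis_def)
  then show ?thesis by simp
qed

lemma pair_eqI: "(\<And>x. pair x y = pair x y') \<Longrightarrow> y = y'"
  by (metis pair_axis_left vec_eq_iff)

lemma pair_self_nonneg: "pair x x \<ge> 0"
  by (simp add: pair_def sum_nonneg)

lemma pair_self_pos:
  assumes "x \<noteq> 0"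
  shows "pair x x > 0"
proof -
  obtain i where "x $ i \<noteq> 0" using assms by (auto simp: vec_eq_iff)
  then have "x $ i * x $ i > 0" by (simp add: zero_less_mult_iff linorder_neq_iff disj_commute)
  then show ?thesis
    unfolding pair_def by (rule sum_pos2[OF finite UNIV_I]) simp
qed

lemma additive_scale:
  fixes g :: "'n::finite lat \<Rightarrow> 'm::finite lat"
  assumes "Modules.additive g"
  shows "g (c *s x) = c *s g x"
proof (induction c rule: int_induct[where k = 0])
  case base
  show ?case using Modules.additive.zero[OF assms] by simp
next
  case (step1 c)
  then show ?case by (simp add: vector_sadd_rdistrib Modules.additive.add[OF assms])
next
  case (step2 c)
  have "(c - 1) *s x = c *s x - x" "(c - 1) *s g x = c *s g x - g x"
    by (simp_all add: vec_eq_iff algebra_simps)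
  then show ?case using step2 by (simp add: Modules.additive.diff[OF assms])
qed

text \<open>The adjoint of \<open>w\<close> for the pairing. For \<open>w\<close> in the Weyl group
  it is the action of the inverse of \<open>w\<close> on characters.\<close>

definition transp :: "('n::finite lat \<Rightarrow> 'n lat) \<Rightarrow> 'n lat \<Rightarrow> 'n lat" where
  "transp w x = (\<chi> i. pair x (w (axis i 1)))"

lemma pair_transp:
  assumes "Modules.additive w"
  shows "pair (transp w x) y = pair x (w y)"
proof -
  have "pair x (w (\<Sum>i\<in>UNIV. (y $ i) *s axis i 1)) = (\<Sum>i\<in>UNIV. (y $ i) * pair x (w (axis i 1)))"
    by (simp add: Modules.additive.sum[OF assms] additive_scale[OF assms] pair_sum_right)
  then show ?thesis
    by (simp add: basis_expansion) (simp add: transp_def pair_def mult.commute)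
qed

locale adjoint_roots =
  fixes \<Phi> :: "'n::finite lat set" and cor :: "'n lat \<Rightarrow> 'n lat" and h :: "'n lat"
  assumes datum: "adjoint_root_datum \<Phi> cor"
    and regular: "\<forall>\<alpha>\<in>\<Phi>. pair \<alpha> h \<noteq> 0"
begin

abbreviation "W \<equiv> weyl_group \<Phi> cor"
abbreviation "Pos \<equiv> pos_roots \<Phi> h"
abbreviation "corefl \<equiv> coreflection cor"

definition refl where "refl \<alpha> x = x - pair x (cor \<alpha>) *s \<alpha>"

lemma finite_roots: "finite \<Phi>"
  and pair_cor: "\<alpha> \<in> \<Phi> \<Longrightarrow> pair \<alpha> (cor \<alpha>) = 2"
  and refl_root: "\<alpha> \<in> \<Phi> \<Longrightarrow> \<beta> \<in> \<Phi> \<Longrightarrow> refl \<alpha> \<beta> \<in> \<Phi>"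
  and double_root: "\<alpha> \<in> \<Phi> \<Longrightarrow> 2 *s \<alpha> \<notin> \<Phi>"
  and roots_span: "\<exists>c. x = (\<Sum>\<alpha>\<in>\<Phi>. c \<alpha> *s \<alpha>)"
  using datum by (auto simp: adjoint_root_datum_def refl_def)

lemma pair_refl: "pair (refl \<alpha> x) y = pair x (corefl \<alpha> y)"
  by (simp add: refl_def coreflection_def pair_diff_left pair_diff_right)

lemma refl_self: "\<alpha> \<in> \<Phi> \<Longrightarrow> refl \<alpha> \<alpha> = - \<alpha>"
  by (simp add: refl_def pair_cor vec_eq_iff)

lemma corefl_self: "\<alpha> \<in> \<Phi> \<Longrightarrow> corefl \<alpha> (cor \<alpha>) = - cor \<alpha>"
  by (simp add: coreflection_def pair_cor vec_eq_iff)

lemma uminus_root: "\<alpha> \<in> \<Phi> \<Longrightarrow> - \<alpha> \<in> \<Phi>"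
  using refl_root[of \<alpha> \<alpha>] by (simp add: refl_self)

lemma uminus_root_iff: "- \<alpha> \<in> \<Phi> \<longleftrightarrow> \<alpha> \<in> \<Phi>"
  using uminus_root[of "- \<alpha>"] uminus_root by auto

lemma root_nonzero: "\<alpha> \<in> \<Phi> \<Longrightarrow> \<alpha> \<noteq> 0" and cor_nonzero: "\<alpha> \<in> \<Phi> \<Longrightarrow> cor \<alpha> \<noteq> 0"
  using pair_cor by fastforce+

lemma refl_refl: "\<alpha> \<in> \<Phi> \<Longrightarrow> refl \<alpha> (refl \<alpha> x) = x"
  by (simp add: refl_def pair_diff_left pair_cor vec_eq_iff)

lemma corefl_corefl: "\<alpha> \<in> \<Phi> \<Longrightarrow> corefl \<alpha> (corefl \<alpha> y) = y"
  by (simp add: coreflection_def pair_diff_right pair_cor vec_eq_iff)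

lemma roots_separate: "(\<And>\<alpha>. \<alpha> \<in> \<Phi> \<Longrightarrow> pair \<alpha> y = 0) \<Longrightarrow> y = 0"
proof (rule pair_eqI)
  fix x
  assume *: "\<And>\<alpha>. \<alpha> \<in> \<Phi> \<Longrightarrow> pair \<alpha> y = 0"
  obtain c where "x = (\<Sum>\<alpha>\<in>\<Phi>. c \<alpha> *s \<alpha>)" using roots_span by blast
  then show "pair x y = pair x 0" by (simp add: pair_sum_left *)
qed

section \<open>Invariant form and uniqueness of coroots\<close>

definition Aut where "Aut = {g. Modules.additive g \<and> g ` \<Phi> = \<Phi>}"

lemma finite_Aut: "finite Aut"
proof -
  have "inj_on (\<lambda>g. restrict g \<Phi>) Aut"
  proof (rule inj_onI)
    fix f g assume fg: "f \<in> Aut" "g \<in> Aut" "restrict f \<Phi> = restrict g \<Phi>"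
    then have add: "Modules.additive f" "Modules.additive g" by (auto simp: Aut_def)
    have eq: "f \<alpha> = g \<alpha>" if "\<alpha> \<in> \<Phi>" for \<alpha>
      using fg(3) that by (metis restrict_apply')
    show "f = g"
    proof
      fix x
      obtain c where "x = (\<Sum>\<alpha>\<in>\<Phi>. c \<alpha> *s \<alpha>)" using roots_span by blast
      then show "f x = g x"
        by (simp add: add[THEN Modules.additive.sum] add[THEN additive_scale] eq)
    qed
  qed
  moreover have "(\<lambda>g. restrict g \<Phi>) ` Aut \<subseteq> PiE \<Phi> (\<lambda>_. \<Phi>)"
    by (auto simp: Aut_def)
  ultimately show ?thesis
    by (meson finite_PiE finite_roots inj_on_finite)
qed

text \<open>Summing over all additive maps that preserve the roots, and not over the Weyl group
  alone, makes the form invariant under any reflection preserving the roots, before it is known to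
  be some \<open>refl \<alpha>\<close>. The sum is not normalized, so its values stay
  integral.\<close>

definition B where "B x y = (\<Sum>g\<in>Aut. pair (g x) (g y))"

lemma id_Aut: "id \<in> Aut"
  by (auto simp: Aut_def Modules.additive_def)

lemma B_commute: "B x y = B y x"
  by (simp add: B_def pair_commute)

lemma B_add_left: "B (x + x') y = B x y + B x' y"
  by (auto simp: B_def Aut_def Modules.additive.add pair_add_left sum.distrib[symmetric] intro!: sum.cong)

lemma B_scale_left: "B (c *s x) y = c * B x y"
  by (auto simp: B_def Aut_def additive_scale sum_distrib_left intro!: sum.cong)

lemma B_scale_right: "B x (c *s y) = c * B x y"
  using B_scale_left[of c y x] by (simp only: B_commute)

lemma B_uminus_left: "B (- x) y = - B x y"
  using B_scale_left[of "- 1" x y] by (simp add: vector_sneg_minus1)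

lemma B_diff_left: "B (x - x') y = B x y - B x' y"
  using B_add_left[of x "- x'" y] by (simp add: B_uminus_left)

lemma B_diff_right: "B x (y - y') = B x y - B x y'"
  using B_diff_left[of y y' x] by (simp only: B_commute)

lemma B_zero_left: "B 0 y = 0"
  using B_scale_left[of 0 0 y] by simp

lemma B_sum_left: "B (sum f A) y = (\<Sum>i\<in>A. B (f i) y)"
  by (induction A rule: infinite_finite_induct) (simp_all add: B_add_left B_zero_left)

lemma B_sum_right: "B x (sum f A) = (\<Sum>i\<in>A. B x (f i))"
  using B_sum_left[of f A x] by (simp only: B_commute)

lemma B_pos: "x \<noteq> 0 \<Longrightarrow> B x x > 0"
  unfolding B_def
  by (rule sum_pos2[OF finite_Aut id_Aut]) (auto simp: pair_self_pos pair_self_nonneg)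

text \<open>The reflection defined by \<open>c\<close> lies in \<open>Aut\<close> and so preserves
  \<open>B\<close>; as it negates \<gamma>, B(x,\<gamma>) = - B(rx,\<gamma>), which expands to the
  formula. The formula determines \<open>c\<close> from \<gamma>.\<close>

lemma pair_reflection_form:
  assumes \<gamma>: "\<gamma> \<in> \<Phi>" and c: "pair \<gamma> c = 2" and closed: "\<And>x. x \<in> \<Phi> \<Longrightarrow> x - pair x c *s \<gamma> \<in> \<Phi>"
  shows "pair x c * B \<gamma> \<gamma> = 2 * B x \<gamma>"
proof -
  define r where "r x = x - pair x c *s \<gamma>" for x
  have rr: "r (r x) = x" for x
    by (simp add: r_def pair_diff_left c vec_eq_iff)
  have r_add: "Modules.additive r"
    by (simp add: r_def Modules.additive_def pair_add_left vector_sadd_rdistrib)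
  have r_roots: "r ` \<Phi> = \<Phi>"
  proof
    show "r ` \<Phi> \<subseteq> \<Phi>" using closed by (auto simp: r_def)
    then show "\<Phi> \<subseteq> r ` \<Phi>" using rr by (metis image_eqI image_subset_iff subsetI)
  qed
  have r_Aut: "g \<circ> r \<in> Aut" if "g \<in> Aut" for g
  proof -
    have "(g \<circ> r) ` \<Phi> = g ` (r ` \<Phi>)" by (simp only: image_comp)
    then show ?thesis
      using that r_add r_roots by (simp add: Aut_def Modules.additive_def)
  qed
  have inv: "B (r x) (r y) = B x y" for x y
    unfolding B_def
    by (rule sum.reindex_bij_witness[where i = "\<lambda>g. g \<circ> r" and j = "\<lambda>g. g \<circ> r"])
       (auto simp: fun_eq_iff rr r_Aut)
  have "r \<gamma> = - \<gamma>" by (simp add: r_def c vec_eq_iff)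
  then have "B x \<gamma> = - B (r x) \<gamma>"
    using inv[of x \<gamma>] B_uminus_left[of \<gamma> "r x"] by (simp add: B_commute)
  then show ?thesis by (simp add: r_def B_diff_left B_scale_left)
qed

lemma pair_cor_form: "\<gamma> \<in> \<Phi> \<Longrightarrow> pair x (cor \<gamma>) * B \<gamma> \<gamma> = 2 * B x \<gamma>"
  using refl_root by (intro pair_reflection_form) (auto simp: pair_cor refl_def)

lemma cor_unique:
  assumes \<gamma>: "\<gamma> \<in> \<Phi>" and c: "pair \<gamma> c = 2" and closed: "\<And>x. x \<in> \<Phi> \<Longrightarrow> x - pair x c *s \<gamma> \<in> \<Phi>"
  shows "c = cor \<gamma>"
proof (rule pair_eqI)
  fix x
  have "pair x c * B \<gamma> \<gamma> = pair x (cor \<gamma>) * B \<gamma> \<gamma>"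
    using pair_reflection_form[OF assms] pair_cor_form[OF \<gamma>] by simp
  then show "pair x c = pair x (cor \<gamma>)"
    using B_pos[OF root_nonzero[OF \<gamma>]] by simp
qed

lemma refl_diff_scale: "refl \<alpha> (x - c *s y) = refl \<alpha> x - c *s refl \<alpha> y"
  by (simp add: refl_def pair_diff_left vec_eq_iff algebra_simps)

text \<open>The datum only makes the set of coroots stable. That \<open>cor\<close> is equivariant
  follows by conjugating the reflection in \<beta> and using that a root determines its
  coroot.\<close>

lemma cor_refl:
  assumes \<alpha>: "\<alpha> \<in> \<Phi>" and \<beta>: "\<beta> \<in> \<Phi>"
  shows "cor (refl \<alpha> \<beta>) = corefl \<alpha> (cor \<beta>)"
proof (rule cor_unique[symmetric])
  show "refl \<alpha> \<beta> \<in> \<Phi>" using assms by (rule refl_root)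
  show "pair (refl \<alpha> \<beta>) (corefl \<alpha> (cor \<beta>)) = 2"
    by (simp add: pair_refl corefl_corefl \<alpha> \<beta> pair_cor)
  fix x assume "x \<in> \<Phi>"
  then have "refl \<alpha> (refl \<beta> (refl \<alpha> x)) \<in> \<Phi>" using assms by (intro refl_root)
  also have "refl \<alpha> (refl \<beta> (refl \<alpha> x)) = x - pair x (corefl \<alpha> (cor \<beta>)) *s refl \<alpha> \<beta>"
    by (simp add: refl_def[of \<beta>] refl_diff_scale refl_refl \<alpha> pair_refl)
  finally show "x - pair x (corefl \<alpha> (cor \<beta>)) *s refl \<alpha> \<beta> \<in> \<Phi>" .
qed

lemma cor_uminus: "\<alpha> \<in> \<Phi> \<Longrightarrow> cor (- \<alpha>) = - cor \<alpha>"
  using cor_refl[of \<alpha> \<alpha>] by (simp add: refl_self corefl_self)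

lemma corefl_uminus: "\<alpha> \<in> \<Phi> \<Longrightarrow> corefl (- \<alpha>) = corefl \<alpha>"
  by (simp add: fun_eq_iff coreflection_def cor_uminus vec_eq_iff)

lemma corefl_refl:
  assumes "\<alpha> \<in> \<Phi>" "\<beta> \<in> \<Phi>"
  shows "corefl (refl \<alpha> \<beta>) y = corefl \<alpha> (corefl \<beta> (corefl \<alpha> y))"
proof -
  have "corefl \<alpha> (y - c *s z) = corefl \<alpha> y - c *s corefl \<alpha> z" for c y z
    by (simp add: coreflection_def pair_diff_right vec_eq_iff algebra_simps)
  then have "corefl \<alpha> (corefl \<beta> (corefl \<alpha> y)) = y - pair \<beta> (corefl \<alpha> y) *s corefl \<alpha> (cor \<beta>)"
    using assms(1) by (simp add: coreflection_def[of cor \<beta>] corefl_corefl)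
  then show ?thesis
    by (simp add: coreflection_def[of cor "refl \<alpha> \<beta>"] pair_refl cor_refl assms)
qed

text \<open>The Cartan integers satisfy ab = 4. The values \<plusminus>1 and \<plusminus>4 of a
  would make one root plus or minus twice the other, which a reduced system forbids, and
  \<plusminus>2 gives the claim.\<close>

lemma root_proportional:
  assumes \<alpha>: "\<alpha> \<in> \<Phi>" and \<beta>: "\<beta> \<in> \<Phi>" and eq: "p *s \<alpha> = q *s \<beta>" and "p \<noteq> 0"
  shows "\<beta> = \<alpha> \<or> \<beta> = - \<alpha>"
proof -
  define a where "a = pair \<alpha> (cor \<beta>)"
  define b where "b = pair \<beta> (cor \<alpha>)"
  have 1: "2 * p = q * b" and 2: "p * a = 2 * q"
    using arg_cong[OF eq, of "\<lambda>x. pair x (cor \<alpha>)"] arg_cong[OF eq, of "\<lambda>x. pair x (cor \<beta>)"] pair_cor \<alpha> \<beta>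
    by (auto simp: a_def b_def)
  have "p * (a * b) = p * 4"
    using 1 2 by (metis mult.assoc mult.commute mult_2 numeral_Bit0 distrib_left mult.left_commute)
  then have ab: "a * b = 4" using \<open>p \<noteq> 0\<close> by simp
  have "q \<noteq> 0" using 1 \<open>p \<noteq> 0\<close> by auto
  have coord: "p * \<alpha> $ i = q * \<beta> $ i" for i
    using eq by (simp add: vec_eq_iff)
  have "\<bar>a\<bar> \<le> 4"
    using dvd_imp_le_int[of 4 a] dvd_triv_left[of a b] ab by simp
  then have "a \<in> {-4, -3, -2, -1, 0, 1, 2, 3, 4}" by auto
  then consider "a = 1" | "a = -1" | "a = 2" | "a = -2" | "a = 4" | "a = -4"
    using ab by auto presburger+
  then show ?thesis
  proof cases
    case 1
    then have "\<beta> = 2 *s \<alpha>" using 2 coord \<open>q \<noteq> 0\<close> by (auto simp: vec_eq_iff)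
    then show ?thesis using double_root \<alpha> \<beta> by auto
  next
    case 2
    then have "p = - (2 * q)" using \<open>p * a = 2 * q\<close> by simp
    then have "q * \<beta> $ i = q * (- (2 * \<alpha> $ i))" for i
      using coord[of i] by simp
    then have "\<beta> $ i = - (2 * \<alpha> $ i)" for i
      using \<open>q \<noteq> 0\<close> mult_left_cancel by blast
    then have "\<beta> = 2 *s (- \<alpha>)" by (simp add: vec_eq_iff)
    then show ?thesis using double_root[of "- \<alpha>"] uminus_root \<alpha> \<beta> by auto
  next
    case 3
    then have "\<beta> = \<alpha>" using 2 coord \<open>q \<noteq> 0\<close> by (auto simp: vec_eq_iff)
    then show ?thesis by simp
  next
    case 4
    then have "q = - p" using 2 by simp
    then have "p * \<beta> $ i = p * (- \<alpha> $ i)" for i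
      using coord[of i] by simp
    then have "\<beta> $ i = - \<alpha> $ i" for i
      using \<open>p \<noteq> 0\<close> mult_left_cancel by blast
    then have "\<beta> = - \<alpha>" by (simp add: vec_eq_iff)
    then show ?thesis by simp
  next
    case 5
    then have "\<alpha> = 2 *s \<beta>" using 2 coord \<open>p \<noteq> 0\<close> by (auto simp: vec_eq_iff)
    then show ?thesis using double_root \<alpha> \<beta> by auto
  next
    case 6
    then have "q = - (2 * p)" using 2 by simp
    then have "p * \<alpha> $ i = p * (- (2 * \<beta> $ i))" for i
      using coord[of i] by simp
    then have "\<alpha> $ i = - (2 * \<beta> $ i)" for i
      using \<open>p \<noteq> 0\<close> mult_left_cancel by blast
    then have "\<alpha> = 2 *s (- \<beta>)" by (simp add: vec_eq_iff)
    then show ?thesis using double_root[of "- \<beta>"] uminus_root \<alpha> \<beta> by auto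
  qed
qed

lemma pos_root: "\<alpha> \<in> Pos \<Longrightarrow> \<alpha> \<in> \<Phi>" and pos_pair: "\<alpha> \<in> Pos \<Longrightarrow> pair \<alpha> h > 0"
  by (auto simp: pos_roots_def)

lemma finite_Pos: "finite Pos"
  using finite_roots by (simp add: pos_roots_def)

lemma pos_or_neg: "\<alpha> \<in> \<Phi> \<Longrightarrow> \<alpha> \<in> Pos \<or> - \<alpha> \<in> Pos"
  using regular uminus_root by (fastforce simp: pos_roots_def)

lemma uminus_not_pos: "\<alpha> \<in> Pos \<Longrightarrow> - \<alpha> \<notin> Pos"
  by (auto simp: pos_roots_def)

lemma coroots_independent:
  assumes \<alpha>: "\<alpha> \<in> Pos" and \<beta>: "\<beta> \<in> Pos" and "\<alpha> \<noteq> \<beta>" and eq: "m *s cor \<alpha> = n *s cor \<beta>"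
  shows "m = 0"
proof (rule ccontr)
  assume "m \<noteq> 0"
  note \<Phi> = pos_root[OF \<alpha>] pos_root[OF \<beta>]
  have pos: "B \<alpha> \<alpha> > 0" "B \<beta> \<beta> > 0"
    using \<Phi> by (simp_all add: B_pos root_nonzero)
  \<comment> \<open>Under \<open>B\<close> the coroot of a root \<gamma> corresponds to
    2\<gamma>/B(\<gamma>,\<gamma>), so proportional coroots come from proportional roots; here the
    denominators are cleared.\<close>
  let ?z = "(m * B \<beta> \<beta>) *s \<alpha> - (n * B \<alpha> \<alpha>) *s \<beta>"
  have "B x ?z = 0" for x
  proof -
    have "m * pair x (cor \<alpha>) = n * pair x (cor \<beta>)"
      using arg_cong[OF eq, of "pair x"] by simp
    then have "m * (pair x (cor \<alpha>) * B \<alpha> \<alpha>) * B \<beta> \<beta> = n * (pair x (cor \<beta>) * B \<beta> \<beta>) * B \<alpha> \<alpha>"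
      by (metis (no_types, opaque_lifting) mult.assoc mult.commute)
    then have "2 * (m * B x \<alpha> * B \<beta> \<beta>) = 2 * (n * B x \<beta> * B \<alpha> \<alpha>)"
      unfolding pair_cor_form[OF \<Phi>(1)] pair_cor_form[OF \<Phi>(2)] by (simp add: mult_ac)
    then show ?thesis
      by (simp add: B_diff_right B_scale_right mult_ac)
  qed
  then have "?z = 0" using B_pos[of ?z] by force
  then have "(m * B \<beta> \<beta>) *s \<alpha> = (n * B \<alpha> \<alpha>) *s \<beta>" by simp
  then have "\<beta> = \<alpha> \<or> \<beta> = - \<alpha>"
    by (rule root_proportional[OF \<Phi>]) (use \<open>m \<noteq> 0\<close> pos in auto)
  then show False using assms uminus_not_pos by auto
qed

subsection \<open>Simple roots and fundamental coweights\<close>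

definition "S = {\<sigma> \<in> Pos. \<forall>\<beta>\<in>Pos. \<forall>\<gamma>\<in>Pos. \<sigma> \<noteq> \<beta> + \<gamma>}"

lemma simple_pos: "\<sigma> \<in> S \<Longrightarrow> \<sigma> \<in> Pos" and simple_root: "\<sigma> \<in> S \<Longrightarrow> \<sigma> \<in> \<Phi>"
  by (auto simp: S_def pos_root)

lemma finite_S: "finite S"
  using finite_Pos by (simp add: S_def)

lemma pos_decomposition:
  "\<alpha> \<in> Pos \<Longrightarrow> \<exists>c. (\<forall>\<sigma>. c \<sigma> \<ge> (0::int)) \<and> \<alpha> = (\<Sum>\<sigma>\<in>S. c \<sigma> *s \<sigma>)"
proof (induction "nat (pair \<alpha> h)" arbitrary: \<alpha> rule: less_induct)
  case less
  show ?case
  proof (cases "\<alpha> \<in> S")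
    case True
    have "(\<Sum>\<sigma>\<in>S. (if \<sigma> = \<alpha> then 1 else 0) *s \<sigma>) = (\<Sum>\<sigma>\<in>S. if \<sigma> = \<alpha> then \<alpha> else 0)"
      by (intro sum.cong) auto
    also have "\<dots> = \<alpha>" using True finite_S by simp
    finally show ?thesis by (intro exI[of _ "\<lambda>\<sigma>. if \<sigma> = \<alpha> then 1 else 0"]) auto
  next
    case False
    then obtain \<beta> \<gamma> where \<beta>\<gamma>: "\<beta> \<in> Pos" "\<gamma> \<in> Pos" "\<alpha> = \<beta> + \<gamma>"
      using less.prems by (auto simp: S_def)
    then have lt: "nat (pair \<beta> h) < nat (pair \<alpha> h)" "nat (pair \<gamma> h) < nat (pair \<alpha> h)"
      using pos_pair[of \<beta>] pos_pair[of \<gamma>] by (auto simp: pair_add_left)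
    obtain b c where "\<forall>\<sigma>. b \<sigma> \<ge> (0::int)" "\<beta> = (\<Sum>\<sigma>\<in>S. b \<sigma> *s \<sigma>)" "\<forall>\<sigma>. c \<sigma> \<ge> (0::int)" "\<gamma> = (\<Sum>\<sigma>\<in>S. c \<sigma> *s \<sigma>)"
      using less.hyps[OF lt(1) \<beta>\<gamma>(1)] less.hyps[OF lt(2) \<beta>\<gamma>(2)] by blast
    then show ?thesis
      using \<beta>\<gamma>(3) by (intro exI[of _ "\<lambda>\<sigma>. b \<sigma> + c \<sigma>"]) (auto simp: vector_sadd_rdistrib sum.distrib)
  qed
qed

text \<open>If B were positive, both Cartan integers would be positive. A value 1 makes \<sigma> -
  \<tau> a root and one of the two simple roots decomposable; values of at least 2 give \<sigma> -
  \<tau> a norm that is not positive.\<close>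

lemma simple_obtuse:
  assumes \<sigma>: "\<sigma> \<in> S" and \<tau>: "\<tau> \<in> S" and "\<sigma> \<noteq> \<tau>"
  shows "B \<sigma> \<tau> \<le> 0"
proof (rule ccontr)
  assume "\<not> B \<sigma> \<tau> \<le> 0"
  then have pos: "B \<sigma> \<tau> > 0" by simp
  note \<Phi> = simple_root[OF \<sigma>] simple_root[OF \<tau>]
  have Bpos: "B \<sigma> \<sigma> > 0" "B \<tau> \<tau> > 0"
    using \<Phi> by (simp_all add: B_pos root_nonzero)
  define a where "a = pair \<sigma> (cor \<tau>)"
  define b where "b = pair \<tau> (cor \<sigma>)"
  have a: "a * B \<tau> \<tau> = 2 * B \<sigma> \<tau>" and b: "b * B \<sigma> \<sigma> = 2 * B \<sigma> \<tau>"
    using pair_cor_form[OF \<Phi>(2), of \<sigma>] pair_cor_form[OF \<Phi>(1), of \<tau>] by (simp_all add: a_def b_def B_commute)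
  have "a > 0" "b > 0"
    using a b pos Bpos by (metis zero_less_mult_pos2 mult_pos_pos zero_less_numeral)+
  have diff: "\<sigma> - \<tau> \<notin> \<Phi>"
  proof
    assume "\<sigma> - \<tau> \<in> \<Phi>"
    then consider "\<sigma> - \<tau> \<in> Pos" | "\<tau> - \<sigma> \<in> Pos" using pos_or_neg[of "\<sigma> - \<tau>"] by auto
    then show False
    proof cases
      case 1
      then have "\<sigma> \<noteq> \<tau> + (\<sigma> - \<tau>)" using \<sigma> simple_pos[OF \<tau>] unfolding S_def by blast
      then show False by simp
    next
      case 2
      then have "\<tau> \<noteq> \<sigma> + (\<tau> - \<sigma>)" using \<tau> simple_pos[OF \<sigma>] unfolding S_def by blast
      then show False by simp
    qed
  qed
  have "a \<noteq> 1"
    using diff refl_root[OF \<Phi>(2,1)] by (auto simp: refl_def a_def)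
  moreover have "b \<noteq> 1"
    using diff refl_root[OF \<Phi>] uminus_root_iff[of "\<sigma> - \<tau>"] by (auto simp: refl_def b_def)
  ultimately have "a \<ge> 2" "b \<ge> 2" using \<open>a > 0\<close> \<open>b > 0\<close> by auto
  then have "2 * B \<tau> \<tau> \<le> 2 * B \<sigma> \<tau>" "2 * B \<sigma> \<sigma> \<le> 2 * B \<sigma> \<tau>"
    using Bpos mult_right_mono[of 2 a "B \<tau> \<tau>"] mult_right_mono[of 2 b "B \<sigma> \<sigma>"] a b by auto
  then have "B (\<sigma> - \<tau>) (\<sigma> - \<tau>) \<le> 0"
    by (simp add: B_diff_left B_diff_right B_commute[of \<tau> \<sigma>])
  then show False using B_pos[of "\<sigma> - \<tau>"] \<open>\<sigma> \<noteq> \<tau>\<close> by force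
qed

text \<open>A relation is split into the positive and negative parts of its coefficients. Both
  describe one vector, whose norm is at most 0 because distinct simple roots are obtuse; pairing it
  with \<open>h\<close> then rules out a positive coefficient.\<close>

lemma simple_independent:
  assumes zero: "(\<Sum>\<sigma>\<in>S. c \<sigma> *s \<sigma>) = 0" and \<tau>: "\<tau> \<in> S"
  shows "c \<tau> = 0"
proof -
  have nonpos: "d \<tau> \<le> 0" if d: "(\<Sum>\<sigma>\<in>S. d \<sigma> *s \<sigma>) = 0" and \<tau>: "\<tau> \<in> S" for d :: "'n lat \<Rightarrow> int" and \<tau>
  proof (rule ccontr)
    assume "\<not> d \<tau> \<le> 0"
    define p where "p \<sigma> = max (d \<sigma>) 0" for \<sigma>
    define q where "q \<sigma> = max (- d \<sigma>) 0" for \<sigma>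
    let ?z = "\<Sum>\<sigma>\<in>S. p \<sigma> *s \<sigma>"
    have "?z - (\<Sum>\<sigma>\<in>S. q \<sigma> *s \<sigma>) = (\<Sum>\<sigma>\<in>S. d \<sigma> *s \<sigma>)"
      unfolding sum_subtractf[symmetric]
      by (intro sum.cong) (auto simp: p_def q_def vec_eq_iff max_def)
    then have z: "?z = (\<Sum>\<sigma>\<in>S. q \<sigma> *s \<sigma>)" using d by simp
    have "B ?z ?z = B ?z (\<Sum>\<sigma>\<in>S. q \<sigma> *s \<sigma>)" using z by simp
    also have "\<dots> = (\<Sum>\<sigma>\<in>S. \<Sum>\<rho>\<in>S. p \<sigma> * (q \<rho> * B \<sigma> \<rho>))"
      unfolding B_sum_left B_scale_left
      unfolding B_sum_right B_scale_right sum_distrib_left ..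
    also have "\<dots> \<le> 0"
    proof (intro sum_nonpos)
      fix \<sigma> \<rho> assume \<sigma>\<rho>: "\<sigma> \<in> S" "\<rho> \<in> S"
      show "p \<sigma> * (q \<rho> * B \<sigma> \<rho>) \<le> 0"
      proof (cases "\<sigma> = \<rho>")
        case True
        then show ?thesis by (auto simp: p_def q_def max_def)
      next
        case False
        then have "B \<sigma> \<rho> \<le> 0" using simple_obtuse \<sigma>\<rho> by blast
        then show ?thesis by (intro mult_nonneg_nonpos) (auto simp: p_def q_def)
      qed
    qed
    finally have "?z = 0" using B_pos[of ?z] by force
    then have "(\<Sum>\<sigma>\<in>S. p \<sigma> * pair \<sigma> h) = 0"
      using pair_sum_left[of "\<lambda>\<sigma>. p \<sigma> *s \<sigma>" S h] by simp
    moreover have "(\<Sum>\<sigma>\<in>S. p \<sigma> * pair \<sigma> h) > 0"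
      using \<open>\<not> d \<tau> \<le> 0\<close> pos_pair[OF simple_pos]
      by (intro sum_pos2[OF finite_S \<tau>])
         (auto simp: p_def less_imp_le \<tau> intro!: mult_pos_pos mult_nonneg_nonneg)
    ultimately show False by simp
  qed
  have "c \<tau> \<le> 0" using zero \<tau> by (rule nonpos)
  moreover have "- c \<tau> \<le> 0"
  proof (rule nonpos[OF _ \<tau>])
    have "(\<Sum>\<sigma>\<in>S. - c \<sigma> *s \<sigma>) = - (\<Sum>\<sigma>\<in>S. c \<sigma> *s \<sigma>)"
      unfolding sum_negf[symmetric] by (intro sum.cong) (auto simp: vec_eq_iff)
    then show "(\<Sum>\<sigma>\<in>S. - c \<sigma> *s \<sigma>) = 0" using zero by simp
  qed
  ultimately show ?thesis by simp
qed

text \<open>Here adjoint type enters: the roots span all characters over the integers, and each root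
  is an integral combination of simple ones.\<close>

lemma simple_span: "\<exists>c. x = (\<Sum>\<sigma>\<in>S. c \<sigma> *s \<sigma>)"
proof -
  have "\<exists>c. \<alpha> = (\<Sum>\<sigma>\<in>S. c \<sigma> *s \<sigma>)" if "\<alpha> \<in> \<Phi>" for \<alpha>
  proof (cases "\<alpha> \<in> Pos")
    case True
    then show ?thesis using pos_decomposition by blast
  next
    case False
    then obtain c where "- \<alpha> = (\<Sum>\<sigma>\<in>S. c \<sigma> *s \<sigma>)"
      using pos_decomposition[of "- \<alpha>"] pos_or_neg[OF \<open>\<alpha> \<in> \<Phi>\<close>] by blast
    then have "\<alpha> = - (\<Sum>\<sigma>\<in>S. c \<sigma> *s \<sigma>)" by (metis minus_minus)
    also have "\<dots> = (\<Sum>\<sigma>\<in>S. - c \<sigma> *s \<sigma>)"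
      unfolding sum_negf[symmetric] by (intro sum.cong) (auto simp: vec_eq_iff)
    finally show ?thesis by (rule exI[of _ "\<lambda>\<sigma>. - c \<sigma>"])
  qed
  then obtain d where d: "\<And>\<alpha>. \<alpha> \<in> \<Phi> \<Longrightarrow> \<alpha> = (\<Sum>\<sigma>\<in>S. d \<alpha> \<sigma> *s \<sigma>)" by metis
  obtain c where "x = (\<Sum>\<alpha>\<in>\<Phi>. c \<alpha> *s \<alpha>)" using roots_span by blast
  also have "\<dots> = (\<Sum>\<alpha>\<in>\<Phi>. \<Sum>\<sigma>\<in>S. (c \<alpha> * d \<alpha> \<sigma>) *s \<sigma>)"
  proof (intro sum.cong HOL.refl)
    fix \<alpha> assume "\<alpha> \<in> \<Phi>"
    then have "c \<alpha> *s \<alpha> = c \<alpha> *s (\<Sum>\<sigma>\<in>S. d \<alpha> \<sigma> *s \<sigma>)" using d by simp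
    also have "\<dots> = (\<Sum>\<sigma>\<in>S. (c \<alpha> * d \<alpha> \<sigma>) *s \<sigma>)"
      by (simp add: vec_eq_iff sum_distrib_left mult.assoc)
    finally show "c \<alpha> *s \<alpha> = (\<Sum>\<sigma>\<in>S. (c \<alpha> * d \<alpha> \<sigma>) *s \<sigma>)" .
  qed
  also have "\<dots> = (\<Sum>\<sigma>\<in>S. (\<Sum>\<alpha>\<in>\<Phi>. c \<alpha> * d \<alpha> \<sigma>) *s \<sigma>)"
    by (subst sum.swap) (simp add: vec_eq_iff sum_distrib_right)
  finally show ?thesis by (rule exI[of _ "\<lambda>\<sigma>. \<Sum>\<alpha>\<in>\<Phi>. c \<alpha> * d \<alpha> \<sigma>"])
qed

text \<open>The basis dual to the simple roots, that is the fundamental coweights;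
  \<open>simple_span\<close> puts them into the cocharacter lattice itself.\<close>

definition fw where "fw = (SOME f. \<forall>x. x = (\<Sum>\<sigma>\<in>S. pair x (f \<sigma>) *s \<sigma>))"

lemma simple_expansion: "x = (\<Sum>\<sigma>\<in>S. pair x (fw \<sigma>) *s \<sigma>)"
proof -
  obtain C where C: "\<And>i. axis i 1 = (\<Sum>\<sigma>\<in>S. C i \<sigma> *s \<sigma>)"
    using choice[of "\<lambda>i c. axis i 1 = (\<Sum>\<sigma>\<in>S. c \<sigma> *s \<sigma>)"] simple_span by blast
  have "\<forall>x. x = (\<Sum>\<sigma>\<in>S. pair x (\<chi> i. C i \<sigma>) *s \<sigma>)"
  proof
    fix x
    have "x = (\<Sum>i\<in>UNIV. (x $ i) *s (\<Sum>\<sigma>\<in>S. C i \<sigma> *s \<sigma>))"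
      unfolding C[symmetric] by (rule basis_expansion[symmetric])
    also have "\<dots> = (\<Sum>i\<in>UNIV. \<Sum>\<sigma>\<in>S. (x $ i * C i \<sigma>) *s \<sigma>)"
      by (simp add: vec_eq_iff sum_distrib_left mult.assoc)
    also have "\<dots> = (\<Sum>\<sigma>\<in>S. pair x (\<chi> i. C i \<sigma>) *s \<sigma>)"
      by (subst sum.swap) (simp add: vec_eq_iff sum_distrib_right pair_def)
    finally show "x = (\<Sum>\<sigma>\<in>S. pair x (\<chi> i. C i \<sigma>) *s \<sigma>)" .
  qed
  then have "\<forall>x. x = (\<Sum>\<sigma>\<in>S. pair x (fw \<sigma>) *s \<sigma>)"
    unfolding fw_def by (rule someI[where x = "\<lambda>\<sigma>. \<chi> i. C i \<sigma>"])
  then show ?thesis by blast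
qed

lemma pair_simple_fw:
  assumes "\<sigma> \<in> S" "\<tau> \<in> S"
  shows "pair \<tau> (fw \<sigma>) = (if \<sigma> = \<tau> then 1 else 0)"
proof -
  have "(\<Sum>\<rho>\<in>S. (if \<rho> = \<tau> then 1 else 0) *s \<rho>) = (\<Sum>\<rho>\<in>S. if \<rho> = \<tau> then \<tau> else 0)"
    by (intro sum.cong) auto
  also have "\<dots> = \<tau>" using assms finite_S by simp
  also have "\<dots> = (\<Sum>\<rho>\<in>S. pair \<tau> (fw \<rho>) *s \<rho>)" by (rule simple_expansion)
  finally have "(\<Sum>\<rho>\<in>S. (pair \<tau> (fw \<rho>) - (if \<rho> = \<tau> then 1 else 0)) *s \<rho>) = 0"
    by (simp add: vec_eq_iff left_diff_distrib sum_subtractf)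
  from simple_independent[OF this assms(1)] show ?thesis by simp
qed

lemma pair_pos_fw:
  assumes "\<alpha> \<in> Pos" "\<sigma> \<in> S"
  shows "pair \<alpha> (fw \<sigma>) \<ge> 0"
proof -
  obtain c where c: "\<forall>\<sigma>. c \<sigma> \<ge> (0::int)" "\<alpha> = (\<Sum>\<tau>\<in>S. c \<tau> *s \<tau>)"
    using pos_decomposition assms by blast
  have "pair \<alpha> (fw \<sigma>) = (\<Sum>\<tau>\<in>S. c \<tau> * pair \<tau> (fw \<sigma>))"
    by (subst c(2)) (simp add: pair_sum_left)
  also have "\<dots> \<ge> 0" using c(1) assms by (intro sum_nonneg) (simp add: pair_simple_fw)
  finally show ?thesis .
qed

lemma fw_expansion: "y = (\<Sum>\<sigma>\<in>S. pair \<sigma> y *s fw \<sigma>)"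
proof (rule pair_eqI)
  fix x
  have "pair x y = pair (\<Sum>\<sigma>\<in>S. pair x (fw \<sigma>) *s \<sigma>) y"
    using simple_expansion[of x] by simp
  then show "pair x y = pair x (\<Sum>\<sigma>\<in>S. pair \<sigma> y *s fw \<sigma>)"
    by (simp add: pair_sum_left pair_sum_right mult.commute)
qed

text \<open>\<beta> is not a multiple of \<sigma>, so it has a positive coordinate at another simple
  root. \<open>refl \<sigma>\<close> leaves that coordinate unchanged, and a negative root has no
  positive coordinate.\<close>

lemma simple_refl_pos:
  assumes \<sigma>: "\<sigma> \<in> S" and \<beta>: "\<beta> \<in> Pos" and "\<beta> \<noteq> \<sigma>"
  shows "refl \<sigma> \<beta> \<in> Pos"
proof -
  have "\<exists>\<tau>\<in>S. \<tau> \<noteq> \<sigma> \<and> pair \<beta> (fw \<tau>) \<noteq> 0"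
  proof (rule ccontr)
    assume "\<not> ?thesis"
    then have "(\<Sum>\<tau>\<in>S. pair \<beta> (fw \<tau>) *s \<tau>) = (\<Sum>\<tau>\<in>S. if \<tau> = \<sigma> then pair \<beta> (fw \<sigma>) *s \<sigma> else 0)"
      by (intro sum.cong) auto
    then have "1 *s \<beta> = pair \<beta> (fw \<sigma>) *s \<sigma>"
      using \<sigma> finite_S simple_expansion[of \<beta>] by simp
    then have "\<sigma> = \<beta> \<or> \<sigma> = - \<beta>"
      using \<sigma> \<beta> by (intro root_proportional[where p = 1]) (auto simp: pos_root simple_root)
    then show False
      using \<open>\<beta> \<noteq> \<sigma>\<close> \<beta> simple_pos[OF \<sigma>] uminus_not_pos by auto
  qed
  then obtain \<tau> where \<tau>: "\<tau> \<in> S" "\<tau> \<noteq> \<sigma>" "pair \<beta> (fw \<tau>) > 0"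
    using pair_pos_fw[OF \<beta>] by force
  have eq: "pair (refl \<sigma> \<beta>) (fw \<tau>) = pair \<beta> (fw \<tau>)"
    using \<tau> \<sigma> by (simp add: refl_def pair_diff_left pair_simple_fw)
  show ?thesis
  proof (rule ccontr)
    assume "refl \<sigma> \<beta> \<notin> Pos"
    then have "- refl \<sigma> \<beta> \<in> Pos"
      using pos_or_neg refl_root simple_root[OF \<sigma>] pos_root[OF \<beta>] by blast
    from pair_pos_fw[OF this \<tau>(1)] show False using eq \<tau>(3) by simp
  qed
qed

lemma simple_refl_bij: "\<sigma> \<in> S \<Longrightarrow> bij_betw (refl \<sigma>) (Pos - {\<sigma>}) (Pos - {\<sigma>})"
proof (rule bij_betw_byWitness[where f' = "refl \<sigma>"])
  assume \<sigma>: "\<sigma> \<in> S"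
  have "refl \<sigma> \<beta> \<noteq> \<sigma>" if "\<beta> \<in> Pos" for \<beta>
  proof
    assume "refl \<sigma> \<beta> = \<sigma>"
    then have "\<beta> = - \<sigma>" using refl_refl[of \<sigma> \<beta>] refl_self[of \<sigma>] simple_root[OF \<sigma>] by simp
    then show False using that simple_pos[OF \<sigma>] uminus_not_pos by auto
  qed
  then show "refl \<sigma> ` (Pos - {\<sigma>}) \<subseteq> Pos - {\<sigma>}" "refl \<sigma> ` (Pos - {\<sigma>}) \<subseteq> Pos - {\<sigma>}"
    using simple_refl_pos[OF \<sigma>] by auto
qed (auto simp: refl_refl simple_root)

definition "rho = (\<Sum>\<sigma>\<in>S. fw \<sigma>)"

lemma pair_simple_rho: "\<sigma> \<in> S \<Longrightarrow> pair \<sigma> rho = 1"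
  using finite_S by (simp add: rho_def pair_sum_right pair_simple_fw)

lemma additive_corefl: "Modules.additive (corefl \<alpha>)"
  by (simp add: Modules.additive_def coreflection_def pair_add_right vector_sadd_rdistrib)

text \<open>Each simple reflection permutes the positive roots other than its own, so the sum pairs
  to 2 with every simple root. In particular it is divisible by 2 in the lattice.\<close>

lemma sum_coroots: "(\<Sum>\<alpha>\<in>Pos. cor \<alpha>) = 2 *s rho"
proof -
  let ?s = "\<Sum>\<alpha>\<in>Pos. cor \<alpha>"
  have 2: "pair \<sigma> ?s = 2" if \<sigma>: "\<sigma> \<in> S" for \<sigma>
  proof -
    note \<sigma>' = simple_pos[OF \<sigma>] simple_root[OF \<sigma>]
    have split: "?s = cor \<sigma> + (\<Sum>\<alpha>\<in>Pos - {\<sigma>}. cor \<alpha>)"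
      using finite_Pos \<sigma>' by (simp add: sum.remove)
    have "corefl \<sigma> ?s = - cor \<sigma> + (\<Sum>\<alpha>\<in>Pos - {\<sigma>}. corefl \<sigma> (cor \<alpha>))"
      unfolding split
      by (simp add: Modules.additive.add[OF additive_corefl] Modules.additive.sum[OF additive_corefl] corefl_self \<sigma>')
    also have "(\<Sum>\<alpha>\<in>Pos - {\<sigma>}. corefl \<sigma> (cor \<alpha>)) = (\<Sum>\<alpha>\<in>Pos - {\<sigma>}. cor (refl \<sigma> \<alpha>))"
      using \<sigma>' by (intro sum.cong) (auto simp: cor_refl pos_root)
    also have "\<dots> = (\<Sum>\<alpha>\<in>Pos - {\<sigma>}. cor \<alpha>)"
      by (rule sum.reindex_bij_betw[OF simple_refl_bij[OF \<sigma>]])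
    finally have "corefl \<sigma> ?s = ?s - 2 *s cor \<sigma>"
      unfolding split by (simp add: vec_eq_iff)
    then have "(pair \<sigma> ?s - 2) *s cor \<sigma> = 0"
      by (simp add: coreflection_def vec_eq_iff left_diff_distrib)
    then show ?thesis using cor_nonzero[OF \<sigma>'(2)] by (auto simp: vec_eq_iff)
  qed
  have "?s = (\<Sum>\<sigma>\<in>S. pair \<sigma> ?s *s fw \<sigma>)" by (rule fw_expansion)
  also have "\<dots> = (\<Sum>\<sigma>\<in>S. 2 *s fw \<sigma>)" by (intro sum.cong HOL.refl) (simp add: 2)
  also have "\<dots> = 2 *s rho" by (simp add: rho_def vec_eq_iff sum_distrib_left)
  finally show ?thesis .
qed


subsection \<open>The Weyl group\<close>

lemma weyl_induct [consumes 1, case_names id refl]: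
  assumes "w \<in> W" "P id" "\<And>\<alpha> w. \<alpha> \<in> \<Phi> \<Longrightarrow> w \<in> W \<Longrightarrow> P w \<Longrightarrow> P (corefl \<alpha> \<circ> w)"
  shows "P w"
  using assms(1)
proof (induction rule: weyl_group.induct)
  case id
  show ?case using assms(2) unfolding id_def .
next
  case (refl \<alpha> w)
  show ?case using assms(3)[OF refl.hyps refl.IH] unfolding comp_def .
qed

lemma weyl_comp: "v \<in> W \<Longrightarrow> w \<in> W \<Longrightarrow> v \<circ> w \<in> W"
  by (induction rule: weyl_induct) (auto simp: comp_assoc intro: weyl_group.refl)

lemma corefl_weyl: "\<alpha> \<in> \<Phi> \<Longrightarrow> corefl \<alpha> \<in> W"
  using weyl_group.refl[OF _ weyl_group.id] by fastforce

lemma corefl_involution: "\<alpha> \<in> \<Phi> \<Longrightarrow> corefl \<alpha> \<circ> corefl \<alpha> = id"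
  by (simp add: fun_eq_iff corefl_corefl)

lemma weyl_bij_inv: "w \<in> W \<Longrightarrow> bij w \<and> inv w \<in> W"
proof (induction rule: weyl_induct)
  case id
  show ?case using weyl_group.id bij_id inv_id by metis
next
  case (refl \<alpha> w)
  have bij: "bij (corefl \<alpha>)"
    using corefl_involution[OF refl.hyps(1)] o_bij by blast
  have "inv (corefl \<alpha>) = corefl \<alpha>"
    using corefl_involution[OF refl.hyps(1)] by (simp add: inv_unique_comp)
  then have "inv (corefl \<alpha> \<circ> w) = inv w \<circ> corefl \<alpha>"
    using bij refl.IH by (simp only: o_inv_distrib)
  then show ?case
    using bij refl corefl_weyl bij_comp weyl_comp by metis
qed

lemmas weyl_bij = weyl_bij_inv[THEN conjunct1] and weyl_inv = weyl_bij_inv[THEN conjunct2]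

lemma weyl_inv_comp: "w \<in> W \<Longrightarrow> w \<circ> inv w = id" "w \<in> W \<Longrightarrow> inv w \<circ> w = id"
  using weyl_bij[of w] by (auto simp: fun_eq_iff bij_is_surj surj_f_inv_f bij_is_inj)

lemma weyl_additive: "w \<in> W \<Longrightarrow> Modules.additive w"
proof (induction rule: weyl_induct)
  case (refl \<alpha> w)
  then show ?case using additive_corefl[of \<alpha>] by (simp add: Modules.additive_def)
qed (simp add: Modules.additive_def)

lemma pair_transp_weyl: "w \<in> W \<Longrightarrow> pair (transp w x) y = pair x (w y)"
  by (simp add: pair_transp weyl_additive)

lemma pair_eqI_left: "(\<And>y. pair x y = pair x' y) \<Longrightarrow> x = x'"
  by (rule pair_eqI) (simp only: pair_commute)

lemma transp_add: "w \<in> W \<Longrightarrow> transp w (x + y) = transp w x + transp w y"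
  by (rule pair_eqI_left) (simp add: pair_transp_weyl pair_add_left)

lemma transp_uminus: "w \<in> W \<Longrightarrow> transp w (- x) = - transp w x"
  by (rule pair_eqI_left) (simp add: pair_transp_weyl)

lemma transp_id: "transp id x = x"
  by (simp add: transp_def pair_commute[of x] vec_eq_iff)

lemma transp_root: "w \<in> W \<Longrightarrow> \<alpha> \<in> \<Phi> \<Longrightarrow> transp w \<alpha> \<in> \<Phi>"
proof (induction arbitrary: \<alpha> rule: weyl_induct)
  case id
  then show ?case using transp_id by metis
next
  case (refl \<beta> w)
  have "transp (corefl \<beta> \<circ> w) \<alpha> = transp w (refl \<beta> \<alpha>)"
    using refl.hyps by (intro pair_eqI_left) (simp add: pair_transp_weyl weyl_group.refl pair_refl)
  then show ?case using refl.IH[OF refl_root[OF refl.hyps(1) refl.prems]] by (simp only:)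
qed

lemma transp_inj: "w \<in> W \<Longrightarrow> inj (transp w)"
proof (rule injI)
  fix x y assume w: "w \<in> W" and eq: "transp w x = transp w y"
  show "x = y"
  proof (rule pair_eqI_left)
    fix z
    have "pair x (w (inv w z)) = pair y (w (inv w z))"
      using eq by (simp flip: pair_transp_weyl[OF w])
    then show "pair x z = pair y z"
      using weyl_bij[OF w] by (simp add: bij_is_surj surj_f_inv_f)
  qed
qed

lemma transp_roots: "w \<in> W \<Longrightarrow> transp w ` \<Phi> = \<Phi>"
  using transp_root card_image[OF inj_on_subset[OF transp_inj subset_UNIV]] finite_roots
  by (intro card_subset_eq) auto

lemma transp_Aut: "w \<in> W \<Longrightarrow> transp w \<in> Aut"
  by (simp add: Aut_def transp_roots Modules.additive_def transp_add)

lemma weyl_transp_eqI: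
  assumes "v \<in> W" "w \<in> W" "transp v = transp w"
  shows "v = w"
proof
  fix y
  show "v y = w y"
    using assms by (intro pair_eqI) (simp flip: pair_transp_weyl)
qed

lemma finite_weyl: "finite W"
proof (rule finite_imageD)
  show "finite (transp ` W)"
    using transp_Aut by (intro finite_subset[OF _ finite_Aut]) auto
  show "inj_on transp W"
    by (rule inj_onI) (rule weyl_transp_eqI)
qed

subsection \<open>Generation by simple reflections and simple transitivity\<close>

text \<open>Words are kept as lists so that letters can be deleted. The same word acts on characters
  by \<open>refl\<close> and on cocharacters by \<open>corefl\<close>; passing across the pairing
  reverses it.\<close>

primrec actX where
  "actX [] x = x"
| "actX (\<sigma> # ws) x = refl \<sigma> (actX ws x)"

primrec actY where
  "actY [] y = y"
| "actY (\<sigma> # ws) y = corefl \<sigma> (actY ws y)"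

lemma actX_append: "actX (us @ vs) x = actX us (actX vs x)"
  by (induction us) simp_all

lemma actY_append: "actY (us @ vs) y = actY us (actY vs y)"
  by (induction us) simp_all

lemma pair_actX_rev: "pair (actX (rev ws) x) y = pair x (actY ws y)"
  by (induction ws arbitrary: x) (simp_all add: actX_append pair_refl)

lemma refl_uminus: "refl \<alpha> (- x) = - refl \<alpha> x"
  by (simp add: refl_def vec_eq_iff)

lemma actX_uminus: "actX ws (- x) = - actX ws x"
  by (induction ws) (simp_all add: refl_uminus)

lemma actX_root: "set ws \<subseteq> \<Phi> \<Longrightarrow> \<alpha> \<in> \<Phi> \<Longrightarrow> actX ws \<alpha> \<in> \<Phi>"
  by (induction ws) (auto simp: refl_root)

lemma refl_conj:
  assumes "\<alpha> \<in> \<Phi>" "\<beta> \<in> \<Phi>"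
  shows "refl (refl \<alpha> \<beta>) (refl \<alpha> x) = refl \<alpha> (refl \<beta> x)"
  by (rule pair_eqI_left) (simp add: pair_refl corefl_refl assms corefl_corefl)

lemma actX_refl:
  assumes "set ws \<subseteq> \<Phi>" "\<beta> \<in> \<Phi>"
  shows "actX ws (refl \<beta> x) = refl (actX ws \<beta>) (actX ws x)"
  using assms
  by (induction ws) (simp_all add: refl_conj actX_root)

text \<open>At a letter where the image of \<tau> turns negative, that image must be the letter
  itself, since a simple reflection keeps all other positive roots positive.\<close>

lemma sign_change:
  assumes "set ws \<subseteq> S" "\<tau> \<in> Pos" "actX ws \<tau> \<notin> Pos"
  shows "\<exists>us \<sigma> vs. ws = us @ \<sigma> # vs \<and> actX vs \<tau> = \<sigma>"
  using assms
proof (induction ws)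
  case (Cons \<sigma> ws)
  show ?case
  proof (cases "actX ws \<tau> \<in> Pos")
    case True
    then have "actX ws \<tau> = \<sigma>"
      using Cons.prems simple_refl_pos[of \<sigma> "actX ws \<tau>"] by auto
    then show ?thesis by (metis append_Nil)
  next
    case False
    then obtain us \<sigma>' vs where "ws = us @ \<sigma>' # vs" "actX vs \<tau> = \<sigma>'"
      using Cons by auto
    then show ?thesis by (metis append_Cons)
  qed
qed simp

text \<open>The deletion argument: if the word \<open>ws @ [\<tau>]\<close> keeps every positive root positive, then some
  letter \<open>\<sigma>\<close> is reached as \<open>vs \<tau> = \<sigma>\<close>, and \<open>\<sigma> vs \<tau> = vs\<close> shortens the word by two letters.\<close>

lemma word_trivial:
  "set ws \<subseteq> S \<Longrightarrow> (\<And>\<beta>. \<beta> \<in> Pos \<Longrightarrow> actX ws \<beta> \<in> Pos) \<Longrightarrow> actX ws x = x"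
proof (induction "length ws" arbitrary: ws x rule: less_induct)
  case less
  show ?case
  proof (cases ws rule: rev_cases)
    case (snoc vs \<tau>)
    have S: "set vs \<subseteq> S" "\<tau> \<in> S" using less.prems(1) snoc by auto
    then have \<tau>: "\<tau> \<in> Pos" "\<tau> \<in> \<Phi>" by (auto simp: simple_pos simple_root)
    have "- actX vs \<tau> \<in> Pos"
      using less.prems(2)[OF \<tau>(1)] \<tau>(2) by (simp add: snoc actX_append refl_self actX_uminus)
    then have "actX vs \<tau> \<notin> Pos" using uminus_not_pos by fastforce
    then obtain us \<sigma> qs where q: "vs = us @ \<sigma> # qs" "actX qs \<tau> = \<sigma>"
      using sign_change[OF S(1) \<tau>(1)] by blast
    have \<Phi>: "set qs \<subseteq> \<Phi>" "\<sigma> \<in> \<Phi>"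
      using S(1) q(1) simple_root by auto
    have short: "actX ws y = actX (us @ qs) y" for y
      using \<Phi> \<tau>(2) q(2) by (simp add: snoc q(1) actX_append actX_refl refl_refl)
    have "actX (us @ qs) x = x"
      using less.prems(2) S(1) unfolding short
      by (intro less.hyps) (auto simp: snoc q(1))
    then show ?thesis by (simp add: short)
  qed simp
qed

text \<open>B(\<alpha>,\<alpha>) > 0 is a combination of the B(\<sigma>,\<alpha>) with nonnegative
  coefficients, so one of these is positive. Reflecting in that \<sigma> lowers the height, which
  drives the induction of \<open>pos_corefl_word\<close>.\<close>

lemma simple_height_reduction:
  assumes \<alpha>: "\<alpha> \<in> Pos"
  shows "\<exists>\<sigma>\<in>S. pair \<alpha> (cor \<sigma>) > 0"
proof -
  have "B \<alpha> \<alpha> = B (\<Sum>\<sigma>\<in>S. pair \<alpha> (fw \<sigma>) *s \<sigma>) \<alpha>"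
    using simple_expansion[of \<alpha>] by simp
  also have "\<dots> = (\<Sum>\<sigma>\<in>S. pair \<alpha> (fw \<sigma>) * B \<sigma> \<alpha>)"
    by (simp only: B_sum_left B_scale_left)
  finally have "(\<Sum>\<sigma>\<in>S. pair \<alpha> (fw \<sigma>) * B \<sigma> \<alpha>) > 0"
    using B_pos[OF root_nonzero[OF pos_root[OF \<alpha>]]] by simp
  then obtain \<sigma> where \<sigma>: "\<sigma> \<in> S" "pair \<alpha> (fw \<sigma>) * B \<sigma> \<alpha> > 0"
    using sum_nonpos[of S "\<lambda>\<sigma>. pair \<alpha> (fw \<sigma>) * B \<sigma> \<alpha>"] by force
  then have "B \<alpha> \<sigma> > 0"
    using pair_pos_fw[OF \<alpha> \<sigma>(1)] B_commute[of \<sigma> \<alpha>] by (auto simp: zero_less_mult_iff)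
  then have "pair \<alpha> (cor \<sigma>) * B \<sigma> \<sigma> > 0"
    using pair_cor_form[OF simple_root[OF \<sigma>(1)]] by simp
  then have "pair \<alpha> (cor \<sigma>) > 0"
    using B_pos[OF root_nonzero[OF simple_root[OF \<sigma>(1)]]] by (auto simp: zero_less_mult_iff)
  then show ?thesis using \<sigma>(1) by blast
qed

lemma pos_corefl_word:
  "\<alpha> \<in> Pos \<Longrightarrow> \<exists>ws. set ws \<subseteq> S \<and> corefl \<alpha> = actY ws"
proof (induction "nat (pair \<alpha> h)" arbitrary: \<alpha> rule: less_induct)
  case less
  show ?case
  proof (cases "\<alpha> \<in> S")
    case True
    then show ?thesis by (intro exI[of _ "[\<alpha>]"]) (auto simp: fun_eq_iff)
  next
    case False
    obtain \<sigma> where \<sigma>: "\<sigma> \<in> S" "pair \<alpha> (cor \<sigma>) > 0"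
      using simple_height_reduction[OF less.prems] by blast
    define \<beta> where "\<beta> = refl \<sigma> \<alpha>"
    have \<beta>: "\<beta> \<in> Pos"
      unfolding \<beta>_def using \<sigma>(1) less.prems False by (intro simple_refl_pos) auto
    have "pair \<beta> h < pair \<alpha> h"
      using \<sigma> pos_pair[OF simple_pos[OF \<sigma>(1)]] by (simp add: \<beta>_def refl_def pair_diff_left)
    then have "nat (pair \<beta> h) < nat (pair \<alpha> h)"
      using pos_pair[OF \<beta>] by simp
    then obtain ws where ws: "set ws \<subseteq> S" "corefl \<beta> = actY ws"
      using less.hyps \<beta> by blast
    have "\<alpha> = refl \<sigma> \<beta>"
      using \<sigma> simple_root by (simp add: \<beta>_def refl_refl)
    then have "corefl \<alpha> = actY (\<sigma> # ws @ [\<sigma>])"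
      using corefl_refl[OF simple_root[OF \<sigma>(1)] pos_root[OF \<beta>]] ws(2)
      by (simp add: fun_eq_iff actY_append)
    then show ?thesis using ws(1) \<sigma>(1) by (intro exI[of _ "\<sigma> # ws @ [\<sigma>]"]) auto
  qed
qed

lemma weyl_word: "w \<in> W \<Longrightarrow> \<exists>ws. set ws \<subseteq> S \<and> w = actY ws"
proof (induction rule: weyl_induct)
  case id
  show ?case by (intro exI[of _ "[]"]) (auto simp: fun_eq_iff)
next
  case (refl \<alpha> w)
  obtain us where us: "set us \<subseteq> S" "w = actY us" using refl.IH by blast
  obtain vs where vs: "set vs \<subseteq> S" "corefl \<alpha> = actY vs"
    using pos_corefl_word pos_or_neg[OF refl.hyps(1)] corefl_uminus[OF refl.hyps(1)] by metis
  have "corefl \<alpha> \<circ> w = actY (vs @ us)"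
    using us vs by (simp add: fun_eq_iff actY_append)
  then show ?case using us vs by (intro exI[of _ "vs @ us"]) auto
qed

lemma weyl_simple_induct [consumes 1, case_names id simple]:
  assumes "w \<in> W" and "P id" and "\<And>\<sigma> w. \<sigma> \<in> S \<Longrightarrow> w \<in> W \<Longrightarrow> P w \<Longrightarrow> P (corefl \<sigma> \<circ> w)"
  shows "P w"
proof -
  have "actY ws \<in> W \<and> P (actY ws)" if "set ws \<subseteq> S" for ws
    using that
  proof (induction ws)
    case Nil
    have "actY [] = id" by (simp add: fun_eq_iff)
    then show ?case using assms(2) weyl_group.id by metis
  next
    case (Cons \<sigma> ws)
    have "actY (\<sigma> # ws) = corefl \<sigma> \<circ> actY ws" by (simp add: fun_eq_iff)
    moreover have "\<sigma> \<in> S" "actY ws \<in> W" "P (actY ws)" using Cons by auto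
    ultimately show ?case using assms(3) simple_root weyl_group.refl by metis
  qed
  then show ?thesis using weyl_word[OF \<open>w \<in> W\<close>] by blast
qed

text \<open>As \<open>transp w\<close> is the inverse of \<open>w\<close> on characters, these are
  the positive roots that \<open>w\<close> makes negative.\<close>

definition "inversions w = {\<beta> \<in> Pos. - \<beta> \<in> transp w ` Pos}"

lemma inversions_empty:
  assumes w: "w \<in> W" and empty: "inversions w = {}"
  shows "w = id"
proof -
  obtain ws where ws: "set ws \<subseteq> S" "w = actY ws" using weyl_word[OF w] by blast
  have tr: "transp w = actX (rev ws)"
    using w ws by (intro ext pair_eqI_left) (simp add: pair_transp_weyl pair_actX_rev)
  have "actX (rev ws) \<beta> \<in> Pos" if \<beta>: "\<beta> \<in> Pos" for \<beta>
  proof (rule ccontr)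
    assume neg: "actX (rev ws) \<beta> \<notin> Pos"
    then have "- transp w \<beta> \<in> Pos"
      using pos_or_neg[OF transp_root[OF w pos_root[OF \<beta>]]] by (simp add: tr)
    then have "- transp w \<beta> \<in> inversions w"
      using \<beta> by (auto simp: inversions_def)
    then show False using empty by blast
  qed
  then have "transp w = transp id"
    using ws(1) by (intro ext) (simp add: tr transp_id word_trivial)
  then show ?thesis using w weyl_group.id by (rule weyl_transp_eqI[rotated 2])
qed

definition "theta = (\<Sum>\<beta>\<in>Pos. \<beta>)"

text \<open>Pulled back by \<open>w\<close>, the positive roots change only by a sign at each
  inversion, so \<open>theta\<close> loses twice the sum of the inversions.\<close>

lemma pair_theta_weyl:
  assumes w: "w \<in> W"
  shows "pair theta (w y) = pair theta y - 2 * (\<Sum>\<beta>\<in>inversions w. pair \<beta> y)"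
proof -
  let ?f = "\<lambda>\<beta>. if \<beta> \<in> inversions w then - \<beta> else \<beta>"
  have inj: "inj_on ?f Pos"
    using uminus_not_pos by (intro inj_onI) (auto split: if_splits)
  have img: "?f ` Pos = transp w ` Pos"
  proof
    show "?f ` Pos \<subseteq> transp w ` Pos"
    proof
      fix x assume "x \<in> ?f ` Pos"
      then obtain \<beta> where \<beta>: "\<beta> \<in> Pos" "x = ?f \<beta>" by blast
      show "x \<in> transp w ` Pos"
      proof (cases "\<beta> \<in> inversions w")
        case True
        then show ?thesis using \<beta> by (simp add: inversions_def)
      next
        case False
        obtain \<gamma> where \<gamma>: "\<gamma> \<in> \<Phi>" "\<beta> = transp w \<gamma>"
          using transp_roots[OF w] pos_root[OF \<beta>(1)] by blast
        have "- \<gamma> \<notin> Pos"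
        proof
          assume "- \<gamma> \<in> Pos"
          then have "- \<beta> \<in> transp w ` Pos"
            using transp_uminus[OF w, of \<gamma>] \<gamma>(2) by (metis imageI)
          then show False using False \<beta>(1) by (simp add: inversions_def)
        qed
        then have "\<gamma> \<in> Pos" using pos_or_neg \<gamma>(1) by blast
        then show ?thesis using False \<beta>(2) \<gamma>(2) by simp
      qed
    qed
    show "transp w ` Pos \<subseteq> ?f ` Pos"
    proof
      fix x assume x: "x \<in> transp w ` Pos"
      then have "x \<in> \<Phi>" using transp_root[OF w] pos_root by blast
      then consider "x \<in> Pos" | "- x \<in> Pos" using pos_or_neg by blast
      then show "x \<in> ?f ` Pos"
      proof cases
        case 1
        have "- x \<notin> transp w ` Pos"
        proof
          assume "- x \<in> transp w ` Pos"
          then obtain \<gamma> \<delta> where "\<gamma> \<in> Pos" "x = transp w \<gamma>" "\<delta> \<in> Pos" "- x = transp w \<delta>"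
            using x by blast
          then have "transp w \<delta> = transp w (- \<gamma>)" by (simp add: transp_uminus[OF w])
          then have "\<delta> = - \<gamma>" using transp_inj[OF w] by (simp add: inj_eq)
          then show False using \<open>\<gamma> \<in> Pos\<close> \<open>\<delta> \<in> Pos\<close> uminus_not_pos by blast
        qed
        then have "x = ?f x" by (simp add: inversions_def)
        then show ?thesis using 1 by (rule image_eqI)
      next
        case 2
        then have "x = ?f (- x)" using x by (simp add: inversions_def)
        then show ?thesis using 2 by (rule image_eqI)
      qed
    qed
  qed
  have fin: "finite (inversions w)" "inversions w \<subseteq> Pos"
    using finite_Pos by (auto simp: inversions_def)
  have "pair theta (w y) = (\<Sum>\<gamma>\<in>Pos. pair (transp w \<gamma>) y)"
    by (simp add: theta_def pair_sum_left pair_transp_weyl[OF w])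
  also have "\<dots> = (\<Sum>\<delta>\<in>transp w ` Pos. pair \<delta> y)"
    by (subst sum.reindex) (auto intro: inj_on_subset[OF transp_inj[OF w]])
  also have "\<dots> = (\<Sum>\<beta>\<in>Pos. pair (?f \<beta>) y)"
    unfolding img[symmetric] by (subst sum.reindex[OF inj]) simp
  also have "\<dots> = (\<Sum>\<beta>\<in>Pos. pair \<beta> y - 2 * (if \<beta> \<in> inversions w then pair \<beta> y else 0))"
    by (intro sum.cong) auto
  also have "\<dots> = pair theta y - 2 * (\<Sum>\<beta>\<in>Pos. if \<beta> \<in> inversions w then pair \<beta> y else 0)"
    by (simp add: sum_subtractf sum_distrib_left theta_def pair_sum_left)
  also have "(\<Sum>\<beta>\<in>Pos. if \<beta> \<in> inversions w then pair \<beta> y else 0) = (\<Sum>\<beta>\<in>inversions w. pair \<beta> y)"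
    using fin(2) finite_Pos by (simp add: sum.inter_restrict[symmetric] Int_absorb1)
  finally show ?thesis .
qed

lemma weyl_regular:
  assumes "w \<in> W" "\<alpha> \<in> \<Phi>"
  shows "pair \<alpha> (w h) \<noteq> 0"
  using regular transp_root[OF assms] by (simp flip: pair_transp_weyl[OF assms(1)])

subsection \<open>Steinberg's weights\<close>

text \<open>The condition says that the inverse of \<open>v\<close> sends \<sigma> to a negative
  root: by adjointness \<open>pair \<sigma> (v h)\<close> is the pairing of that image with
  \<open>h\<close>.\<close>

definition "lam v = (\<Sum>\<sigma>\<in>{\<sigma>\<in>S. pair \<sigma> (v h) < 0}. fw \<sigma>)"

lemma pair_lam: "pair \<beta> (lam v) = (\<Sum>\<sigma>\<in>{\<sigma>\<in>S. pair \<sigma> (v h) < 0}. pair \<beta> (fw \<sigma>))"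
  by (simp add: lam_def pair_sum_right)

lemma pair_lam_nonneg: "\<beta> \<in> Pos \<Longrightarrow> pair \<beta> (lam v) \<ge> 0"
  unfolding pair_lam by (intro sum_nonneg) (auto simp: pair_pos_fw)

text \<open>\<beta> involves only simple roots that the inverse of \<open>v\<close> keeps positive.
  This settles the equality case in the comparison of leading terms.\<close>

lemma pair_lam_zero:
  assumes v: "v \<in> W" and \<beta>: "\<beta> \<in> Pos" and zero: "pair \<beta> (lam v) = 0"
  shows "pair \<beta> (v h) > 0"
proof -
  have z: "pair \<beta> (fw \<sigma>) = 0" if "\<sigma> \<in> S" "pair \<sigma> (v h) < 0" for \<sigma>
    using zero that finite_S pair_pos_fw[OF \<beta>]
    unfolding pair_lam by (subst (asm) sum_nonneg_eq_0_iff) auto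
  have "pair \<beta> (v h) = pair (\<Sum>\<sigma>\<in>S. pair \<beta> (fw \<sigma>) *s \<sigma>) (v h)"
    using simple_expansion[of \<beta>] by simp
  also have "\<dots> = (\<Sum>\<sigma>\<in>S. pair \<beta> (fw \<sigma>) * pair \<sigma> (v h))"
    by (simp add: pair_sum_left)
  also have "\<dots> \<ge> 0"
  proof (rule sum_nonneg)
    fix \<sigma> assume "\<sigma> \<in> S"
    then show "pair \<beta> (fw \<sigma>) * pair \<sigma> (v h) \<ge> 0"
      using z pair_pos_fw[OF \<beta>] by (cases "pair \<sigma> (v h) < 0") auto
  qed
  finally show ?thesis using weyl_regular[OF v pos_root[OF \<beta>]] by simp
qed

text \<open>The identity is the only permutation contributing to the \<open>theta\<close>-leading part of Steinberg's
  determinant: otherwise \<open>v h \<mapsto> \<pi> v h\<close> lowers the \<open>theta\<close>-height without increase anywhere, although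
  \<open>\<pi>\<close> merely permutes the orbit of \<open>h\<close>.\<close>

lemma steinberg_leading_term:
  assumes \<pi>: "\<pi> permutes W" and "\<pi> \<noteq> id"
  shows "pair theta (\<Sum>v\<in>W. \<pi> v (inv v (lam v))) < pair theta (\<Sum>v\<in>W. lam v)"
proof -
  define x where "x v = \<pi> v \<circ> inv v" for v
  have \<pi>W: "\<pi> v \<in> W" if "v \<in> W" for v
    using permutes_in_image[OF \<pi>] that by blast
  have xW: "x v \<in> W" if "v \<in> W" for v
    using that \<pi>W by (simp add: x_def weyl_comp weyl_inv)
  have inv_pos: "\<beta> \<in> Pos" if "\<beta> \<in> inversions w" for \<beta> w
    using that by (simp add: inversions_def)
  have fin: "finite (inversions w)" for w
    using finite_Pos by (simp add: inversions_def)
  \<comment> \<open>\<open>lam v\<close> is dominant, so no \<open>x v\<close> can raise its height;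
    it remains to see when all heights are kept.\<close>
  have le: "pair theta (x v (lam v)) \<le> pair theta (lam v)" if "v \<in> W" for v
    using pair_theta_weyl[OF xW[OF that], of "lam v"] inv_pos
    by (simp add: sum_nonneg pair_lam_nonneg)
  have sums: "pair theta (\<Sum>v\<in>W. \<pi> v (inv v (lam v))) = (\<Sum>v\<in>W. pair theta (x v (lam v)))"
    "pair theta (\<Sum>v\<in>W. lam v) = (\<Sum>v\<in>W. pair theta (lam v))"
    by (simp_all add: pair_sum_right x_def)
  have "\<exists>v\<in>W. pair theta (x v (lam v)) < pair theta (lam v)"
  proof (rule ccontr)
    assume "\<not> ?thesis"
    then have "pair theta (x v (lam v)) = pair theta (lam v)" if "v \<in> W" for v
      using le[OF that] that by force
    then have "(\<Sum>\<beta>\<in>inversions (x v). pair \<beta> (lam v)) = 0" if "v \<in> W" for v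
      using pair_theta_weyl[OF xW[OF that], of "lam v"] that by simp
    then have "pair \<beta> (lam v) = 0" if "v \<in> W" "\<beta> \<in> inversions (x v)" for v \<beta>
      using that fin inv_pos pair_lam_nonneg sum_nonneg_eq_0_iff[of "inversions (x v)" "\<lambda>\<beta>. pair \<beta> (lam v)"]
      by blast
    then have pos: "pair \<beta> (v h) > 0" if "v \<in> W" "\<beta> \<in> inversions (x v)" for v \<beta>
      using that pair_lam_zero inv_pos by blast
    have xv: "x v (v h) = \<pi> v h" if "v \<in> W" for v
      using weyl_bij[OF that] by (simp add: x_def bij_is_inj)
    have nonneg: "(\<Sum>\<beta>\<in>inversions (x v). pair \<beta> (v h)) \<ge> 0" if "v \<in> W" for v
      using pos[OF that] by (intro sum_nonneg) (simp add: less_imp_le)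
    have eq: "pair theta (\<pi> v h) = pair theta (v h) - 2 * (\<Sum>\<beta>\<in>inversions (x v). pair \<beta> (v h))" if "v \<in> W" for v
      using pair_theta_weyl[OF xW[OF that], of "v h"] xv[OF that] by simp
    have "(\<Sum>v\<in>W. pair theta (v h)) = (\<Sum>v\<in>W. pair theta (\<pi> v h))"
      using sum.permute[OF \<pi>, of "\<lambda>v. pair theta (v h)"] by (simp add: comp_def)
    also have "\<dots> = (\<Sum>v\<in>W. pair theta (v h)) - 2 * (\<Sum>v\<in>W. \<Sum>\<beta>\<in>inversions (x v). pair \<beta> (v h))"
      by (simp add: eq sum_subtractf sum_distrib_left)
    finally have "(\<Sum>v\<in>W. \<Sum>\<beta>\<in>inversions (x v). pair \<beta> (v h)) = 0" by simp
    then have z: "(\<Sum>\<beta>\<in>inversions (x v). pair \<beta> (v h)) = 0" if "v \<in> W" for v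
      using that nonneg finite_weyl by (subst (asm) sum_nonneg_eq_0_iff) auto
    have "\<pi> v = v" if "v \<in> W" for v
    proof -
      have "inversions (x v) = {}"
        using z[OF that] pos[OF that] fin[of "x v"] by (metis (no_types, lifting) all_not_in_conv less_irrefl sum_pos)
      then have "x v = id" by (rule inversions_empty[OF xW[OF that]])
      then have "\<pi> v \<circ> (inv v \<circ> v) = v" by (simp add: x_def comp_assoc[symmetric])
      then show ?thesis by (simp add: weyl_inv_comp that)
    qed
    then have "\<pi> = id"
      using permutes_not_in[OF \<pi>] by (auto simp: fun_eq_iff)
    then show False using \<open>\<pi> \<noteq> id\<close> by simp
  qed
  then show ?thesis
    unfolding sums using le finite_weyl by (intro sum_strict_mono_ex1) auto
qed

lemma card_half:
  assumes \<alpha>: "\<alpha> \<in> \<Phi>"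
  shows "card {w\<in>W. pair \<alpha> (w h) > 0} = card W div 2" "card {w\<in>W. pair \<alpha> (w h) < 0} = card W div 2"
proof -
  let ?P = "{w\<in>W. pair \<alpha> (w h) > 0}" and ?N = "{w\<in>W. pair \<alpha> (w h) < 0}"
  have neg: "pair \<alpha> (corefl \<alpha> y) = - pair \<alpha> y" for y
    by (simp add: coreflection_def pair_diff_right pair_cor \<alpha>)
  have "bij_betw (\<lambda>w. corefl \<alpha> \<circ> w) ?P ?N"
  proof (rule bij_betw_byWitness[where f' = "\<lambda>w. corefl \<alpha> \<circ> w"])
    show "(\<lambda>w. corefl \<alpha> \<circ> w) ` ?P \<subseteq> ?N" "(\<lambda>w. corefl \<alpha> \<circ> w) ` ?N \<subseteq> ?P"
      using \<alpha> by (auto simp: neg weyl_group.refl)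
  qed (auto simp: fun_eq_iff corefl_corefl \<alpha>)
  then have "card ?P = card ?N" by (rule bij_betw_same_card)
  moreover have "W = ?P \<union> ?N"
    using weyl_regular[OF _ \<alpha>] by fastforce
  then have "card W = card ?P + card ?N"
    using finite_weyl by (subst card_Un_disjoint[symmetric]) auto
  ultimately show "card ?P = card W div 2" "card ?N = card W div 2" by auto
qed

text \<open>For each simple root, exactly half of the group has an inverse making it negative, so
  each fundamental coweight occurs |W|/2 times. This matches the exponent of the Weyl
  denominator.\<close>

lemma sum_lam: "(\<Sum>v\<in>W. lam v) = of_nat (card W div 2) *s rho"
proof -
  have const: "(\<Sum>v\<in>A. x) = of_nat (card A) *s x" for A :: "'a set" and x :: "'n lat"
    by (induction A rule: infinite_finite_induct) (simp_all add: vector_sadd_rdistrib del: sum_constant)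
  have "(\<Sum>v\<in>W. lam v) = (\<Sum>v\<in>W. \<Sum>\<sigma>\<in>S. if pair \<sigma> (v h) < 0 then fw \<sigma> else 0)"
    unfolding lam_def using finite_S by (simp add: sum.inter_filter)
  also have "\<dots> = (\<Sum>\<sigma>\<in>S. \<Sum>v\<in>W. if pair \<sigma> (v h) < 0 then fw \<sigma> else 0)"
    by (rule sum.swap)
  also have "\<dots> = (\<Sum>\<sigma>\<in>S. of_nat (card W div 2) *s fw \<sigma>)"
  proof (intro sum.cong HOL.refl)
    fix \<sigma> assume \<sigma>: "\<sigma> \<in> S"
    have "(\<Sum>v\<in>W. if pair \<sigma> (v h) < 0 then fw \<sigma> else 0) = (\<Sum>v\<in>{v\<in>W. pair \<sigma> (v h) < 0}. fw \<sigma>)"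
      by (rule sum.inter_filter[OF finite_weyl, symmetric])
    also have "\<dots> = of_nat (card {v\<in>W. pair \<sigma> (v h) < 0}) *s fw \<sigma>"
      by (rule const)
    also have "\<dots> = of_nat (card W div 2) *s fw \<sigma>"
      using card_half(2)[OF simple_root[OF \<sigma>]] by simp
    finally show "(\<Sum>v\<in>W. if pair \<sigma> (v h) < 0 then fw \<sigma> else 0) = of_nat (card W div 2) *s fw \<sigma>" .
  qed
  also have "\<dots> = of_nat (card W div 2) *s rho"
    by (simp add: rho_def vec_eq_iff sum_distrib_left)
  finally show ?thesis .
qed

text \<open>The orbit sum is fixed by every coreflection, hence killed by every root, and the roots
  separate cocharacters.\<close>

lemma sum_orbit: "(\<Sum>w\<in>W. w y) = 0"
proof (rule roots_separate)
  fix \<alpha> assume \<alpha>: "\<alpha> \<in> \<Phi>"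
  let ?z = "\<Sum>w\<in>W. w y"
  have "corefl \<alpha> ?z = (\<Sum>w\<in>W. (corefl \<alpha> \<circ> w) y)"
    by (simp add: Modules.additive.sum[OF additive_corefl])
  also have "\<dots> = ?z"
    by (rule sum.reindex_bij_witness[where i = "\<lambda>w. corefl \<alpha> \<circ> w" and j = "\<lambda>w. corefl \<alpha> \<circ> w"])
       (auto simp: fun_eq_iff corefl_corefl \<alpha> weyl_group.refl)
  finally have "pair \<alpha> ?z *s cor \<alpha> = 0"
    by (simp add: coreflection_def)
  then show "pair \<alpha> ?z = 0"
    using cor_nonzero[OF \<alpha>] by (auto simp: vec_eq_iff)
qed


subsection \<open>Leading terms with respect to \<open>theta\<close>\<close>

text \<open>A strict bound on the \<open>theta\<close>-height of all exponents;
  \<open>low 0 (f - 1)\<close> thus expresses that \<open>f\<close> has leading term 1.\<close>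

definition low :: "int \<Rightarrow> ('n, 'k::field) RT \<Rightarrow> bool" where
  "low t f \<longleftrightarrow> (\<forall>l\<in>Poly_Mapping.keys f. pair theta l < t)"

lemma low_0 [simp]: "low t 0"
  by (simp add: low_def)

lemma low_add: "low t f \<Longrightarrow> low t g \<Longrightarrow> low t (f + g)"
  using keys_add[of f g] by (auto simp: low_def)

lemma low_uminus: "low t f \<Longrightarrow> low t (- f)"
  by (auto simp: low_def in_keys_iff)

lemma low_diff: "low t f \<Longrightarrow> low t g \<Longrightarrow> low t (f - g)"
  using low_add[of t f "- g"] by (simp add: low_uminus)

lemma low_sum: "(\<And>i. i \<in> A \<Longrightarrow> low t (f i)) \<Longrightarrow> low t (sum f A)"
  by (induction A rule: infinite_finite_induct) (auto intro: low_add)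

lemma low_mult:
  assumes "\<And>l. l \<in> Poly_Mapping.keys f \<Longrightarrow> pair theta l \<le> s" "low t g"
  shows "low (s + t) (f * g)"
  unfolding low_def
proof
  fix l assume "l \<in> Poly_Mapping.keys (f * g)"
  then obtain a b where "l = a + b" "a \<in> Poly_Mapping.keys f" "b \<in> Poly_Mapping.keys g"
    using keys_mult[of f g] by blast
  then show "pair theta l < s + t"
    using assms by (auto simp: low_def pair_add_right intro: add_le_less_mono)
qed

lemma low_eT: "pair theta l < t \<Longrightarrow> low t (eT l)"
  by (auto simp: low_def eT_def split: if_splits)

lemma low_eT_mult: "low t f \<Longrightarrow> low (pair theta l + t) (eT l * f)"
  by (rule low_mult) (auto simp: eT_def split: if_splits)

lemma low_of_int_mult: "low t f \<Longrightarrow> low t (of_int c * f)"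
proof -
  assume "low t f"
  then have "low (0 + t) (of_int c * f)"
    by (rule low_mult[rotated]) (auto simp: in_keys_iff lookup_of_int when_def split: if_splits)
  then show ?thesis by simp
qed

lemma low_mult_0: "low 0 f \<Longrightarrow> low 0 g \<Longrightarrow> low 0 (f * g)"
  using low_mult[of f 0 0 g] by (auto simp: low_def less_imp_le)

lemma unipotent_mult:
  assumes "low 0 (f - 1)" "low 0 (g - 1)"
  shows "low 0 (f * g - 1)"
proof -
  have "f * g - 1 = (f - 1) * (g - 1) + (f - 1) + (g - 1)"
    by (simp add: algebra_simps)
  then show ?thesis using assms by (simp only: low_add low_mult_0)
qed

lemma unipotent_prod: "(\<And>i. i \<in> A \<Longrightarrow> low 0 (f i - 1)) \<Longrightarrow> low 0 (prod f A - 1)"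
  by (induction A rule: infinite_finite_induct) (auto intro: unipotent_mult)

lemma unipotent_power: "low 0 (f - 1) \<Longrightarrow> low 0 (f ^ n - 1)"
  by (induction n) (auto intro: unipotent_mult)

text \<open>The exponents of greatest height in \<open>Q\<close> cannot cancel in
  \<open>Q * P\<close>, because multiplying by \<open>P - 1\<close> only lowers heights.\<close>

lemma unipotent_cancel:
  assumes P: "low 0 (P - 1)" and QP: "low 0 (Q * P)"
  shows "low 0 Q"
proof (rule ccontr)
  let ?L = "{l \<in> Poly_Mapping.keys Q. pair theta l \<ge> 0}"
  assume "\<not> low 0 Q"
  then have "?L \<noteq> {}" "finite ?L" by (auto simp: low_def not_less)
  define m where "m = Max (pair theta ` Poly_Mapping.keys Q)"
  have "Poly_Mapping.keys Q \<noteq> {}" using \<open>?L \<noteq> {}\<close> by auto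
  then have "m \<in> pair theta ` Poly_Mapping.keys Q" unfolding m_def by (intro Max_in) auto
  then obtain \<mu> where \<mu>: "\<mu> \<in> Poly_Mapping.keys Q" "pair theta \<mu> = m" by auto
  have max: "pair theta l \<le> m" if "l \<in> Poly_Mapping.keys Q" for l
    unfolding m_def using that by (intro Max_ge) auto
  have "m \<ge> 0" using \<open>?L \<noteq> {}\<close> max by force
  have "low (m + 0) (Q * (P - 1))" by (rule low_mult[OF max P])
  then have "Poly_Mapping.lookup (Q * (P - 1)) \<mu> = 0"
    using \<mu>(2) by (auto simp: low_def in_keys_iff)
  moreover have "Poly_Mapping.lookup (Q * P) \<mu> = 0"
  proof -
    have "\<mu> \<notin> Poly_Mapping.keys (Q * P)" using QP \<mu>(2) \<open>m \<ge> 0\<close> by (auto simp: low_def)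
    then show ?thesis by (simp add: in_keys_iff)
  qed
  moreover have "Q = Q * P - Q * (P - 1)" by (simp add: algebra_simps)
  ultimately have "Poly_Mapping.lookup Q \<mu> = 0" by (metis diff_zero lookup_minus)
  then show False using \<mu>(1) by (simp add: in_keys_iff)
qed

subsection \<open>The Weyl denominator\<close>

definition Delta0 :: "('n, 'k::field) RT" where
  "Delta0 = eT rho * (\<Prod>\<beta>\<in>Pos. 1 - eT (- cor \<beta>))"

lemma Delta0_eq:
  "Delta0 = (-1) ^ card Pos * eT (- rho) * (\<Prod>\<beta>\<in>Pos. 1 - eT (cor \<beta>) :: ('n, 'k::field) RT)"
proof -
  have "(\<Prod>\<beta>\<in>Pos. 1 - eT (- cor \<beta>)) = (\<Prod>\<beta>\<in>Pos. (-1) * eT (- cor \<beta>) * (1 - eT (cor \<beta>)) :: ('n, 'k) RT)"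
    by (intro prod.cong HOL.refl) (simp add: algebra_simps)
  also have "\<dots> = (-1) ^ card Pos * eT (- (\<Sum>\<beta>\<in>Pos. cor \<beta>)) * (\<Prod>\<beta>\<in>Pos. 1 - eT (cor \<beta>))"
    by (simp only: prod.distrib prod_constant eT_sum sum_negf[symmetric])
  also have "eT (- (\<Sum>\<beta>\<in>Pos. cor \<beta>)) = eT (- rho) * (eT (- rho) :: ('n, 'k) RT)"
    unfolding sum_coroots by (simp add: vec_eq_iff flip: eT_add) (rule arg_cong[where f = eT], simp add: vec_eq_iff)
  finally have "Delta0 = (eT rho * eT (- rho)) * ((-1) ^ card Pos * eT (- rho) * (\<Prod>\<beta>\<in>Pos. 1 - eT (cor \<beta>) :: ('n, 'k) RT))"
    unfolding Delta0_def by (simp only: mult_ac)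
  then show ?thesis by simp
qed

text \<open>The division is exact in every coordinate, so \<open>div\<close> is true
  halving.\<close>

lemma half_sum_coroots: "(\<chi> i. (\<Sum>\<alpha>\<in>Pos. cor \<alpha>) $ i div 2) = rho"
  by (simp only: sum_coroots) (simp add: vec_eq_iff)

text \<open>The factors other than that of \<sigma> are permuted, while e^\<rho> picks up the
  exponential of minus the coroot of \<sigma>; together with the factor of \<sigma> this leaves a
  sign.\<close>

lemma Delta0_corefl:
  assumes \<sigma>: "\<sigma> \<in> S"
  shows "wact (corefl \<sigma>) Delta0 = - (Delta0 :: ('n, 'k::field) RT)"
proof -
  note \<sigma>' = simple_pos[OF \<sigma>] simple_root[OF \<sigma>]
  let ?q = "\<lambda>\<beta>. 1 - eT (- cor \<beta>) :: ('n, 'k) RT"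
  let ?P = "\<Prod>\<beta>\<in>Pos - {\<sigma>}. ?q \<beta>"
  have split: "Delta0 = eT rho * (?q \<sigma> * ?P)"
    unfolding Delta0_def using finite_Pos \<sigma>' by (simp add: prod.remove)
  have "wact (corefl \<sigma>) ?P = (\<Prod>\<beta>\<in>Pos - {\<sigma>}. ?q (refl \<sigma> \<beta>))"
    unfolding wact_prod[OF additive_corefl]
    using \<sigma>' by (intro prod.cong HOL.refl)
      (simp add: wact_diff wact_1[OF additive_corefl] Modules.additive.minus[OF additive_corefl] cor_refl pos_root)
  also have "\<dots> = ?P"
    by (rule prod.reindex_bij_betw[OF simple_refl_bij[OF \<sigma>]])
  finally have P: "wact (corefl \<sigma>) ?P = ?P" .
  have q: "wact (corefl \<sigma>) (?q \<sigma>) = 1 - eT (cor \<sigma>)"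
    using \<sigma>' by (simp add: wact_diff wact_1[OF additive_corefl] Modules.additive.minus[OF additive_corefl] corefl_self)
  have "corefl \<sigma> rho = - cor \<sigma> + rho"
    using \<sigma> by (simp add: coreflection_def pair_simple_rho)
  then have rho: "wact (corefl \<sigma>) (eT rho) = eT (- cor \<sigma>) * (eT rho :: ('n, 'k) RT)"
    by (simp only: wact_eT eT_add)
  have "wact (corefl \<sigma>) Delta0 = eT rho * ((eT (- cor \<sigma>) * (1 - eT (cor \<sigma>))) * ?P)"
    unfolding split wact_mult[OF additive_corefl] P q rho by (simp only: mult_ac)
  also have "eT (- cor \<sigma>) * (1 - eT (cor \<sigma>)) = - ?q \<sigma>"
    by (simp add: algebra_simps)
  finally show ?thesis unfolding split by (simp only: mult_minus_left mult_minus_right)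
qed

lemma Delta0_weyl:
  "w \<in> W \<Longrightarrow> wact w (Delta0 :: ('n, 'k::field) RT) = Delta0 \<or> wact w (Delta0 :: ('n, 'k) RT) = - Delta0"
proof (induction rule: weyl_simple_induct)
  case id
  show ?case using wact_id by blast
next
  case (simple \<sigma> w)
  have "wact (corefl \<sigma> \<circ> w) Delta0 = wact (corefl \<sigma>) (wact w (Delta0 :: ('n, 'k) RT))"
    by (rule wact_comp[symmetric])
  then show ?case
    using simple.IH Delta0_corefl[OF simple.hyps(1), where 'k = 'k] by (metis minus_minus wact_uminus)
qed

definition Delta :: "('n, 'k::field) RT" where
  "Delta = Delta0 ^ (card W div 2)"

lemma power_sign:
  fixes x :: "'r::comm_ring_1"
  assumes "y = x \<or> y = - x"
  shows "y ^ n = x ^ n \<or> y ^ n = - (x ^ n)"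
  using assms by (cases "even n") auto

lemma Delta_weyl:
  "w \<in> W \<Longrightarrow> wact w (Delta :: ('n, 'k::field) RT) = Delta \<or> wact w (Delta :: ('n, 'k) RT) = - Delta"
  unfolding Delta_def wact_power[OF weyl_additive] by (intro power_sign Delta0_weyl)

lemma cancel_prod:
  fixes p :: "'a \<Rightarrow> 'r::comm_ring_1"
  assumes "\<And>a f. a \<in> A \<Longrightarrow> p a * f = 0 \<Longrightarrow> f = 0" "prod p A * f = 0"
  shows "f = 0"
  using assms
  by (induction A arbitrary: f rule: infinite_finite_induct) (auto simp: mult.assoc)

lemma Delta0_cancel: "Delta0 * f = 0 \<Longrightarrow> f = 0"
proof -
  assume "Delta0 * f = 0"
  then have "eT (- rho) * (eT rho * ((\<Prod>\<beta>\<in>Pos. 1 - eT (- cor \<beta>)) * f)) = 0"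
    by (simp add: Delta0_def mult.assoc)
  then have "(\<Prod>\<beta>\<in>Pos. 1 - eT (- cor \<beta>)) * f = 0"
    by (simp add: mult.assoc[symmetric])
  then show "f = 0"
  proof (rule cancel_prod[rotated])
    fix \<beta> and g assume "\<beta> \<in> Pos" "(1 - eT (- cor \<beta>)) * g = 0"
    then show "g = 0" using one_minus_eT_cancel[of "- cor \<beta>" g] by (simp add: cor_nonzero pos_root)
  qed
qed

lemma Delta_cancel: "Delta * f = 0 \<Longrightarrow> f = 0"
proof -
  have "Delta0 ^ n * f = 0 \<Longrightarrow> f = 0" for n
    by (induction n) (auto simp: mult.assoc dest: Delta0_cancel)
  then show "Delta * f = 0 \<Longrightarrow> f = 0" unfolding Delta_def .
qed

text \<open>The reflection in \<beta> inverts \<beta>, so it lowers the height of \<open>h\<close>;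
  the drop is \<open>pair \<beta> h\<close> times the height of the coroot.\<close>

lemma pair_theta_cor:
  assumes \<beta>: "\<beta> \<in> Pos"
  shows "pair theta (cor \<beta>) > 0"
proof -
  note \<Phi> = pos_root[OF \<beta>]
  have fin: "finite (inversions (corefl \<beta>))" and sub: "inversions (corefl \<beta>) \<subseteq> Pos"
    using finite_Pos by (auto simp: inversions_def)
  have "transp (corefl \<beta>) \<beta> = - \<beta>"
    by (rule pair_eqI_left)
       (simp add: pair_transp_weyl corefl_weyl \<Phi> coreflection_def pair_diff_right pair_cor)
  then have "- \<beta> \<in> transp (corefl \<beta>) ` Pos" using \<beta> by (metis imageI)
  then have "\<beta> \<in> inversions (corefl \<beta>)"
    using \<beta> by (simp add: inversions_def)
  then have pos: "(\<Sum>\<gamma>\<in>inversions (corefl \<beta>). pair \<gamma> h) > 0"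
    using fin sub pos_pair by (intro sum_pos) auto
  have "pair theta (corefl \<beta> h) = pair theta h - pair \<beta> h * pair theta (cor \<beta>)"
    by (simp add: coreflection_def pair_diff_right)
  then have "pair \<beta> h * pair theta (cor \<beta>) > 0"
    using pair_theta_weyl[OF corefl_weyl[OF \<Phi>], of h] pos by simp
  then show ?thesis using pos_pair[OF \<beta>] by (simp add: zero_less_mult_iff)
qed

definition DP :: "('n, 'k::field) RT" where
  "DP = (\<Prod>\<beta>\<in>Pos. 1 - eT (- cor \<beta>)) ^ (card W div 2)"

lemma Delta_leading: "Delta = eT (of_nat (card W div 2) *s rho) * (DP :: ('n, 'k::field) RT)"
proof -
  have "eT rho ^ n = (eT (of_nat n *s rho) :: ('n, 'k) RT)" for n
    by (induction n) (simp_all add: vector_sadd_rdistrib eT_add)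
  then show ?thesis by (simp only: Delta_def Delta0_def DP_def power_mult_distrib)
qed

lemma DP_unipotent: "low 0 (DP - 1)"
  unfolding DP_def
  by (intro unipotent_power unipotent_prod) (auto intro!: low_uminus low_eT simp: pair_theta_cor)

text \<open>Each factor of \<open>Delta\<close> is a unit or some 1 - e^l with l nonzero, and orders
  are additive. Finite order is what makes division by \<open>Delta\<close> shift levels by a
  bounded amount.\<close>

lemma not_aug_pow_Delta: "\<exists>c. \<not> aug_pow c (Delta :: ('n, 'k::field) RT)"
proof -
  have one: "\<exists>c. \<not> aug_pow c (1 :: ('n, 'k) RT)"
  proof -
    have "axis undefined 1 \<noteq> (0 :: 'n lat)" by simp
    then obtain c where "\<not> aug_pow c (1 - eT (axis undefined 1) :: ('n, 'k) RT)"
      using not_aug_pow_one_minus_eT by blast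
    then show ?thesis
      using aug_pow_mult_left[of c 1 "1 - eT (axis undefined 1) :: ('n, 'k) RT"] by auto
  qed
  have "\<exists>c. \<not> aug_pow c (eT rho :: ('n, 'k) RT)"
    using one aug_pow_mult_left[of _ "eT rho :: ('n, 'k) RT" "eT (- rho)"] by auto
  moreover have "\<exists>c. \<not> aug_pow c (\<Prod>\<beta>\<in>A. 1 - eT (- cor \<beta>) :: ('n, 'k) RT)" if "A \<subseteq> Pos" "finite A" for A
    using that(2,1)
  proof induction
    case (insert \<beta> A)
    have "- cor \<beta> \<noteq> 0" using insert.prems cor_nonzero pos_root by auto
    then show ?case
      using insert by (simp add: not_aug_pow_mult not_aug_pow_one_minus_eT)
  qed (simp add: one)
  ultimately have "\<exists>c. \<not> aug_pow c (Delta0 :: ('n, 'k) RT)"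
    unfolding Delta0_def using finite_Pos by (intro not_aug_pow_mult) auto
  then have "\<exists>c. \<not> aug_pow c ((Delta0 :: ('n, 'k) RT) ^ n)" for n
    by (induction n) (simp_all add: one not_aug_pow_mult)
  then show ?thesis unfolding Delta_def .
qed

subsection \<open>Steinberg's determinant\<close>

definition wdet :: "(('n lat \<Rightarrow> 'n lat) \<Rightarrow> ('n, 'k::field) RT) \<Rightarrow> ('n, 'k) RT" where
  "wdet g = detI W (\<lambda>v w. wact w (g v))"

lemma Delta_dvd_wdet: "Delta dvd wdet (g :: _ \<Rightarrow> ('n, 'k::field) RT)"
proof -
  let ?N = "card W div 2"
  have "(\<Prod>\<alpha>\<in>Pos. 1 - eT (cor \<alpha>)) ^ ?N dvd wdet g"
  proof (rule prod_power_dvd)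
    show "finite Pos" by (rule finite_Pos)
    show "f = 0" if "\<alpha> \<in> Pos" "(1 - eT (cor \<alpha>)) * f = 0" for \<alpha> and f :: "('n, 'k) RT"
      using that one_minus_eT_cancel cor_nonzero pos_root by blast
    show "1 - eT (cor \<beta>) dvd f"
      if "\<alpha> \<in> Pos" "\<beta> \<in> Pos" "\<alpha> \<noteq> \<beta>" "1 - eT (cor \<beta>) dvd (1 - eT (cor \<alpha>)) * f"
      for \<alpha> \<beta> and f :: "('n, 'k) RT"
      using coroots_independent[OF that(1-3)] that(4) by (rule one_minus_eT_coprime)
    show "(1 - eT (cor \<alpha>)) ^ ?N dvd wdet g" if \<alpha>: "\<alpha> \<in> Pos" for \<alpha>
    proof -
      note \<Phi> = pos_root[OF \<alpha>]
      let ?H = "{w\<in>W. pair \<alpha> (w h) > 0}"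
      have neg: "pair \<alpha> (corefl \<alpha> y) = - pair \<alpha> y" for y
        by (simp add: coreflection_def pair_diff_right pair_cor \<Phi>)
      have "(1 - eT (cor \<alpha>)) ^ card ?H dvd wdet g"
        unfolding wdet_def
      proof (rule detI_dvd_power[where s = "\<lambda>w. corefl \<alpha> \<circ> w"])
        show "finite W" by (rule finite_weyl)
        show "corefl \<alpha> \<circ> w \<in> W - ?H" if "w \<in> ?H" for w
        proof -
          have "corefl \<alpha> \<circ> w \<in> W" using that weyl_comp[OF corefl_weyl[OF \<Phi>]] by blast
          moreover have "\<not> pair \<alpha> ((corefl \<alpha> \<circ> w) h) > 0" using that by (simp add: neg)
          ultimately show ?thesis by blast
        qed
        show "1 - eT (cor \<alpha>) dvd wact w (g v) - wact (corefl \<alpha> \<circ> w) (g v)" for v w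
        proof -
          have "\<exists>j. corefl \<alpha> l = l + j *s cor \<alpha>" for l
            by (rule exI[of _ "- pair \<alpha> l"]) (simp add: coreflection_def vec_eq_iff)
          then have "1 - eT (cor \<alpha>) dvd wact w (g v) - wact (corefl \<alpha>) (wact w (g v))"
            by (rule dvd_diff_wact)
          then show ?thesis by (simp only: wact_comp)
        qed
      qed auto
      then show ?thesis by (simp only: card_half(1)[OF \<Phi>])
    qed
  qed
  then obtain k where k: "wdet g = (\<Prod>\<alpha>\<in>Pos. 1 - eT (cor \<alpha>)) ^ ?N * k" by (auto simp: dvd_def)
  \<comment> \<open>\<open>Delta\<close> and the \<open>?N\<close>-th power of the product of the
    \<open>1 - eT (cor \<alpha>)\<close> differ by the unit \<open>?u ^ ?N\<close>, with inverse
    \<open>?u' ^ ?N\<close>.\<close>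
  let ?u = "(-1) ^ card Pos * eT (- rho) :: ('n, 'k) RT" and ?u' = "(-1) ^ card Pos * eT rho :: ('n, 'k) RT"
  have "?u * ?u' = ((-1) ^ card Pos * (-1) ^ card Pos) * (eT (- rho) * eT rho)"
    by (simp only: mult_ac)
  then have uu: "?u * ?u' = 1"
    by (simp flip: power_mult_distrib)
  have "Delta * (?u' ^ ?N * k) = (?u * ?u') ^ ?N * ((\<Prod>\<alpha>\<in>Pos. 1 - eT (cor \<alpha>)) ^ ?N * k)"
    unfolding Delta_def Delta0_eq power_mult_distrib by (simp only: mult_ac)
  also have "\<dots> = wdet g" unfolding uu k by simp
  finally show ?thesis by (metis dvd_triv_left)
qed

text \<open>Left translation by \<open>u\<close> permutes the columns. The sign depends on
  \<open>u\<close> alone and is the same for all \<open>g\<close>, so that quotients of two such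
  determinants are invariant.\<close>

lemma wdet_weyl:
  assumes u: "u \<in> W"
  shows "\<exists>c. (c = 1 \<or> c = -1) \<and>
    (\<forall>g :: ('n lat \<Rightarrow> 'n lat) \<Rightarrow> ('n, 'k::field) RT. wact u (wdet g) = of_int c * wdet g)"
proof -
  define \<pi> where "\<pi> w = (if w \<in> W then u \<circ> w else w)" for w
  have "bij_betw \<pi> W W"
  proof (rule bij_betw_byWitness[where f' = "\<lambda>w. inv u \<circ> w"])
    show "\<forall>w\<in>W. inv u \<circ> \<pi> w = w" "\<forall>w\<in>W. \<pi> (inv u \<circ> w) = w"
      using u by (auto simp: \<pi>_def weyl_comp[OF weyl_inv[OF u]] comp_assoc[symmetric] weyl_inv_comp simp del: o_apply)
    show "\<pi> ` W \<subseteq> W" using u weyl_comp by (auto simp: \<pi>_def simp del: o_apply)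
    show "(\<lambda>w. inv u \<circ> w) ` W \<subseteq> W" using weyl_comp[OF weyl_inv[OF u]] by blast
  qed
  then have \<pi>: "\<pi> permutes W"
    by (rule bij_imp_permutes) (simp add: \<pi>_def)
  note add = weyl_additive[OF u]
  have "wact u (wdet g) = of_int (sign \<pi>) * wdet g" for g :: "('n lat \<Rightarrow> 'n lat) \<Rightarrow> ('n, 'k) RT"
  proof -
    have "wact u (wdet g) = detI W (\<lambda>v w. wact u (wact w (g v)))"
      by (simp only: wdet_def detI_def wact_sum wact_mult[OF add] wact_prod[OF add] wact_of_int[OF add])
    also have "\<dots> = detI W (\<lambda>v w. wact (\<pi> w) (g v))"
      by (rule detI_cong) (simp only: \<pi>_def wact_comp if_True)
    also have "\<dots> = of_int (sign \<pi>) * wdet g"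
      unfolding wdet_def by (rule detI_permute_columns[OF finite_weyl \<pi>])
    finally show ?thesis .
  qed
  then show ?thesis by (intro exI[of _ "sign \<pi>"]) (auto simp: sign_def)
qed

definition est :: "('n lat \<Rightarrow> 'n lat) \<Rightarrow> ('n, 'k::field) RT" where
  "est v = eT (inv v (lam v))"

lemma wdet_est_leading:
  "low (pair theta (of_nat (card W div 2) *s rho))
     (wdet est - (eT (of_nat (card W div 2) *s rho) :: ('n, 'k::field) RT))"
proof -
  let ?S = "{\<pi>. \<pi> permutes W}"
  let ?t = "\<lambda>\<pi>. of_int (sign \<pi>) * eT (\<Sum>v\<in>W. \<pi> v (inv v (lam v))) :: ('n, 'k) RT"
  have fin: "finite ?S" using finite_weyl by (rule finite_permutations)
  have id: "id \<in> ?S" by (simp add: permutes_id)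
  have "wdet est = sum ?t ?S"
    by (simp add: wdet_def detI_def est_def eT_sum)
  also have "\<dots> = ?t id + sum ?t (?S - {id})"
    using fin id by (rule sum.remove)
  also have "?t id = eT (\<Sum>v\<in>W. lam v)"
  proof -
    have "(\<Sum>v\<in>W. id v (inv v (lam v))) = (\<Sum>v\<in>W. lam v)"
      using weyl_bij by (intro sum.cong HOL.refl) (simp add: bij_is_surj surj_f_inv_f)
    then show ?thesis by (simp only: sign_id of_int_1 mult_1_left)
  qed
  finally have "wdet est - eT (\<Sum>v\<in>W. lam v) = sum ?t (?S - {id})"
    by (simp only: add_diff_cancel_left')
  moreover have "low (pair theta (\<Sum>v\<in>W. lam v)) (sum ?t (?S - {id}))"
    using steinberg_leading_term by (intro low_sum low_of_int_mult low_eT) auto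
  ultimately show ?thesis by (simp only: sum_lam)
qed

lemma wdet_est: "wdet est = (Delta :: ('n, 'k::field) RT)"
proof -
  let ?n = "of_nat (card W div 2) *s rho"
  obtain Q where Q: "wdet est = Delta * (Q :: ('n, 'k) RT)"
    using Delta_dvd_wdet by (auto simp: dvd_def)
  have "Delta - eT ?n = eT ?n * (DP - 1 :: ('n, 'k) RT)"
    by (simp add: Delta_leading algebra_simps)
  moreover have "low (pair theta ?n + 0) (eT ?n * (DP - 1 :: ('n, 'k) RT))"
    by (rule low_eT_mult[OF DP_unipotent])
  ultimately have "low (pair theta ?n) (Delta - eT ?n :: ('n, 'k) RT)" by simp
  from low_diff[OF wdet_est_leading this]
  have "low (pair theta ?n) (wdet est - (Delta :: ('n, 'k) RT))" by simp
  then have "low (pair theta (- ?n) + pair theta ?n) (eT (- ?n) * (wdet est - (Delta :: ('n, 'k) RT)))"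
    by (rule low_eT_mult)
  moreover have "eT (- ?n) * (wdet est - Delta) = (Q - 1) * (DP :: ('n, 'k) RT)"
  proof -
    have "eT (- ?n) * (wdet est - Delta) = (eT (- ?n) * eT ?n) * ((Q - 1) * (DP :: ('n, 'k) RT))"
      unfolding Q Delta_leading by (simp only: left_diff_distrib right_diff_distrib mult_1_left mult_ac)
    then show ?thesis by simp
  qed
  ultimately have "low 0 ((Q - 1) * DP)" by simp
  then have low: "low 0 (Q - 1)" by (rule unipotent_cancel[OF DP_unipotent])
  \<comment> \<open>Both \<open>wdet est\<close> and \<open>Delta\<close> change by a sign under
    \<open>w\<close>, so \<open>wact w Q\<close> is \<open>Q\<close> or \<open>- Q\<close>; either
    way the support is preserved.\<close>
  have stable: "w \<mu> \<in> Poly_Mapping.keys Q" if w: "w \<in> W" and \<mu>: "\<mu> \<in> Poly_Mapping.keys Q" for w \<mu>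
  proof -
    obtain c :: int where c: "c = 1 \<or> c = -1" "\<And>g :: ('n lat \<Rightarrow> 'n lat) \<Rightarrow> ('n, 'k) RT. wact w (wdet g) = of_int c * wdet g"
      using wdet_weyl[OF w, where 'k = 'k] by blast
    have "wact w Delta * wact w Q = of_int c * (Delta * Q)"
      using c(2)[of est] unfolding Q wact_mult[OF weyl_additive[OF w]] .
    then have "Delta * wact w Q = Delta * Q \<or> Delta * wact w Q = - (Delta * Q)"
      using c(1) Delta_weyl[OF w, where 'k = 'k] by (elim disjE; simp; metis minus_minus)
    then have "Delta * (wact w Q - Q) = 0 \<or> Delta * (wact w Q + Q) = 0"
      by (simp add: right_diff_distrib distrib_left eq_neg_iff_add_eq_0)
    then have "wact w Q = Q \<or> wact w Q = - Q"
      using Delta_cancel[of "wact w Q - Q"] Delta_cancel[of "wact w Q + Q"]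
      by (auto simp: eq_neg_iff_add_eq_0)
    then have "Poly_Mapping.keys (wact w Q) = Poly_Mapping.keys Q"
      by (auto simp: in_keys_iff)
    then show ?thesis
      using keys_wact_bij[OF weyl_bij[OF w], of Q] \<mu> by auto
  qed
  have "Q - 1 = 0"
  proof (rule ccontr)
    assume "Q - 1 \<noteq> 0"
    then obtain \<mu> where \<mu>: "\<mu> \<in> Poly_Mapping.keys (Q - 1)"
      by (metis all_not_in_conv keys_eq_empty)
    then have "pair theta \<mu> < 0" using low by (simp add: low_def)
    then have "\<mu> \<noteq> 0" by auto
    have keys: "\<nu> \<in> Poly_Mapping.keys Q \<longleftrightarrow> \<nu> \<in> Poly_Mapping.keys (Q - 1)" if "\<nu> \<noteq> 0" for \<nu>
      using that by (simp add: in_keys_iff lookup_minus lookup_one)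
    have "pair theta (w \<mu>) < 0" if "w \<in> W" for w
    proof -
      have "w \<mu> \<noteq> 0"
        using weyl_bij[OF that] Modules.additive.zero[OF weyl_additive[OF that]] \<open>\<mu> \<noteq> 0\<close>
        by (metis bij_is_inj inj_eq)
      then have "w \<mu> \<in> Poly_Mapping.keys (Q - 1)"
        using stable[OF that] keys \<mu> \<open>\<mu> \<noteq> 0\<close> by blast
      then show ?thesis using low by (simp add: low_def)
    qed
    \<comment> \<open>The whole orbit of \<mu> would have negative height, although it sums to
      zero.\<close>
    then have "(\<Sum>w\<in>W. pair theta (w \<mu>)) < 0"
      using finite_weyl weyl_group.id
      by (intro sum_strict_mono[where g = "\<lambda>_. 0", simplified]) auto
    then show False
      using sum_orbit[of \<mu>] by (simp flip: pair_sum_right)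
  qed
  then show ?thesis using Q by simp
qed

end

subsection \<open>Null sequences in the completion\<close>

definition nullseq :: "(nat \<Rightarrow> ('n::finite, 'k::field) RT) \<Rightarrow> bool" where
  "nullseq s \<longleftrightarrow> (\<forall>n. \<exists>N. \<forall>m\<ge>N. aug_pow n (s m))"

lemma ceq_iff_nullseq: "ceq s t \<longleftrightarrow> nullseq (\<lambda>m. s m - t m)"
  by (simp add: ceq_def nullseq_def)

lemma nullseq_add:
  assumes "nullseq s" "nullseq t"
  shows "nullseq (\<lambda>m. s m + t m)"
  unfolding nullseq_def
proof
  fix n
  obtain M N where "\<forall>m\<ge>M. aug_pow n (s m)" "\<forall>m\<ge>N. aug_pow n (t m)"
    using assms unfolding nullseq_def by blast
  then show "\<exists>N. \<forall>m\<ge>N. aug_pow n (s m + t m)"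
    by (intro exI[of _ "max M N"]) (auto intro: aug_pow.add)
qed

lemma nullseq_zero: "nullseq (\<lambda>m. 0)"
  by (simp add: nullseq_def)

lemma nullseq_sum: "(\<And>i. i \<in> A \<Longrightarrow> nullseq (s i)) \<Longrightarrow> nullseq (\<lambda>m. \<Sum>i\<in>A. s i m)"
  by (induction A rule: infinite_finite_induct) (auto intro: nullseq_add nullseq_zero)

lemma nullseq_mult: "nullseq s \<Longrightarrow> nullseq (\<lambda>m. s m * t m)"
  unfolding nullseq_def by (meson aug_pow_mult_right)

lemma nullseq_wact: "Modules.additive w \<Longrightarrow> nullseq s \<Longrightarrow> nullseq (\<lambda>m. wact w (s m))"
  unfolding nullseq_def by (meson aug_pow_wact)

lemma nullseq_uminus: "nullseq s \<Longrightarrow> nullseq (\<lambda>m. - s m)"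
  unfolding nullseq_def by (meson aug_pow_uminus)

lemma nullseq_diff: "nullseq s \<Longrightarrow> nullseq t \<Longrightarrow> nullseq (\<lambda>m. s m - t m)"
  using nullseq_add[OF _ nullseq_uminus, of s t] by simp

lemma nullseq_cancel:
  assumes "\<exists>c. \<not> aug_pow c f" "nullseq (\<lambda>m. f * s m)"
  shows "nullseq s"
  using assms aug_pow_cancel unfolding nullseq_def by meson

context adjoint_roots
begin

subsection \<open>Cramer's rule\<close>

definition cofac :: "('n lat \<Rightarrow> 'n lat) \<Rightarrow> ('n lat \<Rightarrow> 'n lat) \<Rightarrow> ('n, 'k::field) RT" where
  "cofac v u = detI W (\<lambda>v' w. if v' = v then (if w = u then 1 else 0) else wact w (est v'))"

lemma wdet_fun_upd: "wdet (est(v := x)) = detI W (\<lambda>v' w. if v' = v then wact w x else wact w (est v'))"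
  unfolding wdet_def by (rule detI_cong) simp

lemma wdet_row:
  "v \<in> W \<Longrightarrow> wdet (est(v := x)) = (\<Sum>u\<in>W. wact u x * cofac v u)"
  unfolding wdet_fun_upd cofac_def by (rule detI_expand_row[OF finite_weyl])

definition coord :: "('n lat \<Rightarrow> 'n lat) \<Rightarrow> ('n, 'k::field) RT \<Rightarrow> ('n, 'k) RT" where
  "coord v x = (SOME a. wdet (est(v := x)) = Delta * a)"

lemma coord: "wdet (est(v := x)) = Delta * coord v x"
  unfolding coord_def by (rule someI_ex) (use Delta_dvd_wdet in \<open>auto simp: dvd_def\<close>)

lemma Delta_mult_eq: "Delta * a = Delta * b \<Longrightarrow> a = b"
  using Delta_cancel[of "a - b"] by (simp add: algebra_simps)

text \<open>Cramer's rule at the column of the identity, where row \<open>v\<close> has the entry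
  \<open>est v\<close> itself.\<close>

lemma coord_expansion: "(\<Sum>v\<in>W. coord v x * est v) = x"
proof (rule Delta_mult_eq)
  have "Delta * (\<Sum>v\<in>W. coord v x * est v) = (\<Sum>v\<in>W. est v * wdet (est(v := x)))"
    unfolding coord sum_distrib_left by (simp only: mult_ac)
  also have "\<dots> = (\<Sum>v\<in>W. wact id (est v) * detI W (\<lambda>v' w. if v' = v then wact w x else wact w (est v')))"
    by (simp only: wact_id wdet_fun_upd)
  also have "\<dots> = wact id x * wdet est"
    unfolding wdet_def by (rule detI_cramer[OF finite_weyl weyl_group.id])
  finally show "Delta * (\<Sum>v\<in>W. coord v x * est v) = Delta * x"
    by (simp only: wact_id wdet_est mult.commute)
qed

text \<open>Numerator and denominator of the quotient both have the form \<open>wdet g\<close> and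
  change by the same sign.\<close>

lemma coord_invariant:
  assumes u: "u \<in> W"
  shows "wact u (coord v x) = (coord v x :: ('n, 'k::field) RT)"
proof (rule Delta_mult_eq)
  obtain c :: int where c: "c = 1 \<or> c = -1" "\<And>g :: ('n lat \<Rightarrow> 'n lat) \<Rightarrow> ('n, 'k) RT. wact u (wdet g) = of_int c * wdet g"
    using wdet_weyl[OF u, where 'k = 'k] by blast
  have "wact u (Delta * coord v x) = of_int c * (Delta * coord v x)"
    using c(2)[of "est(v := x)"] by (simp only: coord)
  then have "of_int c * (Delta * wact u (coord v x)) = of_int c * (Delta * coord v x)"
    using c(2)[of est] by (simp only: wdet_est wact_mult[OF weyl_additive[OF u]] mult.assoc)
  then show "Delta * wact u (coord v x) = Delta * coord v x"
    using c(1) by auto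
qed

lemma coord_diff: "v \<in> W \<Longrightarrow> Delta * (coord v x - coord v y) = (\<Sum>u\<in>W. wact u (x - y) * cofac v u)"
  by (simp add: right_diff_distrib wact_diff left_diff_distrib sum_subtractf wdet_row flip: coord)

lemma cauchy_coord:
  assumes v: "v \<in> W" and s: "cauchy s"
  shows "cauchy (\<lambda>m. coord v (s m) :: ('n, 'k::field) RT)"
  unfolding cauchy_def
proof
  fix n
  \<comment> \<open>Cancelling \<open>Delta\<close> costs \<open>c\<close> levels, hence the demand
    for level \<open>n + c\<close> below.\<close>
  obtain c where c: "\<not> aug_pow c (Delta :: ('n, 'k) RT)" using not_aug_pow_Delta by blast
  obtain N where N: "\<And>m m'. m \<ge> N \<Longrightarrow> m' \<ge> N \<Longrightarrow> aug_pow (n + c) (s m - s m')"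
    using s unfolding cauchy_def by blast
  have "aug_pow n (coord v (s m) - coord v (s m'))" if "m \<ge> N" "m' \<ge> N" for m m'
  proof (rule aug_pow_cancel[OF c])
    show "aug_pow (n + c) (Delta * (coord v (s m) - coord v (s m')))"
      unfolding coord_diff[OF v] using N[OF that]
      by (intro aug_pow_sum aug_pow_mult_right aug_pow_wact weyl_additive)
  qed
  then show "\<exists>N. \<forall>m\<ge>N. \<forall>m'\<ge>N. aug_pow n (coord v (s m) - coord v (s m'))" by blast
qed

text \<open>The coefficients are invariant only up to null sequences, so applying each
  \<open>w\<close> turns the single null relation into a full linear system with matrix
  \<open>wact w (est v)\<close>. Its cofactors show that \<open>Delta * d v\<close> is null, and
  \<open>Delta\<close> can be cancelled.\<close>

lemma nullseq_coefficients:
  fixes d :: "('n lat \<Rightarrow> 'n lat) \<Rightarrow> nat \<Rightarrow> ('n, 'k::field) RT"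
  assumes inv: "\<And>v w. v \<in> W \<Longrightarrow> w \<in> W \<Longrightarrow> nullseq (\<lambda>m. wact w (d v m) - d v m)"
    and null: "nullseq (\<lambda>m. \<Sum>v\<in>W. d v m * est v)"
    and v: "v \<in> W"
  shows "nullseq (d v)"
proof (rule nullseq_cancel)
  show "\<exists>c. \<not> aug_pow c (Delta :: ('n, 'k) RT)" by (rule not_aug_pow_Delta)
  have conj: "nullseq (\<lambda>m. \<Sum>v\<in>W. d v m * wact w (est v))" if w: "w \<in> W" for w
  proof -
    have "nullseq (\<lambda>m. wact w (\<Sum>v\<in>W. d v m * est v) - (\<Sum>v\<in>W. (wact w (d v m) - d v m) * wact w (est v)))"
      using w by (intro nullseq_diff nullseq_wact weyl_additive null nullseq_sum nullseq_mult inv)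
    then show ?thesis
      by (simp add: wact_sum wact_mult[OF weyl_additive[OF w]] left_diff_distrib sum_subtractf)
  qed
  have "Delta * d v m = (\<Sum>u\<in>W. (\<Sum>k\<in>W. d k m * wact u (est k)) * cofac v u)" for m
  proof -
    have "(\<Sum>u\<in>W. (\<Sum>k\<in>W. d k m * wact u (est k)) * cofac v u) =
        detI W (\<lambda>v' w. if v' = v then (\<Sum>k\<in>W. d k m * wact w (est k)) else wact w (est v'))"
      unfolding cofac_def by (rule detI_expand_row[OF finite_weyl v, symmetric])
    also have "\<dots> = (\<Sum>k\<in>W. d k m * detI W (\<lambda>v' w. if v' = v then wact w (est k) else wact w (est v')))"
      by (rule detI_row_sum[OF finite_weyl v])
    also have "\<dots> = (\<Sum>k\<in>W. d k m * (if k = v then wdet est else 0))"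
      unfolding wdet_def
      by (intro sum.cong HOL.refl arg_cong2[where f = "(*)"] detI_replace_row[OF finite_weyl v])
    also have "\<dots> = (\<Sum>k\<in>W. if k = v then d v m * Delta else 0)"
      by (intro sum.cong) (auto simp: wdet_est)
    also have "\<dots> = Delta * d v m"
      using finite_weyl v by (simp add: mult.commute)
    finally show ?thesis ..
  qed
  then show "nullseq (\<lambda>m. Delta * d v m)"
    by (simp only:) (intro nullseq_sum nullseq_mult conj)
qed

end

section \<open>Freeness of the completion over its invariants\<close>

theorem mainTheorem4:
  fixes \<Phi> :: "'n::finite lat set" and cor :: "'n lat \<Rightarrow> 'n lat" and h :: "'n lat"
  assumes datum: "adjoint_root_datum \<Phi> cor"
    and regular: "\<forall>\<alpha>\<in>\<Phi>. pair \<alpha> h \<noteq> 0"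
  defines "W \<equiv> weyl_group \<Phi> cor"
    and "Pos \<equiv> pos_roots \<Phi> h"
  shows "\<exists>e :: ('n lat \<Rightarrow> 'n lat) \<Rightarrow> nat \<Rightarrow> ('n, 'k::field) RT.
     (\<forall>w\<in>W. cauchy (e w)) \<and>
     (\<forall>x. cauchy x \<longrightarrow>
        (\<exists>a. (\<forall>w\<in>W. cinvariant W (a w)) \<and> ceq x (\<lambda>m. \<Sum>w\<in>W. a w m * e w m))) \<and>
     (\<forall>a b. (\<forall>w\<in>W. cinvariant W (a w)) \<longrightarrow> (\<forall>w\<in>W. cinvariant W (b w)) \<longrightarrow>
        ceq (\<lambda>m. \<Sum>w\<in>W. a w m * e w m) (\<lambda>m. \<Sum>w\<in>W. b w m * e w m) \<longrightarrow>
        (\<forall>w\<in>W. ceq (a w) (b w))) \<and>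
     ceq (\<lambda>m. detI W (\<lambda>v w. wact w (e v m)))
         (\<lambda>m. ((-1) ^ card Pos * eT (- (\<chi> i. (\<Sum>\<alpha>\<in>Pos. cor \<alpha>) $ i div 2))
               * (\<Prod>\<alpha>\<in>Pos. 1 - eT (cor \<alpha>))) ^ (card W div 2))"
proof -
  interpret adjoint_roots \<Phi> cor h
    by unfold_locales (fact datum, fact regular)
  \<comment> \<open>The basis consists of constant sequences, that is of elements of the group
    algebra.\<close>
  let ?e = "\<lambda>v (m :: nat). est v :: ('n, 'k) RT"
  have cauchy_e: "cauchy (?e w)" for w
    by (simp add: cauchy_def)
  have exists: "\<exists>a. (\<forall>w\<in>W. cinvariant W (a w)) \<and> ceq x (\<lambda>m. \<Sum>w\<in>W. a w m * ?e w m)"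
    if x: "cauchy x" for x :: "nat \<Rightarrow> ('n, 'k) RT"
  \<comment> \<open>Coordinates are taken term by term; invariance and expansion then hold exactly,
    and only the Cauchy property needs the filtration.\<close>
  proof (intro exI[of _ "\<lambda>v m. coord v (x m)"] conjI ballI)
    show "cinvariant W (\<lambda>m. coord w (x m))" if "w \<in> W" for w
      using that cauchy_coord[OF _ x] unfolding W_def
      by (simp add: cinvariant_def ceq_def coord_invariant)
    show "ceq x (\<lambda>m. \<Sum>w\<in>W. coord w (x m) * ?e w m)"
      unfolding W_def by (simp add: ceq_def coord_expansion)
  qed
  have unique: "\<forall>w\<in>W. ceq (a w) (b w)"
    if a: "\<forall>w\<in>W. cinvariant W (a w)" and b: "\<forall>w\<in>W. cinvariant W (b w)"
      and eq: "ceq (\<lambda>m. \<Sum>w\<in>W. a w m * ?e w m) (\<lambda>m. \<Sum>w\<in>W. b w m * ?e w m)"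
    for a b :: "('n lat \<Rightarrow> 'n lat) \<Rightarrow> nat \<Rightarrow> ('n, 'k) RT"
  proof
    fix v assume "v \<in> W"
    have "nullseq (\<lambda>m. a v m - b v m)"
    proof (rule nullseq_coefficients[where d = "\<lambda>v m. a v m - b v m"])
      show "v \<in> weyl_group \<Phi> cor" using \<open>v \<in> W\<close> by (simp only: W_def)
      show "nullseq (\<lambda>m. \<Sum>v\<in>weyl_group \<Phi> cor. (a v m - b v m) * est v)"
        using eq by (simp add: ceq_iff_nullseq left_diff_distrib sum_subtractf W_def)
      fix v w assume vw: "v \<in> weyl_group \<Phi> cor" "w \<in> weyl_group \<Phi> cor"
      then have "nullseq (\<lambda>m. wact w (a v m) - a v m)" "nullseq (\<lambda>m. wact w (b v m) - b v m)"
        using a b by (auto simp: cinvariant_def ceq_iff_nullseq W_def)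
      from nullseq_diff[OF this] show "nullseq (\<lambda>m. wact w (a v m - b v m) - (a v m - b v m))"
        by (simp add: wact_diff algebra_simps)
    qed
    then show "ceq (a v) (b v)" by (simp only: ceq_iff_nullseq)
  qed
  have "detI W (\<lambda>v w. wact w (est v)) =
      ((-1) ^ card Pos * eT (- (\<chi> i. (\<Sum>\<alpha>\<in>Pos. cor \<alpha>) $ i div 2))
         * (\<Prod>\<alpha>\<in>Pos. 1 - eT (cor \<alpha>)) :: ('n, 'k) RT) ^ (card W div 2)"
    using wdet_est[where 'k = 'k]
    unfolding wdet_def Delta_def Delta0_eq W_def Pos_def half_sum_coroots .
  then have det: "ceq (\<lambda>m. detI W (\<lambda>v w. wact w (?e v m)))
         (\<lambda>m. ((-1) ^ card Pos * eT (- (\<chi> i. (\<Sum>\<alpha>\<in>Pos. cor \<alpha>) $ i div 2))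
               * (\<Prod>\<alpha>\<in>Pos. 1 - eT (cor \<alpha>))) ^ (card W div 2))"
    by (simp only: ceq_def diff_self aug_pow_0) simp
  show ?thesis
  proof (intro exI[of _ ?e] conjI)
    show "\<forall>w\<in>W. cauchy (?e w)" by (intro ballI cauchy_e)
  qed (rule det | (intro allI impI, (rule exists unique; assumption)))+
qed

end
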